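(* Fix an integer $n\geq 1$. For $d\geq 1$ let $\mathcal{S}_d$ denote the set of all $d\times d$ symmetric matrices with all entries in $\{-1,1\}$ and all diagonal entries equal to $1$, and set \[ A:=\sup\Bigl\{\frac1d\sum_{i=1}^n\lambda_i(S)\,:\, d\geq n,\ S\in\mathcal{S}_d \Bigr\}, \] where $\lambda_1(S)\geq\dots\geq\lambda_d(S)$ are the eigenvalues of $S\in\mathcal{S}_d$ counted with multiplicity. For $d\geq n$ let $\mathcal{P}_{n,d}$ denote the set of all $d\times d$ orthogonal projection matrices of rank $n$, let $\mathcal{P}_n:=\bigcup_{d\geq n}\mathcal{P}_{n,d}$, and set \[ B:=\sup\bigl\{\rho(|P|)\,:\, P\in\mathcal{P}_n \text{ and } |P| \text{ is positive}\bigr\}. \] Then $A=B=\Pi_n$. Moreover, there exists a matrix $P\in\mathcal{P}_n$ such that $|P|$ is a positive matrix and $\rho(|P|)=B$.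
   Context: All Banach spaces and matrices are real. For a finite-dimensional linear subspace $E$ of a Banach space $F$, $\Pi(E,F)$ denotes the minimal operator norm of a linear projection of $F$ onto $E$. The (absolute) projection constant of a finite-dimensional Banach space $E$ is $\Pi(E):=\Pi(E,\ell_\infty)$, where $E$ is regarded as a subspace of $\ell_\infty$ via a linear isometric embedding (the value does not depend on the embedding). The maximal projection constant of order $n$ is $\Pi_n:=\max\{\Pi(E): E \text{ a real Banach space},\ \dim(E)=n\}$. An orthogonal projection matrix is a real symmetric idempotent matrix. $|P|$ is the matrix obtained from $P$ by taking the absolute value of every entry; a matrix is positive if all its entries are strictly positive; $\rho(\cdot)$ denotes the spectral radius. *)

theory Defs
  imports
    "HOL-Analysis.Bounded_Continuous_Function"
    "HOL-Analysis.Operator_Norm"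
    "Jordan_Normal_Form.Spectral_Radius"
    "Jordan_Normal_Form.DL_Rank"
begin

text \<open>
  The space \<open>nat \<Rightarrow>\<^sub>C real\<close> of bounded continuous functions on the discrete space \<open>nat\<close>,
  with the supremum norm, is the real Banach space of bounded sequences.
\<close>

type_synonym linfty = "nat \<Rightarrow>\<^sub>C real"

text \<open>
  Only bounded projections matter for the minimal operator norm, and \<open>onorm\<close> is
  the operator norm only for those. For a finite-dimensional subspace \<open>E\<close> there is
  a bounded projection and, by a compactness argument, the infimum is attained.
\<close>

definition projections_onto :: "'a::real_normed_vector set \<Rightarrow> ('a \<Rightarrow> 'a) set" where
  "projections_onto E = {Q. bounded_linear Q \<and> range Q = E \<and> (\<forall>x\<in>E. Q x = x)}"

definition relative_projection_constant :: "'a::real_normed_vector set \<Rightarrow> real" where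
  "relative_projection_constant E = Inf (onorm ` projections_onto E)"

text \<open>
  Up to the choice of a basis, a real Banach space of dimension \<open>n\<close> is the coordinate space
  \<open>carrier_vec n\<close> with a norm \<open>N\<close>; completeness is automatic. The values of \<open>N\<close> outside
  \<open>carrier_vec n\<close> are irrelevant.
\<close>

definition norm_on :: "nat \<Rightarrow> (real Matrix.vec \<Rightarrow> real) \<Rightarrow> bool" where
  "norm_on n N \<longleftrightarrow>
     (\<forall>x\<in>carrier_vec n. 0 \<le> N x) \<and>
     (\<forall>x\<in>carrier_vec n. N x = 0 \<longleftrightarrow> x = 0\<^sub>v n) \<and>
     (\<forall>c. \<forall>x\<in>carrier_vec n. N (c \<cdot>\<^sub>v x) = \<bar>c\<bar> * N x) \<and>
     (\<forall>x\<in>carrier_vec n. \<forall>y\<in>carrier_vec n. N (x + y) \<le> N x + N y)"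

definition isometric_embedding ::
  "nat \<Rightarrow> (real Matrix.vec \<Rightarrow> real) \<Rightarrow> (real Matrix.vec \<Rightarrow> linfty) \<Rightarrow> bool" where
  "isometric_embedding n N \<phi> \<longleftrightarrow>
     (\<forall>x\<in>carrier_vec n. \<forall>y\<in>carrier_vec n. \<phi> (x + y) = \<phi> x + \<phi> y) \<and>
     (\<forall>c. \<forall>x\<in>carrier_vec n. \<phi> (c \<cdot>\<^sub>v x) = c *\<^sub>R \<phi> x) \<and>
     (\<forall>x\<in>carrier_vec n. norm (\<phi> x) = N x)"

text \<open>
  An isometric embedding exists for every norm, because finite-dimensional spaces are separable,
  and the value below is the same for all embeddings.
\<close>

definition projection_constant :: "nat \<Rightarrow> (real Matrix.vec \<Rightarrow> real) \<Rightarrow> real" where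
  "projection_constant n N =
     relative_projection_constant ((SOME \<phi>. isometric_embedding n N \<phi>) ` carrier_vec n)"

text \<open>\<open>Greatest\<close> is a maximum, not a supremum: it is determined only if it is attained.\<close>

definition maximal_projection_constant :: "nat \<Rightarrow> real" where
  "maximal_projection_constant n =
     (GREATEST c. c \<in> {projection_constant n N | N. norm_on n N})"

definition sign_matrices :: "nat \<Rightarrow> real mat set" where
  "sign_matrices d = {S \<in> carrier_mat d d. transpose_mat S = S \<and>
     (\<forall>i<d. \<forall>j<d. S $$ (i, j) \<in> {-1, 1}) \<and> (\<forall>i<d. S $$ (i, i) = 1)}"

text \<open>
  The real eigenvalues in decreasing order, repeated according to their multiplicity as roots of the
  characteristic polynomial, which for a real symmetric matrix is also the dimension of the
  eigenspace. The indices start from 0.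
\<close>

definition eigenvalues_desc :: "real mat \<Rightarrow> real list" where
  "eigenvalues_desc S = rev (sorted_list_of_multiset (proots (char_poly S)))"

definition orthogonal_projections :: "nat \<Rightarrow> nat \<Rightarrow> real mat set" where
  "orthogonal_projections n d = {P \<in> carrier_mat d d.
     transpose_mat P = P \<and> P * P = P \<and> vec_space.rank d P = n}"

definition orthogonal_projections_of_rank :: "nat \<Rightarrow> real mat set" where
  "orthogonal_projections_of_rank n = (\<Union>d\<in>{n..}. orthogonal_projections n d)"

definition abs_mat :: "real mat \<Rightarrow> real mat" where
  "abs_mat P = map_mat abs P"

definition positive_mat :: "real mat \<Rightarrow> bool" where
  "positive_mat M \<longleftrightarrow> (\<forall>i<dim_row M. \<forall>j<dim_col M. 0 < M $$ (i, j))"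

text \<open>\<open>spectral_radius\<close> takes complex matrices.\<close>

definition real_spectral_radius :: "real mat \<Rightarrow> real" where
  "real_spectral_radius M = spectral_radius (map_mat complex_of_real M)"

definition sign_matrix_sup :: "nat \<Rightarrow> real" where
  "sign_matrix_sup n =
     Sup {(\<Sum>i<n. eigenvalues_desc S ! i) / real d | d S. n \<le> d \<and> S \<in> sign_matrices d}"

definition projection_sup :: "nat \<Rightarrow> real" where
  "projection_sup n =
     Sup {real_spectral_radius (abs_mat P) | P.
            P \<in> orthogonal_projections_of_rank n \<and> positive_mat (abs_mat P)}"

end

theory Submission
  imports Defs "HOL-Analysis.Function_Topology"
begin

text \<open>
  All three numbers are values of one finite-dimensional maximisation problem. A tight frame is a
  family of vectors \<open>u\<^sub>i\<close> in \<open>n\<close>-dimensional space whose matrix \<open>U\<close> has orthonormal columns; the matrices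
  \<open>U U\<^sup>T\<close> with entries \<open>\<langle>u\<^sub>i, u\<^sub>j\<rangle>\<close> are the orthogonal projections of rank \<open>n\<close>. Let \<open>B\<close> be the maximum of
  \<open>\<Sum>\<^sub>i\<^sub>j t\<^sub>i t\<^sub>j |\<langle>u\<^sub>i, u\<^sub>j\<rangle>|\<close> over all finite tight frames and all unit vectors \<open>t \<ge> 0\<close>.

  The maximum is attained. Write \<open>v\<^sub>i = u\<^sub>i / t\<^sub>i\<close> and \<open>w\<^sub>i = t\<^sub>i\<^sup>2\<close>: the constraints become linear in the
  weights \<open>w\<close> and the value becomes the quadratic form with kernel \<open>|\<langle>v\<^sub>i, v\<^sub>j\<rangle>|\<close>. If there are many
  vectors, then more than \<open>n\<^sup>2 + 1\<close> of them lie in a narrow cone, where the kernel is the inner product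
  itself and hence positive semidefinite. So there is a signed weight on this cone that keeps the
  constraints and along which the value is convex; following it in one of its two directions does
  not decrease the value and removes a vector (\<open>isotropic_reduce\<close>). Hence the number of vectors is
  bounded in terms of \<open>n\<close>, and compactness gives a maximum (\<open>frame_maximum_exists\<close>). A maximiser can
  be taken with all \<open>t\<^sub>i > 0\<close> (\<open>weighted_frame_spread\<close>).

  At a maximiser, \<open>t\<close> is a Perron eigenvector of the matrix \<open>|\<langle>u\<^sub>i, u\<^sub>j\<rangle>|\<close>, and the column space of \<open>U\<close>
  is invariant under the matrix \<open>t\<^sub>i t\<^sub>j S\<^sub>i\<^sub>j\<close> for every choice of signs \<open>S\<close> with
  \<open>S\<^sub>i\<^sub>j \<langle>u\<^sub>i, u\<^sub>j\<rangle> = |\<langle>u\<^sub>i, u\<^sub>j\<rangle>|\<close> (\<open>invariant\<close>). The sign at an orthogonal pair is free, and comparing two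
  choices puts a unit coordinate vector into the column space, which forces \<open>B = 1\<close>. Since \<open>B > 1\<close>
  for \<open>n \<ge> 2\<close>, no inner product vanishes (\<open>gram_nonzero\<close>). So \<open>|U U\<^sup>T|\<close> is a positive matrix with
  spectral radius \<open>B\<close>; that no projection of rank \<open>n\<close> exceeds \<open>B\<close> follows by taking absolute values in
  an eigenvector equation.

  For sign matrices, the sum of the \<open>n\<close> largest eigenvalues of \<open>S\<close> is the maximum of the trace of
  \<open>U\<^sup>T S U\<close> over tight frames (\<open>ky_fan\<close>); divided by the size of \<open>S\<close>, this trace is the frame value for
  constant \<open>t\<close> with \<open>S\<close> in place of the signs of the inner products. Rational weights are reduced to constant ones by repeating
  vectors (\<open>sign_matrix_blow_up\<close>), and general weights are limits of rational ones.

  For projection constants, consider a space \<open>E\<close> of \<open>d\<close>-tuples with the maximum norm. For positive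
  weights \<open>w\<close> on the coordinates, the orthogonal projection onto \<open>E\<close> with respect to the inner product
  weighted by \<open>w\<close> has row sums of absolute values whose weighted average is at most \<open>B\<close>
  (\<open>weighted_projection\<close>). A minimax argument turns this into a single projection all of whose row
  sums are at most \<open>B + \<epsilon>\<close> (\<open>small_projection\<close>), and compactness of the unit sphere passes to spaces
  embedded into all bounded sequences. Conversely, a maximiser defines the polyhedral norm
  \<open>max\<^sub>i |\<langle>v\<^sub>i, x\<rangle>|\<close>. By the invariance, the signs weighted by \<open>w\<close> define an operator of the space into
  itself with trace \<open>B\<close> and nuclear norm at most one, so by trace duality every projection onto the
  space has norm at least \<open>B\<close> (\<open>onorm_projection_ge\<close>).
\<close>

section \<open>Tight frames\<close>

text \<open>
  Vectors are functions, and only their first \<open>n\<close> coordinates count, so that dimensions and numbers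
  of vectors can vary inside a proof.
\<close>

definition ip :: "nat \<Rightarrow> (nat \<Rightarrow> real) \<Rightarrow> (nat \<Rightarrow> real) \<Rightarrow> real" where
  "ip n x y = (\<Sum>k<n. x k * y k)"

text \<open>
  The rows \<open>u i\<close> of a matrix with \<open>n\<close> orthonormal columns; \<open>ip n (u i) (u j)\<close> are then the entries of the
  orthogonal projection onto its column space.
\<close>

definition tight :: "nat \<Rightarrow> 'i set \<Rightarrow> ('i \<Rightarrow> nat \<Rightarrow> real) \<Rightarrow> bool" where
  "tight n I u \<longleftrightarrow> (\<forall>k<n. \<forall>l<n. (\<Sum>i\<in>I. u i k * u i l) = (if k = l then 1 else 0))"

definition bform :: "'i set \<Rightarrow> ('i \<Rightarrow> 'i \<Rightarrow> real) \<Rightarrow> ('i \<Rightarrow> real) \<Rightarrow> ('i \<Rightarrow> real) \<Rightarrow> real" where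
  "bform I X x y = (\<Sum>i\<in>I. \<Sum>j\<in>I. X i j * x i * y j)"

lemma ip_commute: "ip n x y = ip n y x"
  by (simp add: ip_def mult.commute)

lemma ip_scale_left: "ip n (\<lambda>k. c * x k) y = c * ip n x y"
  by (simp add: ip_def sum_distrib_left mult.assoc)

lemma ip_scale_right: "ip n x (\<lambda>k. c * y k) = c * ip n x y"
  by (simp add: ip_def sum_distrib_left mult.left_commute)

lemma ip_add_left: "ip n (\<lambda>k. x k + x' k) y = ip n x y + ip n x' y"
  by (simp add: ip_def sum.distrib algebra_simps)

lemma ip_add_right: "ip n x (\<lambda>k. y k + y' k) = ip n x y + ip n x y'"
  by (simp add: ip_def sum.distrib algebra_simps)

lemma ip_sum_left: "ip n (\<lambda>k. \<Sum>i\<in>I. f i k) y = (\<Sum>i\<in>I. ip n (f i) y)"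
  unfolding ip_def sum_distrib_right by (rule sum.swap)

lemma ip_sum_right: "ip n x (\<lambda>k. \<Sum>i\<in>I. f i k) = (\<Sum>i\<in>I. ip n x (f i))"
  unfolding ip_def sum_distrib_left by (rule sum.swap)

lemma ip_self_nonneg: "0 \<le> ip n x x"
  by (simp add: ip_def sum_nonneg)

lemma ip_zero_iff: "ip n x x = 0 \<longleftrightarrow> (\<forall>k<n. x k = 0)"
  by (auto simp: ip_def sum_nonneg_eq_0_iff)

lemma ip_cong: "(\<And>k. k < n \<Longrightarrow> x k = x' k) \<Longrightarrow> (\<And>k. k < n \<Longrightarrow> y k = y' k) \<Longrightarrow> ip n x y = ip n x' y'"
  by (simp add: ip_def)

lemma tightD: "tight n I u \<Longrightarrow> k < n \<Longrightarrow> l < n \<Longrightarrow> (\<Sum>i\<in>I. u i k * u i l) = (if k = l then 1 else 0)"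
  by (simp add: tight_def)

lemma tight_reconstruct:
  assumes "tight n I u" "k < n"
  shows "(\<Sum>i\<in>I. ip n (u i) x * u i k) = x k"
proof -
  have "(\<Sum>i\<in>I. ip n (u i) x * u i k) = (\<Sum>l<n. \<Sum>i\<in>I. u i l * x l * u i k)"
    unfolding ip_def sum_distrib_right by (rule sum.swap)
  also have "\<dots> = (\<Sum>l<n. x l * (\<Sum>i\<in>I. u i l * u i k))"
    by (simp add: sum_distrib_left mult_ac)
  also have "\<dots> = (\<Sum>l<n. if l = k then x l else 0)"
    by (intro sum.cong) (use assms in \<open>auto simp: tightD\<close>)
  finally show ?thesis using assms by simp
qed

lemma tight_parseval:
  assumes "tight n I u"
  shows "(\<Sum>i\<in>I. ip n x (u i) * ip n (u i) y) = ip n x y"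
proof -
  have "(\<Sum>i\<in>I. ip n x (u i) * ip n (u i) y) = (\<Sum>k<n. \<Sum>i\<in>I. x k * (u i k * ip n (u i) y))"
    unfolding ip_def[of n x] sum_distrib_right by (subst sum.swap) (simp add: mult_ac)
  also have "\<dots> = (\<Sum>k<n. x k * (\<Sum>i\<in>I. ip n (u i) y * u i k))"
    by (simp add: sum_distrib_left mult_ac)
  also have "\<dots> = ip n x y"
    unfolding ip_def[of n x y] by (intro sum.cong) (use assms in \<open>auto simp: tight_reconstruct\<close>)
  finally show ?thesis .
qed

lemma tight_trace:
  assumes "tight n I u"
  shows "(\<Sum>i\<in>I. ip n (u i) (u i)) = n"
proof -
  have "(\<Sum>i\<in>I. ip n (u i) (u i)) = (\<Sum>k<n. \<Sum>i\<in>I. u i k * u i k)"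
    unfolding ip_def by (rule sum.swap)
  also have "\<dots> = (\<Sum>k<n. 1)"
    by (intro sum.cong) (use assms in \<open>auto simp: tightD\<close>)
  finally show ?thesis by simp
qed

text \<open>
  The sum is the squared Frobenius norm of the complementary projection, which equals its trace. Its
  sign gives \<open>n \<le> card I\<close>, and its vanishing gives that a square matrix with orthonormal columns has
  orthonormal rows.
\<close>

lemma tight_defect:
  assumes "tight n I u" "finite I"
  shows "(\<Sum>i\<in>I. \<Sum>j\<in>I. ((if i = j then 1 else 0) - ip n (u i) (u j))\<^sup>2) = real (card I) - n"
proof -
  have "(\<Sum>j\<in>I. ((if i = j then 1 else 0) - ip n (u i) (u j))\<^sup>2) = 1 - ip n (u i) (u i)" if "i \<in> I" for i
  proof -
    have "(\<Sum>j\<in>I. ((if i = j then 1 else 0) - ip n (u i) (u j))\<^sup>2)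
       = (\<Sum>j\<in>I. (if i = j then 1 - 2 * ip n (u i) (u j) else 0) + ip n (u i) (u j) * ip n (u j) (u i))"
      by (intro sum.cong) (auto simp: power2_eq_square algebra_simps ip_commute[of n _ "u i"])
    also have "\<dots> = 1 - 2 * ip n (u i) (u i) + ip n (u i) (u i)"
      using assms that by (simp add: sum.distrib tight_parseval)
    finally show ?thesis by simp
  qed
  then show ?thesis using tight_trace[OF assms(1)] by (simp add: sum_subtractf)
qed

lemma tight_card:
  assumes "tight n I u" "finite I" shows "n \<le> card I"
proof -
  have "0 \<le> real (card I) - n"
    unfolding tight_defect[OF assms, symmetric] by (intro sum_nonneg) auto
  then show ?thesis by simp
qed

lemma tight_square:
  assumes "tight n I u" "finite I" "card I = n" "i \<in> I" "j \<in> I"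
  shows "ip n (u i) (u j) = (if i = j then 1 else 0)"
proof -
  have z: "(\<Sum>i\<in>I. \<Sum>j\<in>I. ((if i = j then 1 else 0) - ip n (u i) (u j))\<^sup>2) = 0"
    using tight_defect[OF assms(1,2)] assms(3) by simp
  have "(\<Sum>j\<in>I. ((if i = j then 1 else 0) - ip n (u i) (u j))\<^sup>2) = 0"
    using z assms by (subst (asm) sum_nonneg_eq_0_iff) (auto intro!: sum_nonneg)
  then have "((if i = j then 1 else 0) - ip n (u i) (u j))\<^sup>2 = 0"
    using assms by (subst (asm) sum_nonneg_eq_0_iff) auto
  then show ?thesis by simp
qed

text \<open>
  The second factor is the image of the \<open>i\<close>-th unit vector under the projection onto the orthogonal
  complement of the columns.
\<close>

lemma tight_residual:
  assumes "tight n I u" "finite I" "i \<in> I" "k < n"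
  shows "(\<Sum>j\<in>I. u j k * ((if i = j then 1 else 0) - ip n (u i) (u j))) = 0"
proof -
  have "(\<Sum>j\<in>I. u j k * ((if i = j then 1 else 0) - ip n (u i) (u j)))
     = (\<Sum>j\<in>I. (if i = j then u j k else 0) - ip n (u j) (u i) * u j k)"
    by (intro sum.cong) (auto simp: algebra_simps ip_commute)
  also have "\<dots> = 0"
    using assms by (simp add: sum_subtractf tight_reconstruct)
  finally show ?thesis .
qed

lemma tight_orthogonal_exists:
  assumes "tight n I u" "finite I" "n < card I"
  obtains b where "(\<Sum>i\<in>I. b i * b i) = 1" "\<And>k. k < n \<Longrightarrow> (\<Sum>i\<in>I. u i k * b i) = 0"
proof -
  have "(\<Sum>i\<in>I. \<Sum>j\<in>I. ((if i = j then 1 else 0) - ip n (u i) (u j))\<^sup>2) \<noteq> 0"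
    using tight_defect[OF assms(1,2)] assms(3) by simp
  then obtain i where i: "i \<in> I" "(\<Sum>j\<in>I. ((if i = j then 1 else 0) - ip n (u i) (u j))\<^sup>2) \<noteq> 0"
    by (meson sum.neutral)
  define c where "c j = (if i = j then 1 else 0) - ip n (u i) (u j)" for j
  define s where "s = (\<Sum>j\<in>I. (c j)\<^sup>2)"
  have s: "s > 0" using i(2) by (simp add: s_def c_def sum_nonneg order.not_eq_order_implies_strict)
  show thesis
  proof (rule that[of "\<lambda>j. c j / sqrt s"])
    show "(\<Sum>i\<in>I. c i / sqrt s * (c i / sqrt s)) = 1"
    proof -
      have "(\<Sum>i\<in>I. c i / sqrt s * (c i / sqrt s)) = (\<Sum>i\<in>I. (c i)\<^sup>2 / s)"
        using s by (intro sum.cong) (auto simp: power2_eq_square)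
      also have "\<dots> = s / s" unfolding sum_divide_distrib[symmetric] s_def[symmetric] ..
      finally show ?thesis using s by simp
    qed
    show "(\<Sum>i\<in>I. u i k * (c i / sqrt s)) = 0" if "k < n" for k
      using tight_residual[OF assms(1,2) i(1) that]
      by (simp add: c_def sum_divide_distrib[symmetric])
  qed
qed

section \<open>First-order conditions for quadratic forms\<close>

text \<open>
  The first-order condition at \<open>s = 0\<close>, in the form in which all variations below produce it.
\<close>

lemma linear_le_quadratic_imp_zero:
  fixes a b :: real
  assumes "\<And>s. s * a \<le> s\<^sup>2 * b"
  shows "a = 0"
proof (rule ccontr)
  assume a: "a \<noteq> 0"
  define r where "r = 1 / (\<bar>b\<bar> + 1)"
  have r: "r > 0" "r * b < 1" by (auto simp: r_def field_simps)
  have "r * a * a \<le> (r * a)\<^sup>2 * b" using assms[of "r * a"] .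
  then have "(r * a\<^sup>2) * 1 \<le> (r * a\<^sup>2) * (r * b)" by (simp add: power2_eq_square mult_ac)
  then have "1 \<le> r * b" using r a by simp
  with r show False by simp
qed

lemma bform_commute:
  assumes "\<And>i j. i \<in> I \<Longrightarrow> j \<in> I \<Longrightarrow> X i j = X j i"
  shows "bform I X x y = bform I X y x"
  unfolding bform_def by (subst sum.swap) (auto intro!: sum.cong simp: assms)

lemma bform_add_left: "bform I X (\<lambda>i. x i + x' i) y = bform I X x y + bform I X x' y"
  by (simp add: bform_def sum.distrib algebra_simps)

lemma bform_add_right: "bform I X x (\<lambda>i. y i + y' i) = bform I X x y + bform I X x y'"
  by (simp add: bform_def sum.distrib algebra_simps)

lemma bform_scale_left: "bform I X (\<lambda>i. c * x i) y = c * bform I X x y"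
  by (simp add: bform_def sum_distrib_left mult_ac)

lemma bform_scale_right: "bform I X x (\<lambda>i. c * y i) = c * bform I X x y"
  by (simp add: bform_def sum_distrib_left mult_ac)

lemma bform_quadratic:
  assumes "\<And>i j. i \<in> I \<Longrightarrow> j \<in> I \<Longrightarrow> X i j = X j i"
  shows "bform I X (\<lambda>i. x i + s * y i) (\<lambda>i. x i + s * y i)
     = bform I X x x + 2 * s * bform I X x y + s\<^sup>2 * bform I X y y"
  using bform_commute[where X=X and I=I and x=y and y=x, OF assms]
  by (simp add: bform_add_left bform_add_right bform_scale_left bform_scale_right power2_eq_square algebra_simps)

text \<open>
  The bound is required only on the line through \<open>x\<close> in direction \<open>y\<close>, so that the lemma also applies to
  maximisers on a subspace.
\<close>

lemma rayleigh_stationary: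
  assumes sym: "\<And>i j. i \<in> I \<Longrightarrow> j \<in> I \<Longrightarrow> X i j = X j i"
    and le: "\<And>s. bform I X (\<lambda>i. x i + s * y i) (\<lambda>i. x i + s * y i)
               \<le> c * (\<Sum>i\<in>I. (x i + s * y i)\<^sup>2)"
    and eq: "bform I X x x = c * (\<Sum>i\<in>I. (x i)\<^sup>2)"
  shows "bform I X x y = c * (\<Sum>i\<in>I. x i * y i)"
proof -
  have sq: "(\<Sum>i\<in>I. (x i + s * y i)\<^sup>2) = (\<Sum>i\<in>I. (x i)\<^sup>2) + 2 * s * (\<Sum>i\<in>I. x i * y i) + s\<^sup>2 * (\<Sum>i\<in>I. (y i)\<^sup>2)" for s
    by (simp add: power2_sum power_mult_distrib sum.distrib sum_distrib_left mult_ac)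
  have "s * (2 * (bform I X x y - c * (\<Sum>i\<in>I. x i * y i)))
      \<le> s\<^sup>2 * (c * (\<Sum>i\<in>I. (y i)\<^sup>2) - bform I X y y)" for s
  proof -
    have "bform I X x x + 2 * s * bform I X x y + s\<^sup>2 * bform I X y y
       = bform I X (\<lambda>i. x i + s * y i) (\<lambda>i. x i + s * y i)"
      by (rule bform_quadratic[symmetric]) (rule sym)
    also note le[of s]
    finally have *: "bform I X x x + 2 * s * bform I X x y + s\<^sup>2 * bform I X y y
       \<le> c * ((\<Sum>i\<in>I. (x i)\<^sup>2) + 2 * s * (\<Sum>i\<in>I. x i * y i) + s\<^sup>2 * (\<Sum>i\<in>I. (y i)\<^sup>2))"
      by (simp only: sq)
    have arith: "c * p + 2 * s * q + s\<^sup>2 * r \<le> c * (p + 2 * s * q' + s\<^sup>2 * r')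
      \<Longrightarrow> s * (2 * (q - c * q')) \<le> s\<^sup>2 * (c * r' - r)" for p q r q' r' :: real
      by (simp add: algebra_simps)
    show ?thesis by (rule arith) (use * in \<open>simp only: eq\<close>)
  qed
  from linear_le_quadratic_imp_zero[OF this] show ?thesis by simp
qed

lemma bform_unit: 
  assumes "finite I" "i \<in> I"
  shows "bform I X x (\<lambda>j. if j = i then 1 else 0) = (\<Sum>j\<in>I. X j i * x j)"
proof -
  have "bform I X x (\<lambda>j. if j = i then 1 else 0) = (\<Sum>a\<in>I. \<Sum>b\<in>I. if b = i then X a b * x a else 0)"
    unfolding bform_def by (intro sum.cong refl) auto
  then show ?thesis using assms by simp
qed

lemma bform_eq: "bform I X x y = (\<Sum>i\<in>I. (\<Sum>j\<in>I. X i j * y j) * x i)"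
  unfolding bform_def by (simp add: sum_distrib_right sum_distrib_left mult_ac)

lemma frame_trace:
  "(\<Sum>k<n. bform {..<d} X (\<lambda>i. v i k) (\<lambda>i. v i k)) = (\<Sum>i<d. \<Sum>j<d. X i j * ip n (v i) (v j))"
  unfolding bform_def ip_def sum_distrib_left by (subst sum.swap, subst (2) sum.swap) (simp add: mult.assoc)

text \<open>
  Tilting column \<open>k\<close> towards a vector \<open>b\<close> orthogonal to all columns, and normalising, gives another
  frame; the first-order condition says that \<open>X\<close> maps column \<open>k\<close> to a vector orthogonal to \<open>b\<close>. With \<open>b\<close> the
  residual of the \<open>i\<close>-th unit vector, this is coordinate \<open>i\<close> of the statement that \<open>X\<close> preserves the
  column space.
\<close>

lemma trace_maximal_invariant:
  fixes u :: "'i \<Rightarrow> nat \<Rightarrow> real"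
  assumes fin: "finite I" and sym: "\<And>i j. i \<in> I \<Longrightarrow> j \<in> I \<Longrightarrow> X i j = X j i"
    and tight: "tight n I u"
    and max: "\<And>u'. tight n I u' \<Longrightarrow> (\<Sum>k<n. bform I X (\<lambda>i. u' i k) (\<lambda>i. u' i k)) \<le> (\<Sum>k<n. bform I X (\<lambda>i. u i k) (\<lambda>i. u i k))"
    and k: "k < n" and i: "i \<in> I"
  shows "(\<Sum>j\<in>I. X i j * u j k) = (\<Sum>l<n. u i l * bform I X (\<lambda>i. u i l) (\<lambda>i. u i k))"
proof -
  define b where "b j = (if i = j then 1 else 0) - ip n (u i) (u j)" for j
  have b: "(\<Sum>j\<in>I. u j l * b j) = 0" if "l < n" for l
    using tight_residual[OF tight fin i that] by (simp add: b_def)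
  define \<beta> where "\<beta> = (\<Sum>j\<in>I. b j * b j)"
  have \<beta>: "\<beta> \<ge> 0" by (simp add: \<beta>_def sum_nonneg)
  let ?c = "\<lambda>k i. u i k"
  have "s * (2 * bform I X (?c k) b) \<le> s\<^sup>2 * (\<beta> * bform I X (?c k) (?c k) - bform I X b b)" for s
  proof -
    \<comment> \<open>The squared length of the tilted column.\<close>
    define r where "r = 1 + s\<^sup>2 * \<beta>"
    have r: "r > 0" using \<beta> by (simp add: r_def add_pos_nonneg)
    define u' where "u' j l = (if l = k then (1 / sqrt r) * (u j k + s * b j) else u j l)" for j l
    have t1: "(\<Sum>j\<in>I. u' j k * u' j l) = (1 / sqrt r) * ((\<Sum>j\<in>I. u j k * u j l) + s * (\<Sum>j\<in>I. u j l * b j))" if "l \<noteq> k" for l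
    proof -
      have "(\<Sum>j\<in>I. u' j k * u' j l) = (\<Sum>j\<in>I. (1 / sqrt r) * (u j k * u j l + s * (u j l * b j)))"
        using that by (intro sum.cong refl) (simp add: u'_def distrib_right distrib_left mult_ac)
      then show ?thesis by (simp only: sum_distrib_left[symmetric] sum.distrib)
    qed
    have "(\<Sum>j\<in>I. u' j k * u' j k) = (\<Sum>j\<in>I. u j k * u j k + 2 * s * (u j k * b j) + s\<^sup>2 * (b j * b j)) / r"
      using r unfolding sum_divide_distrib
      by (intro sum.cong) (auto simp: u'_def field_simps power2_eq_square)
    also have "\<dots> = 1"
      using k b[OF k] tightD[OF tight k k] r by (simp add: sum.distrib sum_distrib_left[symmetric] \<beta>_def[symmetric] r_def)
    finally have t2: "(\<Sum>j\<in>I. u' j k * u' j k) = 1" .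
    have "(\<Sum>j\<in>I. u' j l * u' j m) = (if l = m then 1 else 0)" if lm: "l < n" "m < n" for l m
    proof -
      consider "l = k" "m = k" | "l = k" "m \<noteq> k" | "l \<noteq> k" "m = k" | "l \<noteq> k" "m \<noteq> k" by blast
      then show ?thesis
      proof cases
        case 1 then show ?thesis using t2 by simp
      next
        case 2 then show ?thesis using t1[of m] tightD[OF tight k lm(2)] b[OF lm(2)] by simp
      next
        case 3 then show ?thesis using t1[of l] tightD[OF tight k lm(1)] b[OF lm(1)] by (simp add: mult.commute)
      next
        case 4 then show ?thesis using tightD[OF tight lm] by (simp add: u'_def)
      qed
    qed
    then have "tight n I u'" by (simp add: tight_def)
    from max[OF this] have "bform I X (?c k) (?c k) + (\<Sum>l\<in>{..<n}-{k}. bform I X (?c l) (?c l)) \<ge>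
      bform I X (\<lambda>i. u' i k) (\<lambda>i. u' i k) + (\<Sum>l\<in>{..<n}-{k}. bform I X (\<lambda>i. u' i l) (\<lambda>i. u' i l))"
      using k by (subst (asm) (1 2) sum.remove[of _ k]) auto
    moreover have "(\<Sum>l\<in>{..<n}-{k}. bform I X (\<lambda>i. u' i l) (\<lambda>i. u' i l)) = (\<Sum>l\<in>{..<n}-{k}. bform I X (?c l) (?c l))"
      by (intro sum.cong) (auto simp: u'_def)
    ultimately have "bform I X (\<lambda>i. u' i k) (\<lambda>i. u' i k) \<le> bform I X (?c k) (?c k)" by simp
    moreover have "bform I X (\<lambda>i. u' i k) (\<lambda>i. u' i k) = (1 / sqrt r) * ((1 / sqrt r) * bform I X (\<lambda>i. u i k + s * b i) (\<lambda>i. u i k + s * b i))"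
      by (simp only: u'_def if_True simp_thms bform_scale_left bform_scale_right)
    ultimately have "bform I X (\<lambda>i. u i k + s * b i) (\<lambda>i. u i k + s * b i) \<le> r * bform I X (?c k) (?c k)"
      using r by (simp add: field_simps)
    note * = this
    have "bform I X (?c k) (?c k) + 2 * s * bform I X (?c k) b + s\<^sup>2 * bform I X b b
       = bform I X (\<lambda>i. u i k + s * b i) (\<lambda>i. u i k + s * b i)"
      by (rule bform_quadratic[symmetric]) (rule sym)
    also note *
    finally have **: "bform I X (?c k) (?c k) + 2 * s * bform I X (?c k) b + s\<^sup>2 * bform I X b b
       \<le> (1 + s\<^sup>2 * \<beta>) * bform I X (?c k) (?c k)" unfolding r_def .
    have arith: "p + 2 * s * q + s\<^sup>2 * r \<le> (1 + s\<^sup>2 * \<beta>) * p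
      \<Longrightarrow> s * (2 * q) \<le> s\<^sup>2 * (\<beta> * p - r)" for p q r :: real
      by (simp add: algebra_simps)
    show ?thesis by (rule arith) (rule **)
  qed
  from linear_le_quadratic_imp_zero[OF this] have z: "bform I X (?c k) b = 0" by simp
  define y where "y a = (\<Sum>j\<in>I. X a j * u j k)" for a
  have "bform I X b (?c k) = 0" using z bform_commute[where X=X and I=I and x=b and y="?c k", OF sym] by simp
  then have "(\<Sum>a\<in>I. y a * b a) = 0"
    by (simp add: bform_eq y_def)
  moreover have "(\<Sum>a\<in>I. y a * b a) = (\<Sum>a\<in>I. (if i = a then y a else 0) - y a * ip n (u i) (u a))"
    by (intro sum.cong) (auto simp: b_def algebra_simps)
  ultimately have "y i = (\<Sum>a\<in>I. y a * ip n (u i) (u a))"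
    using fin i by (simp add: sum_subtractf)
  also have "\<dots> = (\<Sum>l<n. \<Sum>a\<in>I. y a * (u i l * u a l))"
    unfolding ip_def sum_distrib_left by (rule sum.swap)
  also have "\<dots> = (\<Sum>l<n. u i l * bform I X (?c l) (?c k))"
    by (simp add: bform_eq y_def[symmetric] sum_distrib_left mult_ac)
  finally show ?thesis by (simp add: y_def)
qed

section \<open>Spectral theorem and Ky Fan inequality\<close>

lemma compact_cube: "compact {x :: 'i \<Rightarrow> real. \<forall>p. \<bar>x p\<bar> \<le> 1}"
proof -
  have "compactin (product_topology (\<lambda>_. euclidean) UNIV) (PiE UNIV (\<lambda>_::'i. {-1..1::real}))"
    by (subst compactin_PiE) auto
  moreover have "PiE UNIV (\<lambda>_::'i. {-1..1::real}) = {x. \<forall>p. \<bar>x p\<bar> \<le> 1}"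
    by (force simp: PiE_def Pi_def abs_le_iff)
  ultimately show ?thesis by (simp add: euclidean_product_topology)
qed

lemma continuous_on_bform [continuous_intros]:
  "continuous_on A (\<lambda>x. bform I X (f x) (g x))"
  if "\<And>i. i \<in> I \<Longrightarrow> continuous_on A (\<lambda>x. f x i)" "\<And>i. i \<in> I \<Longrightarrow> continuous_on A (\<lambda>x. g x i)"
  unfolding bform_def by (intro continuous_intros that)

text \<open>
  Compactness of the unit sphere in the orthogonal complement of the first \<open>k\<close> columns, which is not
  empty because \<open>k < d\<close>; the final inequality is homogeneous in \<open>x\<close>.
\<close>

lemma rayleigh_maximum_exists:
  fixes X :: "nat \<Rightarrow> nat \<Rightarrow> real"
  assumes "tight k {..<d} u" "k < d"
  obtains q where "(\<Sum>i<d. q i * q i) = 1" "\<And>m. m < k \<Longrightarrow> (\<Sum>i<d. u i m * q i) = 0"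
    "\<And>x. (\<And>m. m < k \<Longrightarrow> (\<Sum>i<d. u i m * x i) = 0) \<Longrightarrow>
       bform {..<d} X x x \<le> bform {..<d} X q q * (\<Sum>i<d. (x i)\<^sup>2)"
proof -
  define K where "K = {x. \<forall>p. \<bar>x p\<bar> \<le> 1} \<inter> ({x::nat \<Rightarrow> real. (\<Sum>i<d. x i * x i) = 1} \<inter>
     (\<Inter>m\<in>{..<k}. {x. (\<Sum>i<d. u i m * x i) = 0}))"
  have "closed ({x::nat \<Rightarrow> real. (\<Sum>i<d. x i * x i) = 1} \<inter>
     (\<Inter>m\<in>{..<k}. {x. (\<Sum>i<d. u i m * x i) = 0}))"
    by (intro closed_Int closed_INT ballI closed_Collect_eq continuous_intros continuous_on_product_coordinates)
  then have "compact K" unfolding K_def by (intro compact_Int_closed compact_cube)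
  have bd: "\<bar>x p\<bar> \<le> 1" if "(\<Sum>i<d. x i * x i) = 1" "p < d" for x :: "nat \<Rightarrow> real" and p
  proof -
    have "x p * x p \<le> (\<Sum>i<d. x i * x i)" using that by (intro member_le_sum) auto
    then show ?thesis using that by (simp add: abs_square_le_1 power2_eq_square[symmetric])
  qed
  have inK: "(\<lambda>i. if i < d then x i else 0) \<in> K"
    if "(\<Sum>i<d. x i * x i) = 1" "\<And>m. m < k \<Longrightarrow> (\<Sum>i<d. u i m * x i) = 0" for x
    using that bd[OF that(1)] by (auto simp: K_def)
  obtain b where "(\<Sum>i<d. b i * b i) = 1" "\<And>m. m < k \<Longrightarrow> (\<Sum>i<d. u i m * b i) = 0"
    using tight_orthogonal_exists[OF assms(1)] assms(2) by (metis card_lessThan finite_lessThan)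
  from inK[OF this] have "K \<noteq> {}" by blast
  have cont: "continuous_on K (\<lambda>x. bform {..<d} X x x)"
    by (intro continuous_on_bform continuous_on_subset[OF continuous_on_product_coordinates]) auto
  obtain q where q: "q \<in> K" "\<And>x. x \<in> K \<Longrightarrow> bform {..<d} X x x \<le> bform {..<d} X q q"
    using continuous_attains_sup[OF \<open>compact K\<close> \<open>K \<noteq> {}\<close> cont] by blast
  show thesis
  proof (rule that[of q])
    show "(\<Sum>i<d. q i * q i) = 1" "\<And>m. m < k \<Longrightarrow> (\<Sum>i<d. u i m * q i) = 0"
      using q(1) by (auto simp: K_def)
    fix x assume x: "\<And>m. m < k \<Longrightarrow> (\<Sum>i<d. u i m * x i) = 0"
    define s where "s = (\<Sum>i<d. (x i)\<^sup>2)"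
    show "bform {..<d} X x x \<le> bform {..<d} X q q * (\<Sum>i<d. (x i)\<^sup>2)"
    proof (cases "s = 0")
      case True
      then have "\<forall>i<d. x i = 0" by (simp add: s_def sum_nonneg_eq_0_iff)
      then have "bform {..<d} X x x = 0" by (simp add: bform_def)
      with True show ?thesis by (simp add: s_def)
    next
      case False
      then have s: "s > 0" by (simp add: s_def sum_nonneg order.not_eq_order_implies_strict)
      define y where "y i = (1 / sqrt s) * x i" for i
      have "(\<Sum>i<d. y i * y i) = (\<Sum>i<d. (x i)\<^sup>2 / s)"
        using s by (intro sum.cong) (auto simp: y_def power2_eq_square)
      also have "\<dots> = s / s" unfolding sum_divide_distrib[symmetric] s_def[symmetric] ..
      finally have y1: "(\<Sum>i<d. y i * y i) = 1" using s by simp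
      have y2: "(\<Sum>i<d. u i m * y i) = 0" if "m < k" for m
      proof -
        have "(\<Sum>i<d. u i m * y i) = (1 / sqrt s) * (\<Sum>i<d. u i m * x i)"
          unfolding sum_distrib_left by (intro sum.cong) (auto simp: y_def)
        then show ?thesis using x that by simp
      qed
      from q(2)[OF inK[OF y1 y2]] have "bform {..<d} X y y \<le> bform {..<d} X q q"
        by (simp add: bform_def)
      moreover have "bform {..<d} X y y = bform {..<d} X x x / s"
        using s unfolding y_def bform_scale_left bform_scale_right by (simp add: field_simps)
      ultimately show ?thesis using s by (simp add: s_def[symmetric] divide_le_eq)
    qed
  qed
qed

text \<open>
  Eigenvectors are chosen greedily: the next one maximises the Rayleigh quotient on the orthogonal
  complement of the previous ones. The last clause records this maximality, which makes the next
  eigenvalue no larger than the earlier ones.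
\<close>

lemma spectral_step:
  fixes X :: "nat \<Rightarrow> nat \<Rightarrow> real"
  assumes sym: "\<And>i j. i < d \<Longrightarrow> j < d \<Longrightarrow> X i j = X j i" and "k \<le> d"
  shows "\<exists>u l. tight k {..<d} u \<and> (\<forall>m<k. \<forall>i<d. (\<Sum>j<d. X i j * u j m) = l m * u i m) \<and>
    (\<forall>m m'. m \<le> m' \<longrightarrow> m' < k \<longrightarrow> l m' \<le> l m) \<and>
    (\<forall>x m. m < k \<longrightarrow> (\<forall>m'<k. (\<Sum>i<d. u i m' * x i) = 0) \<longrightarrow> bform {..<d} X x x \<le> l m * (\<Sum>i<d. (x i)\<^sup>2))"
  using assms(2)
proof (induction k)
  case 0
  then show ?case by (auto simp: tight_def)
next
  case (Suc k)
  then obtain u l where *: "tight k {..<d} u \<and> (\<forall>m<k. \<forall>i<d. (\<Sum>j<d. X i j * u j m) = l m * u i m) \<and>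
    (\<forall>m m'. m \<le> m' \<longrightarrow> m' < k \<longrightarrow> l m' \<le> l m) \<and>
    (\<forall>x m. m < k \<longrightarrow> (\<forall>m'<k. (\<Sum>i<d. u i m' * x i) = 0) \<longrightarrow> bform {..<d} X x x \<le> l m * (\<Sum>i<d. (x i)\<^sup>2))"
    by (auto dest: Suc_leD)
  from * have tight: "tight k {..<d} u" by (rule conjunct1)
  from * have eig: "\<And>m i. m < k \<Longrightarrow> i < d \<Longrightarrow> (\<Sum>j<d. X i j * u j m) = l m * u i m"
    and dec: "\<And>m m'. m \<le> m' \<Longrightarrow> m' < k \<Longrightarrow> l m' \<le> l m"
    and bd: "\<And>x m. m < k \<Longrightarrow> (\<forall>m'<k. (\<Sum>i<d. u i m' * x i) = 0) \<Longrightarrow> bform {..<d} X x x \<le> l m * (\<Sum>i<d. (x i)\<^sup>2)"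
    by simp_all
  obtain q where q: "(\<Sum>i<d. q i * q i) = 1" "\<And>m. m < k \<Longrightarrow> (\<Sum>i<d. u i m * q i) = 0"
    "\<And>x. (\<And>m. m < k \<Longrightarrow> (\<Sum>i<d. u i m * x i) = 0) \<Longrightarrow>
       bform {..<d} X x x \<le> bform {..<d} X q q * (\<Sum>i<d. (x i)\<^sup>2)"
    by (rule rayleigh_maximum_exists[OF tight, of X]) (use Suc.prems in auto)
  define L where "L = bform {..<d} X q q"
  have sym': "X i j = X j i" if "i \<in> {..<d}" "j \<in> {..<d}" for i j using sym that by auto
  have cross: "bform {..<d} X q (\<lambda>j. u j m) = 0" if "m < k" for m
  proof -
    have "bform {..<d} X q (\<lambda>j. u j m) = (\<Sum>i<d. l m * u i m * q i)"
      unfolding bform_eq by (intro sum.cong) (use eig that in auto)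
    also have "\<dots> = l m * (\<Sum>i<d. u i m * q i)" by (simp add: sum_distrib_left mult.assoc)
    finally show ?thesis using q(2) that by simp
  qed
  have eigq: "(\<Sum>j<d. X i j * q j) = L * q i" if i: "i < d" for i
  proof -
    define b where "b j = (if i = j then 1 else 0) - ip k (u i) (u j)" for j
    have b: "(\<Sum>j<d. u j m * b j) = 0" if "m < k" for m
      using tight_residual[OF tight _ _ that, of i] i by (simp add: b_def)
    have "bform {..<d} X q b = L * (\<Sum>j<d. q j * b j)"
    proof (rule rayleigh_stationary[OF sym'])
      show "bform {..<d} X q q = L * (\<Sum>i<d. (q i)\<^sup>2)" using q(1) by (simp add: L_def power2_eq_square)
      show "bform {..<d} X (\<lambda>i. q i + s * b i) (\<lambda>i. q i + s * b i) \<le> L * (\<Sum>i<d. (q i + s * b i)\<^sup>2)" for s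
        unfolding L_def
      proof (rule q(3))
        fix m assume "m < k"
        have "(\<Sum>i<d. u i m * (q i + s * b i)) = (\<Sum>i<d. u i m * q i) + s * (\<Sum>i<d. u i m * b i)"
          by (simp add: distrib_left sum.distrib sum_distrib_left mult.left_commute)
        then show "(\<Sum>i<d. u i m * (q i + s * b i)) = 0" using b q(2) \<open>m < k\<close> by simp
      qed
    qed auto
    moreover have "b = (\<lambda>j. (if j = i then 1 else 0) + (-1) * (\<Sum>m<k. u i m * u j m))"
      by (auto simp: b_def ip_def)
    moreover have "bform {..<d} X q (\<lambda>j. \<Sum>m<k. u i m * u j m) = (\<Sum>m<k. u i m * bform {..<d} X q (\<lambda>j. u j m))"
    proof -
      have "bform {..<d} X q (\<lambda>j. \<Sum>m<r. u i m * u j m) = (\<Sum>m<r. u i m * bform {..<d} X q (\<lambda>j. u j m))" for r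
        by (induction r) (auto simp: bform_add_right bform_scale_right, simp add: bform_def)
      then show ?thesis .
    qed
    ultimately have "bform {..<d} X q (\<lambda>j. if j = i then 1 else 0) = L * (\<Sum>j<d. q j * b j)"
      by (simp only: bform_add_right bform_scale_right) (simp add: cross)
    also have "(\<Sum>j<d. q j * b j) = (\<Sum>j<d. (if i = j then q j else 0) - (\<Sum>m<k. u i m * (u j m * q j)))"
      by (intro sum.cong) (auto simp: b_def ip_def algebra_simps sum_distrib_left)
    also have "\<dots> = q i - (\<Sum>m<k. u i m * (\<Sum>j<d. u j m * q j))"
    proof -
      have "(\<Sum>j<d. \<Sum>m<k. u i m * (u j m * q j)) = (\<Sum>m<k. u i m * (\<Sum>j<d. u j m * q j))"
        by (subst sum.swap) (simp add: sum_distrib_left)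
      then show ?thesis using i by (simp add: sum_subtractf)
    qed
    also have "\<dots> = q i" using q(2) by simp
    finally have "(\<Sum>j<d. X j i * q j) = L * q i" using i by (simp add: bform_unit)
    moreover have "(\<Sum>j<d. X j i * q j) = (\<Sum>j<d. X i j * q j)" using sym i by (intro sum.cong) auto
    ultimately show ?thesis by simp
  qed
  define u' where "u' i m = (if m = k then q i else u i m)" for i m
  define l' where "l' = l(k := L)"
  have "tight (Suc k) {..<d} u'"
    using tightD[OF tight] q(1,2) by (auto simp: tight_def u'_def less_Suc_eq mult.commute)
  moreover have "\<forall>m<Suc k. \<forall>i<d. (\<Sum>j<d. X i j * u' j m) = l' m * u' i m"
    using eig eigq by (auto simp: u'_def l'_def less_Suc_eq)
  moreover have "\<forall>m m'. m \<le> m' \<longrightarrow> m' < Suc k \<longrightarrow> l' m' \<le> l' m"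
  proof (intro allI impI)
    fix m m' :: nat assume mm: "m \<le> m'" "m' < Suc k"
    have "L \<le> l m" if "m < k"
      using bd[OF that, of q] q(1,2) by (simp add: L_def power2_eq_square)
    with mm dec show "l' m' \<le> l' m" by (auto simp: l'_def less_Suc_eq)
  qed
  moreover have "bform {..<d} X x x \<le> l' m * (\<Sum>i<d. (x i)\<^sup>2)"
    if "m < Suc k" "\<forall>m'<Suc k. (\<Sum>i<d. u' i m' * x i) = 0" for x m
  proof -
    have x: "\<forall>m'<k. (\<Sum>i<d. u i m' * x i) = 0"
    proof (intro allI impI)
      fix m' assume "m' < k" then show "(\<Sum>i<d. u i m' * x i) = 0"
        using that(2)[rule_format, of m'] by (simp add: u'_def)
    qed
    show ?thesis
    proof (cases "m = k")
      case True then show ?thesis using q(3)[of x] x by (simp add: l'_def L_def)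
    next
      case False then show ?thesis using bd[of m x] x that(1) by (simp add: l'_def)
    qed
  qed
  ultimately show ?case by (intro exI[of _ u'] exI[of _ l'] conjI) simp_all
qed

text \<open>
  The order of the eigenvalues is part of the notion, so that the first \<open>n\<close> columns belong to the \<open>n\<close>
  largest eigenvalues.
\<close>

definition eigenframe :: "nat \<Rightarrow> (nat \<Rightarrow> nat \<Rightarrow> real) \<Rightarrow> (nat \<Rightarrow> nat \<Rightarrow> real) \<Rightarrow> (nat \<Rightarrow> real) \<Rightarrow> bool" where
  "eigenframe d X q l \<longleftrightarrow> tight d {..<d} q \<and> (\<forall>m<d. \<forall>i<d. (\<Sum>j<d. X i j * q j m) = l m * q i m) \<and>
     (\<forall>m m'. m \<le> m' \<longrightarrow> m' < d \<longrightarrow> l m' \<le> l m)"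

lemma eigenframeD:
  assumes "eigenframe d X q l"
  shows "tight d {..<d} q" "\<And>i m. i < d \<Longrightarrow> m < d \<Longrightarrow> (\<Sum>j<d. X i j * q j m) = l m * q i m"
    "\<And>m m'. m \<le> m' \<Longrightarrow> m' < d \<Longrightarrow> l m' \<le> l m"
  using assms by (simp_all add: eigenframe_def)

theorem symmetric_spectral:
  fixes X :: "nat \<Rightarrow> nat \<Rightarrow> real"
  assumes "\<And>i j. i < d \<Longrightarrow> j < d \<Longrightarrow> X i j = X j i"
  shows "\<exists>q l. eigenframe d X q l"
proof -
  have "\<exists>u l. tight d {..<d} u \<and> (\<forall>m<d. \<forall>i<d. (\<Sum>j<d. X i j * u j m) = l m * u i m) \<and>
    (\<forall>m m'. m \<le> m' \<longrightarrow> m' < d \<longrightarrow> l m' \<le> l m) \<and>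
    (\<forall>x m. m < d \<longrightarrow> (\<forall>m'<d. (\<Sum>i<d. u i m' * x i) = 0) \<longrightarrow> bform {..<d} X x x \<le> l m * (\<Sum>i<d. (x i)\<^sup>2))"
    by (rule spectral_step) (use assms in auto)
  then show ?thesis unfolding eigenframe_def by (elim exE conjE) (intro exI conjI)
qed

lemma tight_square_orthonormal:
  assumes "tight d {..<d} u" "i < d" "j < d"
  shows "ip d (u i) (u j) = (if i = j then 1 else 0)"
  using tight_square[OF assms(1)] assms by simp

lemma spectral_decomposition:
  assumes "eigenframe d X q l" "i < d" "j < d"
  shows "X i j = (\<Sum>m<d. l m * q i m * q j m)"
proof -
  have "X i j = (\<Sum>a<d. if a = j then X i a else 0)" using assms by simp
  also have "\<dots> = (\<Sum>a<d. X i a * ip d (q a) (q j))"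
    by (intro sum.cong) (use assms in \<open>auto simp: tight_square_orthonormal eigenframeD(1)\<close>)
  also have "\<dots> = (\<Sum>m<d. (\<Sum>a<d. X i a * q a m) * q j m)"
    unfolding ip_def sum_distrib_left sum_distrib_right by (subst sum.swap) (simp add: mult.assoc)
  also have "\<dots> = (\<Sum>m<d. l m * q i m * q j m)"
    by (intro sum.cong) (use assms eigenframeD(2)[OF assms(1)] in auto)
  finally show ?thesis .
qed

text \<open>
  In the eigenbasis the trace becomes \<open>\<Sum>\<^sub>m l m * c m\<close>, where \<open>c m\<close> is the squared length of the projection
  of the \<open>m\<close>-th eigenvector to the column space of \<open>u\<close>. These weights lie between \<open>0\<close> and \<open>1\<close> and add up to
  \<open>n\<close>, so the sum is at most the one with all weight on the first \<open>n\<close> eigenvalues.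
\<close>

lemma ky_fan:
  fixes u :: "nat \<Rightarrow> nat \<Rightarrow> real"
  assumes X: "eigenframe d X q l" and u: "tight n {..<d} u"
  shows "(\<Sum>i<d. \<Sum>j<d. X i j * ip n (u i) (u j)) \<le> (\<Sum>m<n. l m)"
proof -
  note q = eigenframeD(1)[OF X] and dec = eigenframeD(3)[OF X]
  have nd: "n \<le> d" using tight_card[OF u] by simp
  define c where "c m = (\<Sum>k<n. (\<Sum>i<d. q i m * u i k)\<^sup>2)" for m
  have c0: "c m \<ge> 0" for m by (simp add: c_def sum_nonneg)
  have "(\<Sum>i<d. \<Sum>j<d. X i j * ip n (u i) (u j)) = (\<Sum>i<d. \<Sum>j<d. \<Sum>m<d. \<Sum>k<n. l m * ((q i m * u i k) * (q j m * u j k)))"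
    by (intro sum.cong refl) (simp add: spectral_decomposition[OF X] ip_def sum_product mult_ac sum.swap[of _ "{..<n}"])
  also have "\<dots> = (\<Sum>m<d. \<Sum>k<n. \<Sum>i<d. \<Sum>j<d. l m * ((q i m * u i k) * (q j m * u j k)))"
    by (subst (2) sum.swap, subst sum.swap, subst (3) sum.swap, subst (2) sum.swap) (rule refl)
  also have "\<dots> = (\<Sum>m<d. l m * c m)"
  proof -
    have "(\<Sum>i<d. \<Sum>j<d. l m * ((q i m * u i k) * (q j m * u j k))) = l m * (\<Sum>i<d. q i m * u i k)\<^sup>2" for m k
      unfolding power2_eq_square sum_product by (simp only: sum_distrib_left)
    then show ?thesis by (simp add: c_def sum_distrib_left)
  qed
  finally have tr: "(\<Sum>i<d. \<Sum>j<d. X i j * ip n (u i) (u j)) = (\<Sum>m<d. l m * c m)" .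
  have csum: "(\<Sum>m<d. c m) = n"
  proof -
    have "(\<Sum>m<d. (\<Sum>i<d. q i m * u i k)\<^sup>2) = 1" if k: "k < n" for k
    proof -
      have "(\<Sum>m<d. (\<Sum>i<d. q i m * u i k)\<^sup>2) = (\<Sum>m<d. \<Sum>i<d. \<Sum>j<d. q i m * q j m * (u i k * u j k))"
        by (simp add: power2_eq_square sum_product mult_ac)
      also have "\<dots> = (\<Sum>i<d. \<Sum>j<d. ip d (q i) (q j) * (u i k * u j k))"
        unfolding ip_def sum_distrib_right by (subst sum.swap, subst (2) sum.swap) (rule refl)
      also have "\<dots> = (\<Sum>i<d. \<Sum>j<d. if i = j then u i k * u j k else 0)"
        by (intro sum.cong refl) (use q in \<open>auto simp: tight_square_orthonormal\<close>)
      also have "\<dots> = 1" using tightD[OF u k k] by simp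
      finally show ?thesis .
    qed
    then show ?thesis unfolding c_def by (subst sum.swap) simp
  qed
  have c1: "c m \<le> 1" if m: "m < d" for m
  proof -
    define w where "w i = (\<Sum>k<n. (\<Sum>j<d. q j m * u j k) * u i k)" for i
    have qw: "(\<Sum>i<d. q i m * w i) = c m"
      unfolding w_def c_def power2_eq_square sum_distrib_left by (subst sum.swap) (simp add: sum_distrib_left mult_ac)
    have "(\<Sum>i<d. w i * w i) = (\<Sum>k<n. \<Sum>k'<n. (\<Sum>j<d. q j m * u j k) * (\<Sum>j<d. q j m * u j k') * (\<Sum>i<d. u i k * u i k'))"
      unfolding w_def sum_product[of _ "{..<n}"] sum_distrib_left
      by (subst sum.swap, subst (2) sum.swap) (simp add: mult_ac sum_distrib_left)
    also have "\<dots> = (\<Sum>k<n. \<Sum>k'<n. if k = k' then (\<Sum>j<d. q j m * u j k) * (\<Sum>j<d. q j m * u j k') else 0)"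
      by (intro sum.cong refl) (use tightD[OF u] in auto)
    also have "\<dots> = c m" by (simp add: c_def power2_eq_square)
    finally have ww: "(\<Sum>i<d. w i * w i) = c m" .
    have "0 \<le> (\<Sum>i<d. (q i m - w i)\<^sup>2)" by (simp add: sum_nonneg)
    also have "\<dots> = (\<Sum>i<d. q i m * q i m - 2 * (q i m * w i) + w i * w i)"
      by (intro sum.cong) (auto simp: power2_eq_square algebra_simps)
    also have "\<dots> = (\<Sum>i<d. q i m * q i m) - 2 * (\<Sum>i<d. q i m * w i) + (\<Sum>i<d. w i * w i)"
      by (simp add: sum.distrib sum_subtractf sum_distrib_left)
    also have "\<dots> = 1 - c m" using tightD[OF q m m] qw ww by simp
    finally show ?thesis by simp
  qed
  show ?thesis
  proof (cases "n = 0")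
    case True then show ?thesis using tr csum c0 by (simp add: sum_nonneg_eq_0_iff)
  next
    case False
    \<comment> \<open>Subtracting the \<open>n\<close>-th eigenvalue makes the first \<open>n\<close> terms nonnegative and the others nonpositive.\<close>
    define L where "L = l (n - 1)"
    have split: "(\<Sum>m<d. f m) = (\<Sum>m<n. f m) + (\<Sum>m\<in>{n..<d}. f m)" for f :: "nat \<Rightarrow> real"
      using nd by (metis sum.lessThan_Suc atLeast0LessThan sum.atLeastLessThan_concat zero_le)
    have "(\<Sum>m<d. (l m - L) * c m) = (\<Sum>m<n. (l m - L) * c m) + (\<Sum>m\<in>{n..<d}. (l m - L) * c m)"
      by (rule split)
    also have "\<dots> \<le> (\<Sum>m<n. l m - L) + 0"
    proof (intro add_mono sum_mono sum_nonpos)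
      fix m assume "m \<in> {..<n}"
      then have "l m - L \<ge> 0" "c m \<le> 1" using dec[of m "n - 1"] nd c1 by (auto simp: L_def)
      then show "(l m - L) * c m \<le> l m - L" using c0[of m] by (simp add: mult_left_le)
    next
      fix m assume "m \<in> {n..<d}"
      then have "l m - L \<le> 0" using dec[of "n - 1" m] by (auto simp: L_def)
      then show "(l m - L) * c m \<le> 0" using c0[of m] by (simp add: mult_nonpos_nonneg)
    qed
    finally have "(\<Sum>m<d. l m * c m) - L * (\<Sum>m<d. c m) \<le> (\<Sum>m<n. l m) - n * L"
      by (simp add: left_diff_distrib sum_subtractf sum_distrib_left)
    then show ?thesis using tr csum by simp
  qed
qed

text \<open>
  The eigenvalues are \<open>0\<close> or \<open>1\<close> and decrease, so the first \<open>m\<close> columns of an eigenframe, those with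
  eigenvalue \<open>1\<close>, form the frame.
\<close>

lemma idempotent_frame:
  fixes P :: "nat \<Rightarrow> nat \<Rightarrow> real"
  assumes "\<And>i j. i < d \<Longrightarrow> j < d \<Longrightarrow> P i j = P j i"
    and "\<And>i j. i < d \<Longrightarrow> j < d \<Longrightarrow> (\<Sum>k<d. P i k * P k j) = P i j"
  obtains m u where "tight m {..<d} u" "\<And>i j. i < d \<Longrightarrow> j < d \<Longrightarrow> P i j = ip m (u i) (u j)"
proof -
  obtain q l where X: "eigenframe d P q l" using symmetric_spectral[where X=P, OF assms(1)] by blast
  note q = eigenframeD(1,2)[OF X] and dec = eigenframeD(3)[OF X]
  have l: "l m = 0 \<or> l m = 1" if m: "m < d" for m
  proof -
    have "(\<Sum>i<d. q i m * q i m) \<noteq> 0" using tightD[OF q(1) m m] by simp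
    then have "\<exists>i<d. q i m \<noteq> 0" by (rule contrapos_np) simp
    then obtain i where i: "i < d" "q i m \<noteq> 0" by blast
    have "l m * q i m = (\<Sum>j<d. \<Sum>k<d. P i k * P k j * q j m)"
      using q(2)[OF i(1) m] assms(2) i(1) by (simp add: sum_distrib_right[symmetric])
    also have "\<dots> = (\<Sum>k<d. P i k * (\<Sum>j<d. P k j * q j m))"
      unfolding sum_distrib_left by (subst sum.swap) (simp add: mult.assoc)
    also have "\<dots> = (\<Sum>k<d. l m * (P i k * q k m))"
      by (intro sum.cong) (use q(2) m in auto)
    also have "\<dots> = l m * (l m * q i m)" using q(2)[OF i(1) m] by (simp add: sum_distrib_left[symmetric])
    finally show ?thesis using i by simp
  qed
  have "\<exists>m. m \<le> d \<and> (\<forall>k<m. l k = 1) \<and> (\<forall>k. m \<le> k \<longrightarrow> k < d \<longrightarrow> l k = 0)"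
  proof (cases "\<exists>k<d. l k = 0")
    case True
    define m where "m = (LEAST k. k < d \<and> l k = 0)"
    have m: "m < d" "l m = 0" using LeastI_ex[OF True] by (auto simp: m_def)
    have "l k = 1" if "k < m" for k using not_less_Least[OF that[unfolded m_def]] l[of k] m that by auto
    moreover have "l k = 0" if "m \<le> k" "k < d" for k using dec[OF that] m l[OF that(2)] by auto
    ultimately show ?thesis using m by (intro exI[of _ m]) auto
  next
    case False then show ?thesis using l by (intro exI[of _ d]) auto
  qed
  then obtain m where m: "m \<le> d" "\<forall>k<m. l k = 1" "\<forall>k. m \<le> k \<longrightarrow> k < d \<longrightarrow> l k = 0" by blast
  show thesis
  proof (rule that[of m q])
    show "tight m {..<d} q" using q(1) m(1) by (auto simp: tight_def)
    fix i j assume ij: "i < d" "j < d"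
    have "P i j = (\<Sum>k<d. l k * q i k * q j k)" by (rule spectral_decomposition[OF X ij])
    also have "\<dots> = (\<Sum>k<m. l k * q i k * q j k)"
      using m by (intro sum.mono_neutral_right) auto
    also have "\<dots> = ip m (q i) (q j)" unfolding ip_def using m by (intro sum.cong) auto
    finally show "P i j = ip m (q i) (q j)" .
  qed
qed

section \<open>Weighted frames\<close>

definition frame_value :: "nat \<Rightarrow> 'i set \<Rightarrow> ('i \<Rightarrow> real) \<Rightarrow> ('i \<Rightarrow> nat \<Rightarrow> real) \<Rightarrow> real" where
  "frame_value n I t u = (\<Sum>i\<in>I. \<Sum>j\<in>I. t i * t j * \<bar>ip n (u i) (u j)\<bar>)"

definition weighted_frame :: "nat \<Rightarrow> 'i set \<Rightarrow> ('i \<Rightarrow> real) \<Rightarrow> ('i \<Rightarrow> nat \<Rightarrow> real) \<Rightarrow> bool" where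
  "weighted_frame n I t u \<longleftrightarrow> finite I \<and> tight n I u \<and> (\<forall>i\<in>I. 0 \<le> t i) \<and> (\<Sum>i\<in>I. (t i)\<^sup>2) = 1"

lemma weighted_frame_reindex:
  assumes h: "bij_betw h J I" and w: "weighted_frame n I t u"
  shows "weighted_frame n J (t \<circ> h) (u \<circ> h)" "frame_value n J (t \<circ> h) (u \<circ> h) = frame_value n I t u"
proof -
  have s: "(\<Sum>i\<in>J. f (h i)) = (\<Sum>i\<in>I. f i)" for f :: "'b \<Rightarrow> real"
    by (rule sum.reindex_bij_betw[OF h])
  have "finite J" using w bij_betw_finite[OF h] by (simp add: weighted_frame_def)
  moreover have "\<forall>i\<in>J. 0 \<le> t (h i)" using w bij_betw_apply[OF h] by (auto simp: weighted_frame_def)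
  moreover have "tight n J (u \<circ> h)" using w s[of "\<lambda>i. u i _ * u i _"] by (auto simp: weighted_frame_def tight_def)
  moreover have "(\<Sum>i\<in>J. (t (h i))\<^sup>2) = 1" using w s[of "\<lambda>i. (t i)\<^sup>2"] by (simp add: weighted_frame_def)
  ultimately show "weighted_frame n J (t \<circ> h) (u \<circ> h)" by (simp add: weighted_frame_def)
  have "(\<Sum>j\<in>J. t (h i) * t (h j) * \<bar>ip n (u (h i)) (u (h j))\<bar>) = (\<Sum>j\<in>I. t (h i) * t j * \<bar>ip n (u (h i)) (u j)\<bar>)" for i
    by (rule s)
  then show "frame_value n J (t \<circ> h) (u \<circ> h) = frame_value n I t u"
    using s[of "\<lambda>i. \<Sum>j\<in>I. t i * t j * \<bar>ip n (u i) (u j)\<bar>"] by (simp add: frame_value_def)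
qed

lemma weighted_frame_enumerate:
  assumes w: "weighted_frame n I t u"
  shows "\<exists>t' u'. weighted_frame n {..<card I} t' u' \<and> frame_value n {..<card I} t' u' = frame_value n I t u \<and>
    (\<forall>i<card I. \<exists>j\<in>I. t' i = t j \<and> u' i = u j)"
proof -
  have "finite I" using w by (simp add: weighted_frame_def)
  then obtain h where h: "bij_betw h {..<card I} I"
    using ex_bij_betw_nat_finite[of I] by (auto simp: atLeast0LessThan)
  show ?thesis
    by (intro exI[of _ "t \<circ> h"] exI[of _ "u \<circ> h"] conjI weighted_frame_reindex[OF h w])
      (use bij_betw_apply[OF h] in auto)
qed

lemma ip_polarise: "ip n (\<lambda>k. a k + s * b k) (\<lambda>k. a' k + s' * b' k)
   = ip n a a' + s * ip n b a' + s' * ip n a b' + s * s' * ip n b b'"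
  by (simp add: ip_add_left ip_add_right ip_scale_left ip_scale_right algebra_simps)

text \<open>
  Vectors \<open>u z\<close> of weight zero count for tightness but not for the value. They are
  absorbed by the others: each \<open>u i\<close> of positive weight is replaced by the copies \<open>u i \<plusminus> sqrt |Z| * t i * u z\<close>,
  where \<open>z\<close> runs over the set \<open>Z\<close> of indices of weight zero, scaled by \<open>1 / sqrt (2 * |Z|)\<close>. The cross
  terms cancel, and the second moment of the \<open>u z\<close> is recovered because the squared weights add up to
  one. The value does not decrease because the absolute value is convex.
\<close>

lemma weighted_frame_spread:
  fixes u :: "'i \<Rightarrow> nat \<Rightarrow> real"
  assumes w: "weighted_frame n I t u"
  shows "\<exists>(d::nat) t' u'. weighted_frame n {..<d} t' u' \<and> (\<forall>i<d. 0 < t' i) \<and> frame_value n I t u \<le> frame_value n {..<d} t' u'"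
proof (cases "\<forall>i\<in>I. 0 < t i")
  case True
  with weighted_frame_enumerate[OF w] show ?thesis by (metis order_refl)
next
  case False
  note W = w[unfolded weighted_frame_def]
  define Z where "Z = {i\<in>I. t i = 0}"
  define I' where "I' = I - Z"
  have fin: "finite I" "finite Z" "finite I'" using W by (auto simp: Z_def I'_def)
  have "Z \<noteq> {}" using False W by (force simp: Z_def)
  define m where "m = real (card Z)"
  have m: "m > 0" using \<open>Z \<noteq> {}\<close> fin by (simp add: m_def card_gt_0_iff)
  have split: "(\<Sum>i\<in>I. f i) = (\<Sum>i\<in>I'. f i) + (\<Sum>i\<in>Z. f i)" for f :: "'i \<Rightarrow> real"
    unfolding I'_def using fin by (intro sum.subset_diff) (auto simp: Z_def)
  define J where "J = I' \<times> Z \<times> {1, -1::real}"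
  define c where "c = 1 / sqrt (2 * m)"
  have c: "c > 0" "c * c = 1 / (2 * m)" using m by (auto simp: c_def)
  define e where "e i z \<sigma> k = u i k + \<sigma> * sqrt m * t i * u z k" for i z \<sigma> k
  define U where "U = (\<lambda>(i,z,\<sigma>) k. c * e i z \<sigma> k)"
  define T where "T = (\<lambda>(i,z::'i,\<sigma>::real). c * t i)"
  have sumJ: "(\<Sum>x\<in>J. f x) = (\<Sum>i\<in>I'. \<Sum>z\<in>Z. f (i,z,1) + f (i,z,-1))" for f :: "_ \<Rightarrow> real"
    unfolding J_def sum.cartesian_product' by simp
  have t1: "(\<Sum>i\<in>I'. (t i)\<^sup>2) = 1" using W split[of "\<lambda>i. (t i)\<^sup>2"] by (simp add: Z_def)
  have "tight n J U"
    unfolding tight_def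
  proof (intro allI impI)
    fix k l assume kl: "k < n" "l < n"
    have "(\<Sum>x\<in>J. U x k * U x l) = (\<Sum>i\<in>I'. \<Sum>z\<in>Z. u i k * u i l / m + (t i)\<^sup>2 * (u z k * u z l))"
      unfolding sumJ
    proof (intro sum.cong refl)
      fix i z
      have "U (i,z,1) k * U (i,z,1) l + U (i,z,-1) k * U (i,z,-1) l
        = (c * c) * (2 * (u i k * u i l + (sqrt m * sqrt m) * (t i)\<^sup>2 * (u z k * u z l)))"
        by (simp add: U_def e_def algebra_simps power2_eq_square)
      then show "U (i,z,1) k * U (i,z,1) l + U (i,z,-1) k * U (i,z,-1) l = u i k * u i l / m + (t i)\<^sup>2 * (u z k * u z l)"
        using m by (simp add: c field_simps)
    qed
    also have "\<dots> = (\<Sum>i\<in>I'. u i k * u i l) + (\<Sum>i\<in>I'. (t i)\<^sup>2) * (\<Sum>z\<in>Z. u z k * u z l)"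
      using m unfolding sum.distrib sum_product by (simp add: m_def)
    also have "\<dots> = (\<Sum>i\<in>I. u i k * u i l)" using t1 split by simp
    also have "\<dots> = (if k = l then 1 else 0)" using W kl by (simp add: tight_def)
    finally show "(\<Sum>x\<in>J. U x k * U x l) = (if k = l then 1 else 0)" .
  qed
  moreover have "(\<Sum>x\<in>J. (T x)\<^sup>2) = 1"
  proof -
    have "(\<Sum>x\<in>J. (T x)\<^sup>2) = (\<Sum>i\<in>I'. \<Sum>z\<in>Z. (t i)\<^sup>2 / m)"
      unfolding sumJ by (intro sum.cong refl) (use m c in \<open>simp add: T_def power2_eq_square field_simps\<close>)
    also have "\<dots> = 1" using t1 m by (simp add: m_def)
    finally show ?thesis .
  qed
  moreover have Tpos: "T x > 0" if "x \<in> J" for x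
  proof -
    obtain i z \<sigma> where x: "x = (i, z, \<sigma>)" by (cases x)
    then have "i \<in> I'" using that by (simp add: J_def)
    then have "0 \<le> t i" "t i \<noteq> 0" using W by (auto simp: I'_def Z_def)
    then show ?thesis using c x by (simp add: T_def)
  qed
  moreover have "finite J" using fin by (simp add: J_def)
  ultimately have wJ: "weighted_frame n J T U" by (auto simp: weighted_frame_def intro: less_imp_le)
  \<comment> \<open>The average over the four sign choices of the inner products is \<open>ip n (u i) (u j)\<close>.\<close>
  have four: "4 * \<bar>ip n (u i) (u j)\<bar> \<le> \<bar>ip n (e i z 1) (e j z' 1)\<bar> + \<bar>ip n (e i z 1) (e j z' (-1))\<bar>
      + (\<bar>ip n (e i z (-1)) (e j z' 1)\<bar> + \<bar>ip n (e i z (-1)) (e j z' (-1))\<bar>)" for i j z z'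
    unfolding e_def ip_polarise by (simp add: algebra_simps)
  have qi: "\<bar>ip n (U (i,z,\<sigma>)) (U (j,z',\<sigma>'))\<bar> = (c * c) * \<bar>ip n (e i z \<sigma>) (e j z' \<sigma>')\<bar>" for i j z z' \<sigma> \<sigma>'
    using c(1) by (simp add: U_def ip_scale_left ip_scale_right abs_mult)
  have "frame_value n I t u = (\<Sum>i\<in>I'. \<Sum>j\<in>I'. t i * t j * \<bar>ip n (u i) (u j)\<bar>)"
    unfolding frame_value_def split by (simp add: Z_def)
  also have "\<dots> = (\<Sum>i\<in>I'. \<Sum>z\<in>Z. \<Sum>j\<in>I'. \<Sum>z'\<in>Z. (c * c) * (c * c) * (t i * t j) * (4 * \<bar>ip n (u i) (u j)\<bar>))"
    using m by (simp add: m_def[symmetric] c sum_distrib_left[symmetric] flip: sum_divide_distrib)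
      (simp add: sum_distrib_left mult.assoc)
  also have "\<dots> \<le> (\<Sum>i\<in>I'. \<Sum>z\<in>Z. \<Sum>j\<in>I'. \<Sum>z'\<in>Z. (c * c) * (c * c) * (t i * t j) *
      (\<bar>ip n (e i z 1) (e j z' 1)\<bar> + \<bar>ip n (e i z 1) (e j z' (-1))\<bar>
      + (\<bar>ip n (e i z (-1)) (e j z' 1)\<bar> + \<bar>ip n (e i z (-1)) (e j z' (-1))\<bar>)))"
    by (intro sum_mono mult_left_mono four) (use W c in \<open>auto simp: I'_def\<close>)
  also have "\<dots> = frame_value n J T U"
    unfolding frame_value_def sumJ sum.distrib[symmetric]
    by (intro sum.cong refl) (simp add: T_def qi algebra_simps)
  finally have "frame_value n I t u \<le> frame_value n J T U" .
  moreover obtain t' u' where "weighted_frame n {..<card J} t' u'" "frame_value n {..<card J} t' u' = frame_value n J T U"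
    "\<forall>i<card J. \<exists>j\<in>J. t' i = T j \<and> u' i = U j"
    using weighted_frame_enumerate[OF wJ] by blast
  moreover have "\<forall>i<card J. 0 < t' i" using calculation(4) Tpos by force
  ultimately show ?thesis by (intro exI[of _ "card J"] exI[of _ t'] exI[of _ u']) simp
qed

section \<open>Bounding the number of vectors\<close>

text \<open>
  A weighted frame in the coordinates \<open>v i = u i / t i\<close>, \<open>w i = (t i)\<^sup>2\<close>: a probability measure with
  identity second moment, which is a linear condition on the masses \<open>w\<close>.
\<close>

definition isotropic :: "nat \<Rightarrow> 'i set \<Rightarrow> ('i \<Rightarrow> real) \<Rightarrow> ('i \<Rightarrow> nat \<Rightarrow> real) \<Rightarrow> bool" where
  "isotropic n I w v \<longleftrightarrow> finite I \<and> (\<forall>i\<in>I. 0 < w i) \<and> (\<Sum>i\<in>I. w i) = 1 \<and>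
     (\<forall>k<n. \<forall>l<n. (\<Sum>i\<in>I. w i * (v i k * v i l)) = (if k = l then 1 else 0))"

definition measure_value :: "nat \<Rightarrow> 'i set \<Rightarrow> ('i \<Rightarrow> nat \<Rightarrow> real) \<Rightarrow> ('i \<Rightarrow> real) \<Rightarrow> ('i \<Rightarrow> real) \<Rightarrow> real" where
  "measure_value n I v w w' = bform I (\<lambda>i j. \<bar>ip n (v i) (v j)\<bar>) w w'"

text \<open>
  A finite partition of space into cells so narrow that two vectors of one cell never form an obtuse
  angle: the normalised vectors of a cell differ by at most \<open>1 / n\<close> in each coordinate, hence by at most
  one in norm.
\<close>

definition sector :: "nat \<Rightarrow> (nat \<Rightarrow> real) \<Rightarrow> nat \<Rightarrow> int" where
  "sector n x = restrict (\<lambda>k. \<lfloor>real n * (x k / sqrt (ip n x x))\<rfloor>) {..<n}"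

lemma sector_range: "sector n x \<in> PiE {..<n} (\<lambda>_. {- int n..int n})"
proof -
  have "- real n \<le> real n * (x k / sqrt (ip n x x)) \<and> real n * (x k / sqrt (ip n x x)) \<le> real n" if "k < n" for k
  proof -
    have "(x k)\<^sup>2 \<le> ip n x x"
      unfolding ip_def power2_eq_square using that by (intro member_le_sum) auto
    then have "\<bar>x k\<bar> \<le> sqrt (ip n x x)" using real_le_rsqrt by force
    then have a: "\<bar>x k / sqrt (ip n x x)\<bar> \<le> 1"
      using ip_self_nonneg[of n x] by (cases "ip n x x = 0") (auto simp: abs_div divide_le_eq_1)
    have "\<bar>real n * (x k / sqrt (ip n x x))\<bar> \<le> real n * 1"
      unfolding abs_mult using mult_left_mono[OF a, of "real n"] by simp
    then show ?thesis by (simp only: abs_le_iff) linarith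
  qed
  moreover have "\<lfloor>y\<rfloor> \<in> {- int n..int n}" if "- real n \<le> y \<and> y \<le> real n" for y
    using that by (auto simp: le_floor_iff floor_le_iff)
  ultimately show ?thesis unfolding sector_def by (intro restrict_PiE_iff[THEN iffD2] ballI) simp
qed

lemma sector_eq_imp_ip_nonneg:
  assumes "sector n x = sector n y" "0 < n"
  shows "0 \<le> ip n x y"
proof (cases "ip n x x = 0 \<or> ip n y y = 0")
  case True
  then have "(\<forall>k<n. x k = 0) \<or> (\<forall>k<n. y k = 0)" by (simp add: ip_zero_iff)
  then show ?thesis by (auto simp: ip_def)
next
  case False
  define a where "a = sqrt (ip n x x)"
  define b where "b = sqrt (ip n y y)"
  have ab: "a > 0" "b > 0" "a * a = ip n x x" "b * b = ip n y y"
    using False ip_self_nonneg[of n x] ip_self_nonneg[of n y] by (auto simp: a_def b_def)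
  have "(x k / a - y k / b)\<^sup>2 \<le> (1 / n)\<^sup>2" if "k < n" for k
  proof -
    have "\<lfloor>real n * (x k / a)\<rfloor> = \<lfloor>real n * (y k / b)\<rfloor>"
      using fun_cong[OF assms(1), of k] that by (simp add: sector_def a_def b_def)
    then have "\<bar>real n * (x k / a) - real n * (y k / b)\<bar> \<le> 1" by linarith
    then have "real n * \<bar>x k / a - y k / b\<bar> \<le> 1"
      unfolding right_diff_distrib[symmetric] abs_mult by simp
    then have "\<bar>x k / a - y k / b\<bar> \<le> 1 / n"
      using assms(2) by (simp add: pos_le_divide_eq mult.commute)
    then show ?thesis by (metis abs_ge_zero power2_abs power_mono)
  qed
  then have "(\<Sum>k<n. (x k / a - y k / b)\<^sup>2) \<le> (\<Sum>k<n. (1 / n)\<^sup>2)" by (intro sum_mono) auto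
  also have "\<dots> \<le> 1" using assms(2) by (simp add: power2_eq_square field_simps)
  finally have le: "(\<Sum>k<n. (x k / a - y k / b)\<^sup>2) \<le> 1" .
  have "(\<Sum>k<n. (x k / a - y k / b)\<^sup>2)
      = (\<Sum>k<n. (1 / (a * a)) * (x k * x k) + (1 / (b * b)) * (y k * y k) - (2 / (a * b)) * (x k * y k))"
    by (intro sum.cong refl) (simp add: power2_eq_square algebra_simps)
  also have "\<dots> = (1 / (a * a)) * ip n x x + (1 / (b * b)) * ip n y y - (2 / (a * b)) * ip n x y"
    by (simp add: ip_def sum.distrib sum_subtractf sum_distrib_left)
  also have "\<dots> = 2 - (2 / (a * b)) * ip n x y" using ab by (simp add: ab(3,4)[symmetric])
  finally have "(2 / (a * b)) * ip n x y \<ge> 1" using le by simp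
  then have "0 \<le> (2 / (a * b)) * ip n x y" by simp
  moreover have "0 < 2 / (a * b)" using ab by simp
  ultimately show ?thesis by (metis zero_le_mult_iff not_le)
qed

lemma large_fibre:
  assumes "finite I" "finite C" "f ` I \<subseteq> C" "m * card C < card I"
  shows "\<exists>c\<in>C. m < card {i\<in>I. f i = c}"
proof (rule ccontr)
  assume "\<not> ?thesis"
  then have "(\<Sum>c\<in>C. card {i\<in>I. f i = c}) \<le> (\<Sum>c\<in>C. m)" by (intro sum_mono) (auto simp: not_less)
  moreover have "(\<Sum>c\<in>C. card {i\<in>I. f i = c}) = card I"
    using sum.group[OF assms(1-3), of "\<lambda>_. 1::nat"] by simp
  ultimately show False using assms(4) by (simp add: mult.commute)
qed

text \<open>
  The number of linear constraints, \<open>n\<^sup>2\<close> for the second moment and one for the mass, times the number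
  of sectors.
\<close>

definition frame_size :: "nat \<Rightarrow> nat" where
  "frame_size n = (n * n + 1) * (2 * n + 1) ^ n"

text \<open>
  Gaussian elimination: each equation is used to eliminate one unknown.
\<close>

lemma homogeneous_system:
  fixes a :: "nat \<Rightarrow> 'i \<Rightarrow> real"
  assumes "finite J" "m < card J"
  shows "\<exists>\<nu>. (\<exists>j\<in>J. \<nu> j \<noteq> 0) \<and> (\<forall>e<m. (\<Sum>j\<in>J. a e j * \<nu> j) = 0)"
  using assms
proof (induction m arbitrary: J a)
  case 0
  then obtain j where "j \<in> J" by fastforce
  then show ?case by (intro exI[of _ "\<lambda>_. 1"]) auto
next
  case (Suc m)
  show ?case
  proof (cases "\<forall>j\<in>J. a m j = 0")
    case True
    from Suc.IH[of J a] Suc.prems obtain \<nu> where "\<exists>j\<in>J. \<nu> j \<noteq> 0" "\<forall>e<m. (\<Sum>j\<in>J. a e j * \<nu> j) = 0" by auto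
    with True show ?thesis by (intro exI[of _ \<nu>]) (auto simp: less_Suc_eq)
  next
    case False
    then obtain p where p: "p \<in> J" "a m p \<noteq> 0" by blast
    define J' where "J' = J - {p}"
    have J': "finite J'" "m < card J'" using Suc.prems p by (auto simp: J'_def)
    from Suc.IH[OF this, of "\<lambda>e j. a e j - a e p / a m p * a m j"]
    obtain \<nu> where \<nu>: "\<exists>j\<in>J'. \<nu> j \<noteq> 0" "\<forall>e<m. (\<Sum>j\<in>J'. (a e j - a e p / a m p * a m j) * \<nu> j) = 0" by blast
    define s where "s = (\<Sum>j\<in>J'. a m j * \<nu> j)"
    define \<nu>' where "\<nu>' = \<nu>(p := - s / a m p)"
    have split: "(\<Sum>j\<in>J. a e j * \<nu>' j) = - a e p * s / a m p + (\<Sum>j\<in>J'. a e j * \<nu> j)" for e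
    proof -
      have "(\<Sum>j\<in>J. a e j * \<nu>' j) = a e p * \<nu>' p + (\<Sum>j\<in>J'. a e j * \<nu>' j)"
        using Suc.prems p by (simp add: J'_def sum.remove)
      also have "(\<Sum>j\<in>J'. a e j * \<nu>' j) = (\<Sum>j\<in>J'. a e j * \<nu> j)"
        by (intro sum.cong) (auto simp: \<nu>'_def J'_def)
      finally show ?thesis by (simp add: \<nu>'_def)
    qed
    have "(\<Sum>j\<in>J. a e j * \<nu>' j) = 0" if "e < Suc m" for e
    proof (cases "e = m")
      case True then show ?thesis using p split[of m] by (simp add: s_def)
    next
      case False
      with that \<nu> have "(\<Sum>j\<in>J'. (a e j - a e p / a m p * a m j) * \<nu> j) = 0" by simp
      then have "(\<Sum>j\<in>J'. a e j * \<nu> j) = a e p / a m p * s"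
        by (simp add: left_diff_distrib sum_subtractf s_def sum_distrib_left mult.assoc)
      then show ?thesis using split[of e] by simp
    qed
    moreover have "\<exists>j\<in>J. \<nu>' j \<noteq> 0" using \<nu>(1) by (auto simp: \<nu>'_def J'_def)
    ultimately show ?thesis by blast
  qed
qed

text \<open>
  One sector contains more vectors than there are linear constraints, so it carries a nonzero signed
  mass \<open>\<nu>\<close> that leaves the constraints unchanged. Within a sector the kernel is the inner product
  itself, so the quadratic term of the value along \<open>\<nu>\<close> is the squared norm of \<open>\<Sum>\<^sub>i \<nu> i * v i\<close>. With the sign of \<open>\<nu>\<close>
  chosen to make the linear term nonnegative, one moves along \<open>\<nu>\<close> until the first mass vanishes.
\<close>

lemma isotropic_reduce:
  assumes I: "isotropic n I w v" and n: "0 < n" and big: "frame_size n < card I"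
  shows "\<exists>J w'. J \<subset> I \<and> isotropic n J w' v \<and> measure_value n I v w w \<le> measure_value n J v w' w'"
proof -
  note M = I[unfolded isotropic_def]
  have fin: "finite I" using M by simp
  obtain c where c: "n * n + 1 < card {i\<in>I. sector n (v i) = c}"
  proof -
    have "card (PiE {..<n} (\<lambda>_. {- int n..int n})) = (2 * n + 1) ^ n"
    proof -
      have "nat (int n + int n + 1) = 2 * n + 1" by simp
      then show ?thesis by (simp add: card_PiE)
    qed
    then have "\<exists>c\<in>PiE {..<n} (\<lambda>_. {- int n..int n}). n * n + 1 < card {i\<in>I. sector n (v i) = c}"
      using fin big sector_range by (intro large_fibre) (auto simp: frame_size_def intro!: finite_PiE)
    then show thesis using that by blast
  qed
  define S where "S = {i\<in>I. sector n (v i) = c}"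
  have S: "finite S" "S \<subseteq> I" "n * n + 1 < card S" using fin c by (auto simp: S_def)
  define a where "a e j = (if e = n * n then 1 else v j (e div n) * v j (e mod n))" for e j
  obtain \<nu>0 where nu0: "\<exists>j\<in>S. \<nu>0 j \<noteq> 0" "\<And>e. e < n * n + 1 \<Longrightarrow> (\<Sum>j\<in>S. a e j * \<nu>0 j) = 0"
    using homogeneous_system[OF S(1,3), of a] by blast
  define \<nu>1 where "\<nu>1 i = (if i \<in> S then \<nu>0 i else 0)" for i
  have toS: "(\<Sum>i\<in>I. f i * \<nu>1 i) = (\<Sum>i\<in>S. f i * \<nu>0 i)" for f :: "'a \<Rightarrow> real"
  proof -
    have "(\<Sum>i\<in>I. f i * \<nu>1 i) = (\<Sum>i\<in>S. f i * \<nu>1 i)"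
      using fin S by (intro sum.mono_neutral_right) (auto simp: \<nu>1_def)
    also have "\<dots> = (\<Sum>i\<in>S. f i * \<nu>0 i)" by (intro sum.cong) (auto simp: \<nu>1_def)
    finally show ?thesis .
  qed
  have z1: "(\<Sum>i\<in>I. 1 * \<nu>1 i) = 0"
    unfolding toS using nu0(2)[of "n * n"] by (simp add: a_def)
  have z2: "(\<Sum>i\<in>I. (v i k * v i l) * \<nu>1 i) = 0" if "k < n" "l < n" for k l
  proof -
    have lt: "k * n + l < n * n" using that n
      by (metis mult.commute mult_less_cancel1 nat_neq_iff not_less_eq Suc_leI add_less_le_mono less_le_trans mult_le_mono1 mult_Suc add.commute add_less_cancel_right)
    have "a (k * n + l) = (\<lambda>j. v j k * v j l)" using that lt by (auto simp: a_def)
    with nu0(2)[of "k * n + l"] lt show ?thesis unfolding toS by simp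
  qed
  \<comment> \<open>The sign makes the linear term of the value nonnegative.\<close>
  define s where "s = (if 0 \<le> measure_value n I v w \<nu>1 then 1 else - 1::real)"
  define \<nu> where "\<nu> = (\<lambda>i. s * \<nu>1 i)"
  have s: "s * s = 1" by (simp add: s_def)
  have nu_sum: "(\<Sum>i\<in>I. \<nu> i) = 0" using z1 by (simp add: \<nu>_def sum_distrib_left[symmetric])
  have nu_mom: "(\<Sum>i\<in>I. \<nu> i * (v i k * v i l)) = 0" if "k < n" "l < n" for k l
  proof -
    have "(\<Sum>i\<in>I. \<nu> i * (v i k * v i l)) = s * (\<Sum>i\<in>I. (v i k * v i l) * \<nu>1 i)"
      by (simp add: \<nu>_def sum_distrib_left mult_ac)
    then show ?thesis using z2[OF that] by simp
  qed
  have lin: "0 \<le> measure_value n I v w \<nu>"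
    unfolding measure_value_def \<nu>_def bform_scale_right by (simp add: s_def measure_value_def)
  have quad: "0 \<le> measure_value n I v \<nu> \<nu>"
  proof -
    have pos: "\<bar>ip n (v i) (v j)\<bar> * \<nu> i * \<nu> j = ip n (v i) (v j) * \<nu> i * \<nu> j" for i j
    proof (cases "i \<in> S \<and> j \<in> S")
      case True
      then have "0 \<le> ip n (v i) (v j)" using n by (intro sector_eq_imp_ip_nonneg) (auto simp: S_def)
      then show ?thesis by simp
    next
      case False then show ?thesis by (auto simp: \<nu>_def \<nu>1_def)
    qed
    have "measure_value n I v \<nu> \<nu> = (\<Sum>i\<in>I. \<Sum>j\<in>I. ip n (v i) (v j) * \<nu> i * \<nu> j)"
      unfolding measure_value_def bform_def by (simp add: pos)
    also have "\<dots> = ip n (\<lambda>k. \<Sum>i\<in>I. \<nu> i * v i k) (\<lambda>k. \<Sum>j\<in>I. \<nu> j * v j k)"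
      by (simp add: ip_sum_left ip_sum_right ip_scale_left ip_scale_right mult_ac)
    finally show ?thesis using ip_self_nonneg by simp
  qed
  have "\<exists>i\<in>I. \<nu> i < 0"
  proof (rule ccontr)
    assume "\<not> ?thesis"
    then have "\<forall>i\<in>I. \<nu> i = 0" using nu_sum fin by (subst (asm) sum_nonneg_eq_0_iff) (auto simp: not_less)
    moreover obtain j where "j \<in> S" "\<nu>0 j \<noteq> 0" using nu0(1) by blast
    moreover have "\<nu> j \<noteq> 0" using calculation s by (auto simp: \<nu>_def \<nu>1_def)
    ultimately show False using S(2) by auto
  qed
  define R where "R = (\<lambda>i. w i / (- \<nu> i)) ` {i\<in>I. \<nu> i < 0}"
  \<comment> \<open>The step length at which the first mass vanishes, at the index \<open>p\<close>.\<close>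
  define r where "r = Min R"
  have R: "finite R" "R \<noteq> {}" using fin \<open>\<exists>i\<in>I. \<nu> i < 0\<close> by (auto simp: R_def)
  have "r \<in> R" unfolding r_def by (rule Min_in[OF R])
  then obtain p where p: "p \<in> I" "\<nu> p < 0" "r = w p / (- \<nu> p)" by (auto simp: R_def)
  have r0: "r > 0" unfolding p(3) by (rule divide_pos_pos) (use p M in auto)
  define w' where "w' i = w i + r * \<nu> i" for i
  have w'p: "w' p = 0" using p by (simp add: w'_def)
  have w'0: "0 \<le> w' i" if "i \<in> I" for i
  proof (cases "\<nu> i < 0")
    case True
    then have "r \<le> w i / (- \<nu> i)" unfolding r_def using R that by (intro Min_le) (auto simp: R_def)
    then have "r * (- \<nu> i) \<le> w i" using True by (subst (asm) pos_le_divide_eq) auto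
    then show ?thesis by (simp add: w'_def)
  next
    case False
    have "0 \<le> r * \<nu> i" using False r0 by simp
    then show ?thesis using M that by (auto simp: w'_def intro!: add_nonneg_nonneg less_imp_le)
  qed
  define J where "J = {i\<in>I. 0 < w' i}"
  have "p \<notin> J" "J \<subseteq> I" using w'p by (auto simp: J_def)
  then have J: "J \<subset> I" using p(1) by blast
  have IJ: "(\<Sum>i\<in>I. f i * w' i) = (\<Sum>i\<in>J. f i * w' i)" for f :: "'a \<Rightarrow> real"
    using fin w'0 by (intro sum.mono_neutral_right) (force simp: J_def)+
  have "(\<Sum>i\<in>J. w' i) = 1"
    using IJ[of "\<lambda>_. 1"] M nu_sum by (simp add: w'_def sum.distrib sum_distrib_left[symmetric])
  moreover have "(\<Sum>i\<in>J. w' i * (v i k * v i l)) = (if k = l then 1 else 0)" if "k < n" "l < n" for k l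
  proof -
    have "(\<Sum>i\<in>J. w' i * (v i k * v i l)) = (\<Sum>i\<in>I. w' i * (v i k * v i l))"
      using IJ[of "\<lambda>i. v i k * v i l"] by (simp add: mult.commute)
    also have "\<dots> = (\<Sum>i\<in>I. w i * (v i k * v i l)) + r * (\<Sum>i\<in>I. \<nu> i * (v i k * v i l))"
      by (simp add: w'_def distrib_right sum.distrib sum_distrib_left mult.assoc)
    finally show ?thesis using M that nu_mom[OF that] by simp
  qed
  ultimately have "isotropic n J w' v" using fin by (auto simp: isotropic_def J_def)
  moreover have "measure_value n I v w w \<le> measure_value n J v w' w'"
  proof -
    have "measure_value n J v w' w' = measure_value n I v w' w'"
    proof -
      have "measure_value n I v w' w' = (\<Sum>i\<in>I. (\<Sum>j\<in>I. \<bar>ip n (v i) (v j)\<bar> * w' j) * w' i)"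
        unfolding measure_value_def bform_eq ..
      also have "\<dots> = (\<Sum>i\<in>J. (\<Sum>j\<in>J. \<bar>ip n (v i) (v j)\<bar> * w' j) * w' i)"
        unfolding IJ ..
      finally show ?thesis by (simp add: measure_value_def bform_eq)
    qed
    also have "measure_value n I v w' w' = measure_value n I v w w + 2 * r * measure_value n I v w \<nu> + r\<^sup>2 * measure_value n I v \<nu> \<nu>"
      unfolding measure_value_def w'_def by (rule bform_quadratic) (simp add: ip_commute)
    finally show ?thesis using lin quad r0 by simp
  qed
  ultimately show ?thesis using J by blast
qed

lemma isotropic_small:
  assumes "isotropic n I w v" "0 < n"
  shows "\<exists>J w'. J \<subseteq> I \<and> card J \<le> frame_size n \<and> isotropic n J w' v \<and> measure_value n I v w w \<le> measure_value n J v w' w'"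
  using assms(1)
proof (induction "card I" arbitrary: I w rule: less_induct)
  case less
  show ?case
  proof (cases "card I \<le> frame_size n")
    case True with less.prems show ?thesis by blast
  next
    case False
    then obtain J w' where J: "J \<subset> I" "isotropic n J w' v" "measure_value n I v w w \<le> measure_value n J v w' w'"
      using isotropic_reduce[OF less.prems assms(2)] by (auto simp: not_le)
    have "finite I" using less.prems by (simp add: isotropic_def)
    then have "card J < card I" using J(1) by (rule psubset_card_mono)
    from less.hyps[OF this J(2)] obtain J' w'' where J': "J' \<subseteq> J" "card J' \<le> frame_size n"
      "isotropic n J' w'' v" "measure_value n J v w' w' \<le> measure_value n J' v w'' w''" by blast
    then show ?thesis using J by (intro exI[of _ J'] exI[of _ w'']) auto
  qed
qed

lemma weighted_frame_small:
  assumes w: "weighted_frame n I t u" and n: "0 < n"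
  obtains t' u' where "weighted_frame n {..<frame_size n} t' u'" "frame_value n I t u \<le> frame_value n {..<frame_size n} t' u'"
proof -
  obtain d :: nat and T U where W: "weighted_frame n {..<d} T U" "\<forall>i<d. 0 < T i" "frame_value n I t u \<le> frame_value n {..<d} T U"
    using weighted_frame_spread[OF w] by blast
  define v where "v i k = U i k / T i" for i k
  have Tv: "T i * v i k = U i k" if "i < d" for i k using W(2)[rule_format, OF that] by (simp add: v_def)
  have "(\<Sum>i<d. (T i)\<^sup>2 * (v i k * v i l)) = (\<Sum>i<d. U i k * U i l)" for k l
  proof (intro sum.cong refl)
    fix i assume "i \<in> {..<d}"
    have "(T i)\<^sup>2 * (v i k * v i l) = (T i * v i k) * (T i * v i l)" by (simp add: power2_eq_square)
    also have "\<dots> = U i k * U i l" using Tv \<open>i \<in> {..<d}\<close> by simp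
    finally show "(T i)\<^sup>2 * (v i k * v i l) = U i k * U i l" .
  qed
  moreover have "\<forall>i\<in>{..<d}. 0 < (T i)\<^sup>2" using W(2) by (intro ballI zero_less_power) simp
  ultimately have "isotropic n {..<d} (\<lambda>i. (T i)\<^sup>2) v"
    using W(1) by (simp add: isotropic_def weighted_frame_def tight_def)
  from isotropic_small[OF this n] obtain J w' where J: "card J \<le> frame_size n" "isotropic n J w' v"
    "measure_value n {..<d} v (\<lambda>i. (T i)\<^sup>2) (\<lambda>i. (T i)\<^sup>2) \<le> measure_value n J v w' w'" by blast
  have q1: "measure_value n {..<d} v (\<lambda>i. (T i)\<^sup>2) (\<lambda>i. (T i)\<^sup>2) = frame_value n {..<d} T U"
    unfolding measure_value_def bform_def frame_value_def
  proof (intro sum.cong refl)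
    fix i j assume ij: "i \<in> {..<d}" "j \<in> {..<d}"
    have "ip n (U i) (U j) = T i * T j * ip n (v i) (v j)"
    proof -
      have "U i = (\<lambda>k. T i * v i k)" "U j = (\<lambda>k. T j * v j k)" using ij Tv by auto
      then show ?thesis by (simp only: ip_scale_left ip_scale_right mult.assoc)
    qed
    then show "\<bar>ip n (v i) (v j)\<bar> * (T i)\<^sup>2 * (T j)\<^sup>2 = T i * T j * \<bar>ip n (U i) (U j)\<bar>"
      using W(2)[rule_format, of i] W(2)[rule_format, of j] ij by (simp add: abs_mult power2_eq_square)
  qed
  note M = J(2)[unfolded isotropic_def]
  define T' where "T' i = sqrt (w' i)" for i
  define U' where "U' i k = sqrt (w' i) * v i k" for i k
  have sq: "sqrt (w' i) * sqrt (w' i) = w' i" if "i \<in> J" for i using M that by (simp add: less_imp_le)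
  have "(\<Sum>i\<in>J. U' i k * U' i l) = (\<Sum>i\<in>J. w' i * (v i k * v i l))" for k l
  proof (intro sum.cong refl)
    fix i assume "i \<in> J"
    have "U' i k * U' i l = (sqrt (w' i) * sqrt (w' i)) * (v i k * v i l)" by (simp add: U'_def)
    then show "U' i k * U' i l = w' i * (v i k * v i l)" using sq[OF \<open>i \<in> J\<close>] by simp
  qed
  then have W': "weighted_frame n J T' U'"
    using M by (auto simp: weighted_frame_def tight_def T'_def less_imp_le)
  have q2: "measure_value n J v w' w' = frame_value n J T' U'"
    unfolding measure_value_def bform_def frame_value_def
  proof (intro sum.cong refl)
    fix i j assume ij: "i \<in> J" "j \<in> J"
    have "\<bar>ip n (U' i) (U' j)\<bar> = sqrt (w' i) * sqrt (w' j) * \<bar>ip n (v i) (v j)\<bar>"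
    proof -
      have "U' i = (\<lambda>k. sqrt (w' i) * v i k)" "U' j = (\<lambda>k. sqrt (w' j) * v j k)" by (auto simp: U'_def)
      then have "ip n (U' i) (U' j) = sqrt (w' i) * sqrt (w' j) * ip n (v i) (v j)"
        by (simp only: ip_scale_left ip_scale_right mult.assoc)
      moreover have "0 \<le> sqrt (w' i) * sqrt (w' j)" using M ij by (simp add: less_imp_le)
      ultimately show ?thesis by (simp only: abs_mult[of "sqrt (w' i) * sqrt (w' j)"] abs_of_nonneg)
    qed
    then have "T' i * T' j * \<bar>ip n (U' i) (U' j)\<bar> = (sqrt (w' i) * sqrt (w' i)) * (sqrt (w' j) * sqrt (w' j)) * \<bar>ip n (v i) (v j)\<bar>"
      by (simp only: T'_def mult_ac)
    then show "\<bar>ip n (v i) (v j)\<bar> * w' i * w' j = T' i * T' j * \<bar>ip n (U' i) (U' j)\<bar>"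
      using sq ij by simp
  qed
  obtain t' u' where E: "weighted_frame n {..<card J} t' u'" "frame_value n {..<card J} t' u' = frame_value n J T' U'"
    using weighted_frame_enumerate[OF W'] by blast
  define tt where "tt i = (if i < card J then t' i else 0)" for i
  define uu where "uu i k = (if i < card J then u' i k else 0)" for i k
  have cut: "(\<Sum>i<frame_size n. f i) = (\<Sum>i<card J. f i)" if "\<And>i. card J \<le> i \<Longrightarrow> f i = 0" for f :: "nat \<Rightarrow> real"
    using J(1) that by (intro sum.mono_neutral_right) auto
  have "weighted_frame n {..<frame_size n} tt uu"
    using E(1) by (auto simp: weighted_frame_def tight_def tt_def uu_def cut)
  moreover have "frame_value n {..<frame_size n} tt uu = frame_value n {..<card J} t' u'"
  proof -
    have "frame_value n {..<frame_size n} tt uu = (\<Sum>i<card J. \<Sum>j<card J. tt i * tt j * \<bar>ip n (uu i) (uu j)\<bar>)"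
      unfolding frame_value_def by (subst cut, simp add: tt_def, intro sum.cong refl cut, simp add: tt_def)
    also have "\<dots> = frame_value n {..<card J} t' u'"
      unfolding frame_value_def by (intro sum.cong refl) (simp add: tt_def ip_def uu_def)
    finally show ?thesis .
  qed
  ultimately show thesis using that W(3) J(3) q1 q2 E(2) by simp
qed

section \<open>Existence of an optimal frame\<close>

definition frame_bound :: "nat \<Rightarrow> real \<Rightarrow> bool" where
  "frame_bound n B \<longleftrightarrow> (\<forall>d t u. weighted_frame n {..<d::nat} t u \<longrightarrow> frame_value n {..<d} t u \<le> B)"

lemma frame_boundD:
  assumes "frame_bound n B" "weighted_frame n I t u"
  shows "frame_value n I t u \<le> B"
  using weighted_frame_enumerate[OF assms(2)] assms(1) unfolding frame_bound_def by metis

lemma weighted_frame_basis: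
  assumes "0 < n"
  shows "weighted_frame n {..<n} (\<lambda>_. 1 / sqrt n) (\<lambda>i k. if i = k then 1 else 0)"
  using assms by (auto simp: weighted_frame_def tight_def power_divide if_distrib cong: if_cong)

lemma frame_value_bform: "frame_value n I t u = bform I (\<lambda>i j. \<bar>ip n (u i) (u j)\<bar>) t t"
  unfolding frame_value_def bform_def by (intro sum.cong refl) (simp add: mult_ac)

lemma tight_entry_le_1:
  assumes "tight n I u" "finite I" "i \<in> I" "k < n"
  shows "\<bar>u i k\<bar> \<le> 1"
proof -
  have "u i k * u i k \<le> (\<Sum>i\<in>I. u i k * u i k)" using assms by (intro member_le_sum) auto
  then show ?thesis using tightD[OF assms(1,4,4)] by (simp add: abs_square_le_1 power2_eq_square[symmetric])
qed

text \<open>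
  A weighted frame is encoded as one real function on pairs, with \<open>t\<close> stored in column \<open>n\<close>; the constraints
  define a closed subset of a compact cube.
\<close>

lemma weighted_frame_maximum_exists:
  assumes ne: "weighted_frame n {..<d::nat} t0 u0"
  shows "\<exists>t u. weighted_frame n {..<d} t u \<and> (\<forall>t' u'. weighted_frame n {..<d} t' u' \<longrightarrow> frame_value n {..<d} t' u' \<le> frame_value n {..<d} t u)"
proof -
  define t where "t z i = z (i, n)" for z :: "nat \<times> nat \<Rightarrow> real" and i
  define u where "u z i k = z (i, k)" for z :: "nat \<times> nat \<Rightarrow> real" and i k
  define C where "C = (\<Inter>k\<in>{..<n}. \<Inter>l\<in>{..<n}. {z. (\<Sum>i<d. u z i k * u z i l) = (if k = l then 1 else 0)})
     \<inter> (\<Inter>i\<in>{..<d}. {z. 0 \<le> t z i}) \<inter> {z. (\<Sum>i<d. (t z i)\<^sup>2) = 1}"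
  define K where "K = {z. \<forall>p. \<bar>z p\<bar> \<le> 1} \<inter> C"
  have cont: "continuous_on A (\<lambda>z. z p)" for A and p :: "nat \<times> nat"
    by (rule continuous_on_subset[OF continuous_on_product_coordinates]) auto
  have "closed C"
    unfolding C_def t_def u_def
    by (intro closed_Int closed_INT ballI closed_Collect_eq closed_Collect_le continuous_intros cont)
  then have "compact K" unfolding K_def by (intro compact_Int_closed compact_cube)
  have wC: "weighted_frame n {..<d} (t z) (u z) \<longleftrightarrow> z \<in> C" for z
    by (auto simp: weighted_frame_def tight_def C_def)
  define enc where "enc t' u' = (\<lambda>(i,k). if i < d then if k < n then u' i k else if k = n then t' i else (0::real) else 0)" for t' :: "nat \<Rightarrow> real" and u' :: "nat \<Rightarrow> nat \<Rightarrow> real"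
  have tenc: "t (enc t' u') i = t' i" if "i < d" for t' u' i using that by (simp add: t_def enc_def)
  have uenc: "u (enc t' u') i k = u' i k" if "i < d" "k < n" for t' u' i k using that by (simp add: u_def enc_def)
  have encC: "enc t' u' \<in> K" if w: "weighted_frame n {..<d} t' u'" for t' u'
  proof -
    have "weighted_frame n {..<d} (t (enc t' u')) (u (enc t' u'))"
      using w by (simp add: weighted_frame_def tight_def tenc uenc)
    moreover have "\<bar>enc t' u' p\<bar> \<le> 1" for p
    proof -
      have "\<bar>u' i k\<bar> \<le> 1" if "i < d" "k < n" for i k
        using tight_entry_le_1[of n "{..<d}" u'] w that by (simp add: weighted_frame_def)
      moreover have "\<bar>t' i\<bar> \<le> 1" if "i < d" for i
      proof -
        have "(t' i)\<^sup>2 \<le> (\<Sum>i<d. (t' i)\<^sup>2)" using that by (intro member_le_sum) auto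
        then show ?thesis using w by (simp add: weighted_frame_def abs_square_le_1)
      qed
      ultimately show ?thesis by (cases p) (simp add: enc_def)
    qed
    ultimately show ?thesis unfolding K_def wC by simp
  qed
  have qenc: "frame_value n {..<d} (t (enc t' u')) (u (enc t' u')) = frame_value n {..<d} t' u'" for t' u'
    unfolding frame_value_def by (intro sum.cong refl) (simp add: tenc uenc ip_def)
  have "K \<noteq> {}" using encC[OF ne] by blast
  have "continuous_on K (\<lambda>z. frame_value n {..<d} (t z) (u z))"
    unfolding frame_value_def ip_def t_def u_def by (intro continuous_intros cont)
  from continuous_attains_sup[OF \<open>compact K\<close> \<open>K \<noteq> {}\<close> this]
  obtain z where z: "z \<in> K" "\<forall>y\<in>K. frame_value n {..<d} (t y) (u y) \<le> frame_value n {..<d} (t z) (u z)" by blast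
  show ?thesis
  proof (intro exI conjI allI impI)
    show "weighted_frame n {..<d} (t z) (u z)" using z(1) wC by (simp add: K_def)
    fix t' u' assume "weighted_frame n {..<d} t' u'"
    then show "frame_value n {..<d} t' u' \<le> frame_value n {..<d} (t z) (u z)"
      using z(2)[rule_format, OF encC] qenc by metis
  qed
qed

text \<open>
  Frames of at most \<open>frame_size n\<close> vectors suffice for the supremum, and for this size it is attained.
  Spreading the weights of a maximiser makes them positive; the new frame may have more vectors, but
  it still cannot exceed the bound.
\<close>

lemma frame_maximum_exists:
  assumes "0 < n"
  shows "\<exists>B (d::nat) t u. weighted_frame n {..<d} t u \<and> (\<forall>i<d. 0 < t i) \<and> frame_value n {..<d} t u = B \<and> frame_bound n B"
proof -
  obtain t0 u0 where "weighted_frame n {..<frame_size n} t0 u0"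
    using weighted_frame_small[OF weighted_frame_basis[OF assms] assms] by metis
  from weighted_frame_maximum_exists[OF this] obtain t u where m: "weighted_frame n {..<frame_size n} t u"
    "\<forall>t' u'. weighted_frame n {..<frame_size n} t' u' \<longrightarrow> frame_value n {..<frame_size n} t' u' \<le> frame_value n {..<frame_size n} t u"
    by blast
  define B where "B = frame_value n {..<frame_size n} t u"
  have B: "frame_bound n B"
    unfolding frame_bound_def
  proof (intro allI impI)
    fix d t' u' assume w: "weighted_frame n {..<d::nat} t' u'"
    obtain t'' u'' where "weighted_frame n {..<frame_size n} t'' u''" "frame_value n {..<d} t' u' \<le> frame_value n {..<frame_size n} t'' u''"
      using weighted_frame_small[OF w assms] by blast
    then show "frame_value n {..<d} t' u' \<le> B" using m(2) unfolding B_def by (meson order_trans)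
  qed
  obtain d :: nat and T U where W: "weighted_frame n {..<d} T U" "\<forall>i<d. 0 < T i" "frame_value n {..<frame_size n} t u \<le> frame_value n {..<d} T U"
    using weighted_frame_spread[OF m(1)] by blast
  have "frame_value n {..<d} T U = B" using frame_boundD[OF B W(1)] W(3) by (simp add: B_def)
  then show ?thesis using W B by blast
qed

section \<open>Stationarity and positivity of an optimal frame\<close>

lemma abs_gram_form_le:
  assumes B: "frame_bound n B" and u: "tight n I u" "finite I"
  shows "bform I (\<lambda>i j. \<bar>ip n (u i) (u j)\<bar>) x x \<le> B * (\<Sum>i\<in>I. (x i)\<^sup>2)"
proof -
  define s where "s = (\<Sum>i\<in>I. (x i)\<^sup>2)"
  show ?thesis
  proof (cases "s = 0")
    case True
    then have "\<forall>i\<in>I. x i = 0" using u by (simp add: s_def sum_nonneg_eq_0_iff)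
    then show ?thesis by (simp add: bform_def)
  next
    case False
    then have s: "s > 0" by (simp add: s_def sum_nonneg order.not_eq_order_implies_strict)
    define t where "t i = (1 / sqrt s) * \<bar>x i\<bar>" for i
    have "(\<Sum>i\<in>I. (t i)\<^sup>2) = (\<Sum>i\<in>I. (x i)\<^sup>2 / s)"
      using s by (intro sum.cong) (auto simp: t_def power_divide)
    also have "\<dots> = s / s" unfolding sum_divide_distrib[symmetric] s_def[symmetric] ..
    finally have "weighted_frame n I t u" using s u by (simp add: weighted_frame_def t_def)
    from frame_boundD[OF B this] have "(1 / sqrt s) * ((1 / sqrt s) * bform I (\<lambda>i j. \<bar>ip n (u i) (u j)\<bar>) (\<lambda>i. \<bar>x i\<bar>) (\<lambda>i. \<bar>x i\<bar>)) \<le> B"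
      unfolding frame_value_bform t_def bform_scale_left bform_scale_right .
    then have "bform I (\<lambda>i j. \<bar>ip n (u i) (u j)\<bar>) (\<lambda>i. \<bar>x i\<bar>) (\<lambda>i. \<bar>x i\<bar>) \<le> B * s"
      using s by (simp add: field_simps)
    moreover have "bform I (\<lambda>i j. \<bar>ip n (u i) (u j)\<bar>) x x \<le> bform I (\<lambda>i j. \<bar>ip n (u i) (u j)\<bar>) (\<lambda>i. \<bar>x i\<bar>) (\<lambda>i. \<bar>x i\<bar>)"
      unfolding bform_def by (intro sum_mono) (metis abs_ge_self abs_mult abs_abs mult.assoc)
    ultimately show ?thesis by (simp add: s_def)
  qed
qed

text \<open>
  A maximiser over frames of all sizes, with positive weights.
\<close>

locale optimal_frame =
  fixes n d :: nat and B :: real and t :: "nat \<Rightarrow> real" and u :: "nat \<Rightarrow> nat \<Rightarrow> real"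
  assumes wf: "weighted_frame n {..<d} t u" and pos: "\<And>i. i < d \<Longrightarrow> 0 < t i"
    and val: "frame_value n {..<d} t u = B" and bound: "frame_bound n B"
begin

lemma tight_u: "tight n {..<d} u" and sum_t: "(\<Sum>i<d. (t i)\<^sup>2) = 1"
  using wf by (simp_all add: weighted_frame_def)

lemma perron:
  assumes "i < d"
  shows "(\<Sum>j<d. \<bar>ip n (u i) (u j)\<bar> * t j) = B * t i"
proof -
  let ?X = "\<lambda>i j. \<bar>ip n (u i) (u j)\<bar>"
  let ?e = "\<lambda>j. if j = i then 1 else (0::real)"
  have "bform {..<d} ?X t ?e = B * (\<Sum>j<d. t j * ?e j)"
  proof (rule rayleigh_stationary)
    show "bform {..<d} ?X t t = B * (\<Sum>i<d. (t i)\<^sup>2)" using val sum_t by (simp add: frame_value_bform)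
  qed (auto simp: ip_commute intro: abs_gram_form_le[OF bound tight_u])
  then show ?thesis using assms by (simp add: bform_unit ip_commute if_distrib cong: if_cong)
qed

text \<open>
  For any frame \<open>v\<close>, the trace of \<open>t\<^sub>i t\<^sub>j S\<^sub>i\<^sub>j\<close> on its column space is at most the frame value of \<open>v\<close>, hence at
  most \<open>B\<close>, with equality for \<open>u\<close>. So \<open>u\<close> maximises this trace. At orthogonal pairs, \<open>S\<close> is
  restricted only by symmetry and \<open>|S i j| \<le> 1\<close>.
\<close>

lemma invariant:
  assumes S: "\<And>i j. i < d \<Longrightarrow> j < d \<Longrightarrow> S i j = S j i" "\<And>i j. i < d \<Longrightarrow> j < d \<Longrightarrow> \<bar>S i j\<bar> \<le> 1"
    "\<And>i j. i < d \<Longrightarrow> j < d \<Longrightarrow> S i j * ip n (u i) (u j) = \<bar>ip n (u i) (u j)\<bar>"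
    and "k < n" "i < d"
  shows "(\<Sum>j<d. t i * t j * S i j * u j k)
    = (\<Sum>l<n. u i l * bform {..<d} (\<lambda>i j. t i * t j * S i j) (\<lambda>i. u i l) (\<lambda>i. u i k))"
proof (rule trace_maximal_invariant[OF _ _ tight_u])
  have "(\<Sum>i<d. \<Sum>j<d. t i * t j * S i j * ip n (u i) (u j)) = frame_value n {..<d} t u"
    unfolding frame_value_def by (intro sum.cong refl) (simp add: S(3) mult.assoc)
  then have eq: "(\<Sum>i<d. \<Sum>j<d. t i * t j * S i j * ip n (u i) (u j)) = B" using val by simp
  fix v assume v: "tight n {..<d} v"
  have "(\<Sum>i<d. \<Sum>j<d. t i * t j * S i j * ip n (v i) (v j)) \<le> frame_value n {..<d} t v"
    unfolding frame_value_def
  proof (intro sum_mono)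
    fix i j assume ij: "i \<in> {..<d}" "j \<in> {..<d}"
    have "S i j * ip n (v i) (v j) \<le> \<bar>S i j\<bar> * \<bar>ip n (v i) (v j)\<bar>" by (metis abs_ge_self abs_mult)
    also have "\<dots> \<le> 1 * \<bar>ip n (v i) (v j)\<bar>" using S(2) ij by (intro mult_right_mono) auto
    finally have "(t i * t j) * (S i j * ip n (v i) (v j)) \<le> (t i * t j) * \<bar>ip n (v i) (v j)\<bar>"
      using pos[of i] pos[of j] ij by (intro mult_left_mono) auto
    then show "t i * t j * S i j * ip n (v i) (v j) \<le> t i * t j * \<bar>ip n (v i) (v j)\<bar>" by (simp add: mult.assoc)
  qed
  also have "\<dots> \<le> B" using v wf by (intro frame_boundD[OF bound]) (auto simp: weighted_frame_def)
  finally show "(\<Sum>k<n. bform {..<d} (\<lambda>i j. t i * t j * S i j) (\<lambda>i. v i k) (\<lambda>i. v i k))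
    \<le> (\<Sum>k<n. bform {..<d} (\<lambda>i j. t i * t j * S i j) (\<lambda>i. u i k) (\<lambda>i. u i k))"
    unfolding frame_trace eq .
qed (use assms in auto)

text \<open>
  The sign at the pair \<open>i, j\<close> is free. Subtracting the invariance for the signs \<open>1\<close> and \<open>0\<close>, and applying the
  result to \<open>u j\<close>, shows that the \<open>i\<close>-th unit vector lies in the column space. Then row \<open>i\<close> of the
  projection is this unit vector, and the Perron equation at \<open>i\<close> reads \<open>t i = B * t i\<close>.
\<close>

lemma orthogonal_pair_imp_bound_1:
  assumes ij: "i < d" "j < d" "i \<noteq> j" and z: "ip n (u i) (u j) = 0" and uj: "ip n (u j) (u j) \<noteq> 0"
  shows "B = 1"
proof -
  define S where "S c a b = (if a = i \<and> b = j \<or> a = j \<and> b = i then c else sgn (ip n (u a) (u b)))" for c :: real and a b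
  define M where "M c l k = bform {..<d} (\<lambda>a b. t a * t b * S c a b) (\<lambda>a. u a l) (\<lambda>a. u a k)" for c l k
  \<comment> \<open>Only the signs at the pair depend on \<open>c\<close>; both values used below are admissible.\<close>
  have inv: "(\<Sum>b<d. t a * t b * S c a b * u b k) = (\<Sum>l<n. u a l * M c l k)"
    if "\<bar>c\<bar> \<le> 1" "k < n" "a < d" for c k a
    unfolding M_def
  proof (rule invariant)
    fix a b
    show "S c a b = S c b a" by (auto simp: S_def ip_commute)
    show "\<bar>S c a b\<bar> \<le> 1" using that(1) by (auto simp: S_def sgn_if)
    show "S c a b * ip n (u a) (u b) = \<bar>ip n (u a) (u b)\<bar>"
      using z by (auto simp: S_def ip_commute sgn_if abs_if)
  qed (use that in auto)
  define y where "y = (\<lambda>l. (1 / (t i * t j)) * (\<Sum>k<n. u j k * (M 1 l k - M 0 l k)))"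
  have titj: "t i * t j > 0" using pos ij by simp
  have range: "ip n (u a) y = (if a = i then ip n (u j) (u j) else 0)" if a: "a < d" for a
  proof -
    have dif: "(\<Sum>b<d. t a * t b * (S 1 a b - S 0 a b) * u b k) = (\<Sum>l<n. u a l * (M 1 l k - M 0 l k))" if "k < n" for k
      using inv[of 1 k a] inv[of 0 k a] that a by (simp add: sum_subtractf algebra_simps)
    have dS: "S 1 a b - S 0 a b = (if a = i \<and> b = j \<or> a = j \<and> b = i then 1 else 0)" for b
      by (simp add: S_def)
    have "(t i * t j) * ip n (u a) y = (\<Sum>l<n. \<Sum>k<n. u a l * (u j k * (M 1 l k - M 0 l k)))"
    proof -
      have "(t i * t j) * ip n (u a) y = ip n (u a) (\<lambda>l. \<Sum>k<n. u j k * (M 1 l k - M 0 l k))"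
        using pos[of i] pos[of j] ij unfolding y_def ip_scale_right by simp
      then show ?thesis by (simp only: ip_def sum_distrib_left)
    qed
    also have "\<dots> = (\<Sum>k<n. u j k * (\<Sum>l<n. u a l * (M 1 l k - M 0 l k)))"
      by (subst sum.swap) (simp add: sum_distrib_left mult.left_commute)
    also have "\<dots> = (\<Sum>k<n. u j k * (\<Sum>b<d. t a * t b * (S 1 a b - S 0 a b) * u b k))"
      by (intro sum.cong refl) (simp add: dif)
    also have "\<dots> = (\<Sum>b<d. t a * t b * (S 1 a b - S 0 a b) * ip n (u j) (u b))"
      unfolding sum_distrib_left ip_def by (subst sum.swap) (simp add: mult_ac)
    also have "\<dots> = (t i * t j) * (if a = i then ip n (u j) (u j) else 0)"
    proof -
      consider "a = i" | "a = j" | "a \<noteq> i" "a \<noteq> j" by blast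
      then show ?thesis
      proof cases
        case 1
        have "(\<Sum>b<d. t a * t b * (S 1 a b - S 0 a b) * ip n (u j) (u b)) = (\<Sum>b<d. if b = j then t i * t j * ip n (u j) (u j) else 0)"
          by (intro sum.cong refl) (simp only: dS, use 1 ij in auto)
        then show ?thesis using 1 ij by simp
      next
        case 2
        have "(\<Sum>b<d. t a * t b * (S 1 a b - S 0 a b) * ip n (u j) (u b)) = (\<Sum>b<d. 0)"
          by (intro sum.cong refl) (simp only: dS, use 2 ij z in \<open>auto simp: ip_commute\<close>)
        then show ?thesis using 2 ij by simp
      next
        case 3
        then show ?thesis by (simp add: dS)
      qed
    qed
    finally have e: "(t i * t j) * ip n (u a) y = (t i * t j) * (if a = i then ip n (u j) (u j) else 0)" .
    show ?thesis by (rule iffD1[OF mult_left_cancel e]) (rule less_imp_neq[OF titj, symmetric])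
  qed
  define s where "s = ip n (u j) (u j)"
  \<comment> \<open>Up to the factor \<open>s\<close>, \<open>y\<close> exhibits the \<open>i\<close>-th unit vector as an element of the column space.\<close>
  have row: "ip n (u i) (u a) = (if a = i then 1 else 0)" if a: "a < d" for a
  proof -
    have "ip n (u a) y = (\<Sum>b<d. ip n (u a) (u b) * ip n (u b) y)"
      using tight_parseval[OF tight_u] by simp
    also have "\<dots> = (\<Sum>b<d. if b = i then ip n (u a) (u i) * s else 0)"
      by (intro sum.cong refl) (auto simp: range s_def)
    also have "\<dots> = ip n (u a) (u i) * s" using ij by simp
    finally have e: "ip n (u a) y = ip n (u a) (u i) * s" .
    have "ip n (u a) (u i) * s = (if a = i then s else 0)"
      by (rule trans[OF sym[OF e] range[OF a, folded s_def]])
    then show ?thesis using uj by (auto simp: s_def ip_commute)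
  qed
  have "B * t i = (\<Sum>b<d. if b = i then t i else 0)"
    unfolding perron[OF ij(1), symmetric] by (intro sum.cong refl) (auto simp: row)
  then show ?thesis using ij pos[of i] by simp
qed

end

text \<open>
  The orthogonal complement of the all-ones vector in dimension \<open>n + 1\<close>, with constant weights, has the
  value \<open>2 * n / (n + 1)\<close>.
\<close>

lemma frame_bound_gt_1:
  assumes B: "frame_bound n B" and n: "2 \<le> n"
  shows "1 < B"
proof -
  define P where "P i j = (if i = j then 1 else 0) - 1 / real (n + 1)" for i j :: nat
  have "(\<Sum>k<n+1. P i k * P k j) = P i j" if ij: "i < n + 1" "j < n + 1" for i j
  proof -
    have "(\<Sum>k<n+1. P i k * P k j) = (\<Sum>k<n+1. (if k = i then (if i = j then 1 else 0) - 1 / real (n+1) else 0)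
        - (if k = j then 1 / real (n+1) else 0) + 1 / real (n + 1) * (1 / real (n+1)))"
      by (intro sum.cong refl) (auto simp: P_def algebra_simps)
    also have "\<dots> = P i j" using ij by (simp add: sum.distrib sum_subtractf P_def del: sum.lessThan_Suc)
    finally show ?thesis .
  qed
  then obtain m u where u: "tight m {..<n+1} u" "\<And>i j. i < n+1 \<Longrightarrow> j < n+1 \<Longrightarrow> P i j = ip m (u i) (u j)"
    by (rule idempotent_frame[of "n+1" P, rotated]) (auto simp: P_def)
  have "real m = (\<Sum>i<n+1. P i i)" using tight_trace[OF u(1)] u(2) by simp
  also have "\<dots> = real n" by (simp add: P_def field_simps del: sum.lessThan_Suc)
  finally have m: "m = n" by simp
  define t where "t i = 1 / sqrt (real (n + 1))" for i :: nat
  have w: "weighted_frame n {..<n+1} t u"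
    using u(1) m by (simp add: weighted_frame_def t_def power_divide del: sum.lessThan_Suc)
  have "frame_value n {..<n+1} t u = (\<Sum>i<n+1. \<Sum>j<n+1. 1 / real (n+1) * \<bar>P i j\<bar>)"
    unfolding frame_value_def using u(2) m by (intro sum.cong refl) (simp add: t_def)
  also have "\<dots> = (\<Sum>i<n+1. 1 / real (n+1) * (2 * real n / real (n+1)))"
  proof (intro sum.cong refl)
    fix i assume i: "i \<in> {..<n+1}"
    have "(\<Sum>j<n+1. \<bar>P i j\<bar>) = (\<Sum>j<n+1. (if j = i then 1 - 2 / real (n+1) else 0) + 1 / real (n+1))"
    proof (intro sum.cong refl)
      fix j
      have "1 / real (n+1) \<le> 1" by simp
      then show "\<bar>P i j\<bar> = (if j = i then 1 - 2 / real (n+1) else 0) + 1 / real (n+1)" by (auto simp: P_def)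
    qed
    also have "\<dots> = 1 - 2 / real (n+1) + 1" using i by (simp add: sum.distrib del: sum.lessThan_Suc)
    also have "\<dots> = 2 * real n / real (n+1)" by (simp add: field_simps)
    finally show "(\<Sum>j<n+1. 1 / real (n+1) * \<bar>P i j\<bar>) = 1 / real (n+1) * (2 * real n / real (n+1))"
      unfolding sum_distrib_left[symmetric] by simp
  qed
  also have "\<dots> = 2 * real n / real (n+1)" by (simp del: sum.lessThan_Suc)
  finally have "2 * real n / real (n+1) \<le> B" using frame_boundD[OF B w] by simp
  moreover have "1 < 2 * real n / real (n+1)" using n by (simp add: field_simps)
  ultimately show ?thesis by linarith
qed

context optimal_frame
begin

text \<open>
  A vanishing vector contradicts the Perron equation, and two nonzero orthogonal vectors force \<open>n \<ge> 2\<close> and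
  \<open>B = 1\<close>.
\<close>

lemma gram_nonzero:
  assumes n: "0 < n" and ij: "i < d" "j < d"
  shows "ip n (u i) (u j) \<noteq> 0"
proof
  assume z: "ip n (u i) (u j) = 0"
  have "0 < B"
  proof -
    have "0 < (\<Sum>i<d. ip n (u i) (u i))" using tight_trace[OF tight_u] n by simp
    then have "\<exists>a<d. 0 < ip n (u a) (u a)" 
      using sum_nonpos[of "{..<d}" "\<lambda>i. ip n (u i) (u i)"] by (force simp: not_less)
    then obtain a where a: "a < d" "0 < ip n (u a) (u a)" by blast
    have "0 < \<bar>ip n (u a) (u a)\<bar> * t a" using a pos by simp
    also have "\<dots> \<le> (\<Sum>b<d. \<bar>ip n (u a) (u b)\<bar> * t b)"
      by (rule member_le_sum) (auto simp: a intro!: mult_nonneg_nonneg less_imp_le[OF pos])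
    also have "\<dots> = B * t a" using perron a by simp
    finally show ?thesis using pos[OF a(1)] by (simp add: zero_less_mult_iff)
  qed
  have self: "ip n (u a) (u a) \<noteq> 0" if a: "a < d" for a
  proof
    assume "ip n (u a) (u a) = 0"
    then have "\<forall>k<n. u a k = 0" by (simp add: ip_zero_iff)
    then have "(\<Sum>b<d. \<bar>ip n (u a) (u b)\<bar> * t b) = 0" by (simp add: ip_def)
    with perron[OF a] \<open>0 < B\<close> pos[OF a] show False by simp
  qed
  show False
  proof (cases "i = j")
    case True with z self ij show False by simp
  next
    case False
    from orthogonal_pair_imp_bound_1[OF ij False z self[OF ij(2)]] have "B = 1" .
    moreover have "n \<noteq> 1" using z self ij by (auto simp: ip_def)
    then have "2 \<le> n" using n by simp
    ultimately show False using frame_bound_gt_1[OF bound] by simp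
  qed
qed

end

section \<open>Sign matrices\<close>

lemma mat_mult_entry:
  assumes "A \<in> carrier_mat a b" "B \<in> carrier_mat b c" "i < a" "j < c"
  shows "(A * B) $$ (i,j) = (\<Sum>m<b. A $$ (i,m) * B $$ (m,j))"
  using assms by (simp add: scalar_prod_def atLeast0LessThan)

text \<open>
  The eigenframe diagonalises \<open>S\<close>, so the characteristic polynomial is the product of the linear factors
  of the \<open>l m\<close>, which are already in decreasing order.
\<close>

lemma eigenvalues_desc_eigenframe:
  assumes S: "S \<in> carrier_mat d d" and X: "eigenframe d (\<lambda>i j. S $$ (i,j)) q l"
  shows "eigenvalues_desc S = map l [0..<d]"
proof -
  define Q where "Q = mat d d (\<lambda>(i,m). q i m)"
  define L where "L = mat d d (\<lambda>(i,j). if i = j then l i else 0)"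
  have car: "Q \<in> carrier_mat d d" "L \<in> carrier_mat d d" "Q\<^sup>T \<in> carrier_mat d d" by (simp_all add: Q_def L_def)
  have 1: "Q\<^sup>T * Q = 1\<^sub>m d"
    by (rule eq_matI) (use tightD[OF eigenframeD(1)[OF X]] in
        \<open>auto simp: Q_def times_mat_def scalar_prod_def atLeast0LessThan\<close>)
  have 2: "Q * Q\<^sup>T = 1\<^sub>m d" by (rule mat_mult_left_right_inverse[OF car(3,1) 1])
  have 3: "S = Q * L * Q\<^sup>T"
  proof (rule eq_matI)
    fix i j assume "i < dim_row (Q * L * Q\<^sup>T)" "j < dim_col (Q * L * Q\<^sup>T)"
    then have ij: "i < d" "j < d" by (simp_all add: Q_def L_def)
    have QL: "(Q * L) $$ (i, m) = q i m * l m" if "m < d" for m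
    proof -
      have "(Q * L) $$ (i, m) = (\<Sum>b<d. q i b * (if b = m then l b else 0))"
        using ij that by (simp add: Q_def L_def times_mat_def scalar_prod_def atLeast0LessThan)
      also have "\<dots> = (\<Sum>b<d. if b = m then q i b * l b else 0)" by (intro sum.cong) auto
      finally show ?thesis using that by simp
    qed
    have dims: "Q * L \<in> carrier_mat d d" using car by simp
    have "(Q * L * Q\<^sup>T) $$ (i, j) = (\<Sum>m<d. (Q * L) $$ (i, m) * Q\<^sup>T $$ (m, j))"
      using mat_mult_entry[OF dims car(3) ij] .
    also have "\<dots> = (\<Sum>m<d. l m * q i m * q j m)"
      by (intro sum.cong refl) (use ij in \<open>simp add: QL\<close>, simp add: Q_def)
    also have "\<dots> = S $$ (i,j)" using spectral_decomposition[OF X ij] by simp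
    finally show "S $$ (i,j) = (Q * L * Q\<^sup>T) $$ (i, j)" by simp
  qed (use S car in auto)
  have "similar_mat_wit S L Q Q\<^sup>T"
    unfolding similar_mat_wit_def Let_def using S car 1 2 3 by auto
  then have "char_poly S = char_poly L" by (intro char_poly_similar) (auto simp: similar_mat_def)
  also have "\<dots> = (\<Prod>a\<leftarrow>diag_mat L. [:- a, 1:])"
    by (rule char_poly_upper_triangular[OF car(2)]) (auto simp: L_def upper_triangular_def)
  also have "diag_mat L = map l [0..<d]" by (simp add: diag_mat_def L_def)
  finally have cp: "char_poly S = (\<Prod>a\<leftarrow>map l [0..<d]. [:- a, 1:])" .
  have pr: "proots (\<Prod>a\<leftarrow>xs. [:- a, 1:]) = mset xs" for xs :: "real list"
  proof (induction xs)
    case (Cons x xs)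
    have "(\<Prod>a\<leftarrow>xs. [:- a, 1:]) \<noteq> 0" by (auto simp: prod_list_zero_iff)
    with Cons show ?case by (simp add: proots_mult del: mult_pCons_left)
  qed simp
  have "sorted (rev (map l [0..<d]))"
    unfolding sorted_iff_nth_mono using eigenframeD(3)[OF X] by (auto simp: rev_nth)
  then have "sorted_list_of_multiset (mset (map l [0..<d])) = rev (map l [0..<d])"
    unfolding sorted_list_of_multiset_mset by (intro properties_for_sort) (simp_all only: mset_rev)
  then show ?thesis unfolding eigenvalues_desc_def cp pr by simp
qed

lemma tight_mono: "tight d I q \<Longrightarrow> n \<le> d \<Longrightarrow> tight n I q"
  by (auto simp: tight_def)

lemma eigenframe_trace:
  assumes X: "eigenframe d X q l" and n: "n \<le> d"
  shows "(\<Sum>i<d. \<Sum>j<d. X i j * ip n (q i) (q j)) = (\<Sum>m<n. l m)"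
  unfolding frame_trace[symmetric]
proof (intro sum.cong refl)
  fix m assume "m \<in> {..<n}"
  then have m: "m < d" using n by simp
  have "bform {..<d} X (\<lambda>i. q i m) (\<lambda>i. q i m) = (\<Sum>i<d. l m * (q i m * q i m))"
    unfolding bform_eq by (intro sum.cong refl) (use eigenframeD(2)[OF X _ m] in simp)
  also have "\<dots> = l m" using tightD[OF eigenframeD(1)[OF X] m m] by (simp add: sum_distrib_left[symmetric])
  finally show "bform {..<d} X (\<lambda>i. q i m) (\<lambda>i. q i m) = l m" .
qed

text \<open>
  The sum of the eigenvalues is the trace of \<open>S\<close> on the first \<open>n\<close> eigenvectors; these form a tight frame,
  which is given constant weights.
\<close>

lemma sign_matrix_value_le:
  assumes B: "frame_bound n B" and n: "0 < n" "n \<le> d" and S: "S \<in> sign_matrices d"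
  shows "(\<Sum>i<n. eigenvalues_desc S ! i) / real d \<le> B"
proof -
  have car: "S \<in> carrier_mat d d" and tr: "S\<^sup>T = S" using S by (auto simp: sign_matrices_def)
  have sym: "S $$ (i,j) = S $$ (j,i)" if "i < d" "j < d" for i j
  proof -
    have "S\<^sup>T $$ (i,j) = S $$ (j,i)" using car that by simp
    then show ?thesis by (simp add: tr)
  qed
  obtain q l where X: "eigenframe d (\<lambda>i j. S $$ (i,j)) q l"
    using symmetric_spectral[where X="\<lambda>i j. S $$ (i,j)" and d=d, OF sym] by blast
  have d: "0 < d" using n by simp
  define t where "t i = 1 / sqrt (real d)" for i :: nat
  have w: "weighted_frame n {..<d} t q"
    using tight_mono[OF eigenframeD(1)[OF X] n(2)] d by (simp add: weighted_frame_def t_def power_divide)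
  have "(\<Sum>i<n. eigenvalues_desc S ! i) = (\<Sum>m<n. l m)"
    unfolding eigenvalues_desc_eigenframe[OF car X] by (intro sum.cong refl) (use n in auto)
  also have "\<dots> = (\<Sum>i<d. \<Sum>j<d. S $$ (i,j) * ip n (q i) (q j))"
    using eigenframe_trace[OF X n(2)] by simp
  also have "\<dots> \<le> (\<Sum>i<d. \<Sum>j<d. real d * (t i * t j * \<bar>ip n (q i) (q j)\<bar>))"
  proof (intro sum_mono)
    fix i j assume "i \<in> {..<d}" "j \<in> {..<d}"
    then have "S $$ (i,j) \<in> {-1,1}" using S by (auto simp: sign_matrices_def)
    then have "S $$ (i,j) * ip n (q i) (q j) \<le> \<bar>ip n (q i) (q j)\<bar>" by auto
    also have "\<dots> = real d * (t i * t j * \<bar>ip n (q i) (q j)\<bar>)" using d by (simp add: t_def)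
    finally show "S $$ (i,j) * ip n (q i) (q j) \<le> real d * (t i * t j * \<bar>ip n (q i) (q j)\<bar>)" .
  qed
  also have "\<dots> = real d * frame_value n {..<d} t q" by (simp add: frame_value_def sum_distrib_left)
  also have "\<dots> \<le> real d * B" using frame_boundD[OF B w] by (intro mult_left_mono) auto
  finally show ?thesis using d by (simp add: divide_le_eq mult.commute)
qed

text \<open>
  Vector \<open>i\<close> is replaced by \<open>k i\<close> copies of itself, scaled to keep the frame tight, and the signs of the
  inner products form the sign matrix. The left side is the trace of this matrix on the enlarged
  frame, divided by its size.
\<close>

lemma sign_matrix_blow_up:
  fixes u :: "nat \<Rightarrow> nat \<Rightarrow> real"
  assumes u: "tight n {..<d} u" and n: "0 < n" and k: "\<And>i. i < d \<Longrightarrow> 0 < (k i :: nat)"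
    and m: "(m::nat) = (\<Sum>i<d. k i)" and nz: "\<And>i j. i < d \<Longrightarrow> j < d \<Longrightarrow> ip n (u i) (u j) \<noteq> 0"
  shows "\<exists>D S. n \<le> D \<and> S \<in> sign_matrices D \<and>
    (\<Sum>i<d. \<Sum>j<d. sqrt (k i / m) * sqrt (k j / m) * \<bar>ip n (u i) (u j)\<bar>)
      \<le> (\<Sum>i<n. eigenvalues_desc S ! i) / real D"
proof -
  define J where "J = Sigma {..<d} (\<lambda>i. {..<k i})"
  define U where "U = (\<lambda>(i,a::nat) l. (1 / sqrt (k i)) * u i l)"
  have sumJ: "(\<Sum>x\<in>J. f x) = (\<Sum>i<d. \<Sum>a<k i. f (i,a))" for f :: "_ \<Rightarrow> real"
    unfolding J_def by (subst sum.Sigma) auto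
  have cardJ: "card J = m" by (simp add: J_def m)
  have fin: "finite J" by (simp add: J_def)
  have tightJ: "tight n J U"
    unfolding tight_def
  proof (intro allI impI)
    fix l l' assume ll: "l < n" "l' < n"
    have "(\<Sum>x\<in>J. U x l * U x l') = (\<Sum>i<d. u i l * u i l')"
      unfolding sumJ
    proof (intro sum.cong refl)
      fix i assume i: "i \<in> {..<d}"
      have "(\<Sum>a<k i. U (i,a) l * U (i,a) l') = real (k i) * ((1 / sqrt (k i)) * u i l * ((1 / sqrt (k i)) * u i l'))"
        by (simp add: U_def)
      also have "\<dots> = (real (k i) / (sqrt (k i) * sqrt (k i))) * (u i l * u i l')" by simp
      also have "\<dots> = u i l * u i l'" using k[of i] i by simp
      finally show "(\<Sum>a<k i. U (i,a) l * U (i,a) l') = u i l * u i l'" .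
    qed
    then show "(\<Sum>x\<in>J. U x l * U x l') = (if l = l' then 1 else 0)" using tightD[OF u ll] by simp
  qed
  then have nm: "n \<le> m" using tight_card[OF _ fin] cardJ by blast
  then have m0: "0 < m" using n by simp
  obtain h where h: "bij_betw h {..<m} J"
    using ex_bij_betw_nat_finite[OF fin] cardJ by (auto simp: atLeast0LessThan)
  have hJ: "h a \<in> J" if "a < m" for a using bij_betw_apply[OF h] that by simp
  have reind: "(\<Sum>a<m. f (h a)) = (\<Sum>x\<in>J. f x)" for f :: "_ \<Rightarrow> real"
    by (rule sum.reindex_bij_betw[OF h])
  define \<sigma> where "\<sigma> x y = sgn (ip n (u (fst x)) (u (fst y)))" for x y :: "nat \<times> nat"
  define S where "S = mat m m (\<lambda>(a,b). \<sigma> (h a) (h b))"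
  have fstJ: "fst x < d" if "x \<in> J" for x using that by (auto simp: J_def)
  have S: "S \<in> sign_matrices m"
    unfolding sign_matrices_def
  proof (intro CollectI conjI allI impI)
    show "S \<in> carrier_mat m m" by (simp add: S_def)
    show "S\<^sup>T = S" by (rule eq_matI) (auto simp: S_def \<sigma>_def ip_commute)
    fix a assume a: "a < m"
    have "0 < ip n (u (fst (h a))) (u (fst (h a)))"
      using nz[OF fstJ[OF hJ[OF a]] fstJ[OF hJ[OF a]]] ip_self_nonneg by (metis order.not_eq_order_implies_strict)
    then show "S $$ (a,a) = 1" using a by (simp add: S_def \<sigma>_def)
    fix b assume b: "b < m"
    show "S $$ (a,b) \<in> {-1, 1}"
      using nz[OF fstJ[OF hJ[OF a]] fstJ[OF hJ[OF b]]] a b by (auto simp: S_def \<sigma>_def sgn_if split: if_splits)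
  qed
  have car: "S \<in> carrier_mat m m" by (simp add: S_def)
  have sym: "S $$ (a,b) = S $$ (b,a)" if "a < m" "b < m" for a b
    using that by (simp add: S_def \<sigma>_def ip_commute)
  obtain q l where X: "eigenframe m (\<lambda>i j. S $$ (i,j)) q l"
    using symmetric_spectral[where X="\<lambda>i j. S $$ (i,j)" and d=m, OF sym] by blast
  have tU: "tight n {..<m} (U \<circ> h)"
    using tightJ reind[of "\<lambda>x. U x _ * U x _"] by (simp add: tight_def)
  have "(\<Sum>i<n. eigenvalues_desc S ! i) = (\<Sum>i<n. l i)"
    unfolding eigenvalues_desc_eigenframe[OF car X] by (intro sum.cong refl) (use nm in auto)
  moreover have "(\<Sum>a<m. \<Sum>b<m. S $$ (a,b) * ip n ((U \<circ> h) a) ((U \<circ> h) b)) \<le> (\<Sum>i<n. l i)"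
    by (rule ky_fan[OF X tU])
  moreover have "(\<Sum>a<m. \<Sum>b<m. S $$ (a,b) * ip n ((U \<circ> h) a) ((U \<circ> h) b))
     = real m * (\<Sum>i<d. \<Sum>j<d. sqrt (k i / m) * sqrt (k j / m) * \<bar>ip n (u i) (u j)\<bar>)"
  proof -
    have "(\<Sum>a<m. \<Sum>b<m. S $$ (a,b) * ip n ((U \<circ> h) a) ((U \<circ> h) b))
      = (\<Sum>a<m. \<Sum>b<m. \<sigma> (h a) (h b) * ip n (U (h a)) (U (h b)))"
      by (intro sum.cong refl) (simp add: S_def)
    also have "\<dots> = (\<Sum>a<m. \<Sum>y\<in>J. \<sigma> (h a) y * ip n (U (h a)) (U y))"
      by (rule sum.cong[OF refl reind])
    also have "\<dots> = (\<Sum>x\<in>J. \<Sum>y\<in>J. \<sigma> x y * ip n (U x) (U y))"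
      by (rule reind)
    also have "\<dots> = (\<Sum>i<d. \<Sum>j<d. real (k i) * real (k j) * (sgn (ip n (u i) (u j)) * ((1 / sqrt (k i)) * ((1 / sqrt (k j)) * ip n (u i) (u j)))))"
    proof -
      have ipU: "ip n (U x) (U y) = (1 / sqrt (k (fst x))) * ((1 / sqrt (k (fst y))) * ip n (u (fst x)) (u (fst y)))" for x y
        by (cases x, cases y) (simp only: U_def prod.case ip_scale_left ip_scale_right fst_conv)
      show ?thesis
        unfolding sumJ ipU \<sigma>_def fst_conv sum_constant card_lessThan
        by (simp only: sum_distrib_left mult_ac)
    qed
    also have "\<dots> = real m * (\<Sum>i<d. \<Sum>j<d. sqrt (k i / m) * sqrt (k j / m) * \<bar>ip n (u i) (u j)\<bar>)"
      unfolding sum_distrib_left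
    proof (intro sum.cong refl)
      fix i j assume ij: "i \<in> {..<d}" "j \<in> {..<d}"
      have kk: "real (k i) = sqrt (k i) * sqrt (k i)" "real (k j) = sqrt (k j) * sqrt (k j)" "real m = sqrt m * sqrt m" by simp_all
      have pos: "sqrt (k i) > 0" "sqrt (k j) > 0" "sqrt m > 0" using k[of i] k[of j] ij m0 by auto
      have "real (k i) * real (k j) * (sgn (ip n (u i) (u j)) * ((1 / sqrt (k i)) * ((1 / sqrt (k j)) * ip n (u i) (u j))))
        = sqrt (k i) * sqrt (k j) * (sgn (ip n (u i) (u j)) * ip n (u i) (u j))"
        using pos by (subst (1 2) kk) (simp add: field_simps)
      also have "\<dots> = sqrt (k i) * sqrt (k j) * \<bar>ip n (u i) (u j)\<bar>" by (simp add: abs_sgn mult.commute)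
      also have "\<dots> = real m * (sqrt (k i / m) * sqrt (k j / m) * \<bar>ip n (u i) (u j)\<bar>)"
        unfolding real_sqrt_divide using pos by (subst kk(3)) (simp add: field_simps)
      finally show "real (k i) * real (k j) * (sgn (ip n (u i) (u j)) * ((1 / sqrt (k i)) * ((1 / sqrt (k j)) * ip n (u i) (u j))))
        = real m * (sqrt (k i / m) * sqrt (k j / m) * \<bar>ip n (u i) (u j)\<bar>)" .
    qed
    finally show ?thesis .
  qed
  ultimately have "(\<Sum>i<d. \<Sum>j<d. sqrt (k i / m) * sqrt (k j / m) * \<bar>ip n (u i) (u j)\<bar>) \<le> (\<Sum>i<n. eigenvalues_desc S ! i) / real m"
    using m0 by (simp add: pos_le_divide_eq mult.commute)
  then show ?thesis using S nm by blast
qed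

context optimal_frame
begin

text \<open>
  The squared weights \<open>(t i)\<^sup>2\<close> are approximated by the fractions \<open>k N i / m N\<close>.
\<close>

lemma sign_matrix_sup_eq:
  assumes n: "0 < n"
  shows "sign_matrix_sup n = B"
proof -
  define V where "V = {(\<Sum>i<n. eigenvalues_desc S ! i) / real d | d S. n \<le> d \<and> S \<in> sign_matrices d}"
  have le: "x \<le> B" if "x \<in> V" for x
    using that sign_matrix_value_le[OF bound n] by (auto simp: V_def)
  then have bdd: "bdd_above V" by (auto simp: bdd_above_def)
  define k where "k N i = nat \<lceil>real (Suc N) * (t i)\<^sup>2\<rceil>" for N i
  define m where "m N = (\<Sum>i<d. k N i)" for N
  define f where "f N = (\<Sum>i<d. \<Sum>j<d. sqrt (k N i / m N) * sqrt (k N j / m N) * \<bar>ip n (u i) (u j)\<bar>)" for N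
  have kpos: "0 < k N i" if "i < d" for N i
    using pos[OF that] by (simp add: k_def)
  have fV: "\<exists>x\<in>V. f N \<le> x" for N
    using sign_matrix_blow_up[OF tight_u n kpos m_def gram_nonzero[OF n]]
    unfolding f_def V_def by fast
  have fS: "f N \<le> Sup V" for N
    using fV[of N] cSup_upper[OF _ bdd] by (meson order_trans)
  have kl: "(\<lambda>N. real (k N i) / real (Suc N)) \<longlonglongrightarrow> (t i)\<^sup>2" for i
  proof (rule tendsto_sandwich)
    have kN: "real (Suc N) * (t i)\<^sup>2 \<le> real (k N i)" "real (k N i) \<le> real (Suc N) * (t i)\<^sup>2 + 1" for N
    proof -
      have "0 \<le> \<lceil>real (Suc N) * (t i)\<^sup>2\<rceil>" by (simp add: order.strict_trans2[of "-1" 0])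
      then have "real (k N i) = of_int \<lceil>real (Suc N) * (t i)\<^sup>2\<rceil>" unfolding k_def by simp
      then show "real (Suc N) * (t i)\<^sup>2 \<le> real (k N i)" "real (k N i) \<le> real (Suc N) * (t i)\<^sup>2 + 1" by linarith+
    qed
    show "\<forall>\<^sub>F N in sequentially. (t i)\<^sup>2 \<le> real (k N i) / real (Suc N)"
      using kN(1) by (intro always_eventually allI) (simp add: pos_le_divide_eq mult.commute del: of_nat_Suc)
    show "\<forall>\<^sub>F N in sequentially. real (k N i) / real (Suc N) \<le> (t i)\<^sup>2 + inverse (real (Suc N))"
      using kN(2) by (intro always_eventually allI) (simp add: pos_divide_le_eq distrib_left mult.commute del: of_nat_Suc)
    show "(\<lambda>N. (t i)\<^sup>2) \<longlonglongrightarrow> (t i)\<^sup>2" by simp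
    show "(\<lambda>N. (t i)\<^sup>2 + inverse (real (Suc N))) \<longlonglongrightarrow> (t i)\<^sup>2"
      using tendsto_add[OF tendsto_const LIMSEQ_inverse_real_of_nat] by simp
  qed
  have ml: "(\<lambda>N. real (m N) / real (Suc N)) \<longlonglongrightarrow> 1"
  proof -
    have "(\<lambda>N. \<Sum>i<d. real (k N i) / real (Suc N)) \<longlonglongrightarrow> (\<Sum>i<d. (t i)\<^sup>2)" by (intro tendsto_sum kl)
    then show ?thesis using sum_t by (simp add: m_def sum_divide_distrib[symmetric])
  qed
  have km: "(\<lambda>N. real (k N i) / real (m N)) \<longlonglongrightarrow> (t i)\<^sup>2" for i
  proof -
    have "(\<lambda>N. (real (k N i) / real (Suc N)) / (real (m N) / real (Suc N))) \<longlonglongrightarrow> (t i)\<^sup>2 / 1"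
      by (intro tendsto_divide kl ml) simp
    then show ?thesis by (simp del: of_nat_Suc)
  qed
  have sq: "(\<lambda>N. sqrt (real (k N i) / real (m N))) \<longlonglongrightarrow> t i" if "i < d" for i
    using tendsto_real_sqrt[OF km[of i]] pos[OF that] by simp
  have "f \<longlonglongrightarrow> (\<Sum>i<d. \<Sum>j<d. t i * t j * \<bar>ip n (u i) (u j)\<bar>)"
    unfolding f_def by (intro tendsto_sum tendsto_mult sq tendsto_const) auto
  then have "f \<longlonglongrightarrow> B" using val by (simp add: frame_value_def)
  then have "B \<le> Sup V" using fS by (intro LIMSEQ_le_const2[of f]) auto
  moreover have "V \<noteq> {}" using fV by blast
  then have "Sup V \<le> B" using le by (rule cSup_least)
  ultimately show ?thesis by (simp add: sign_matrix_sup_def V_def)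
qed

end

section \<open>Orthogonal projections\<close>

text \<open>
  \<open>U U\<^sup>T\<close> has the same column space as \<open>U\<close>, because \<open>U\<^sup>T U\<close> is the identity.
\<close>

lemma rank_gram:
  assumes u: "tight n {..<d} u"
  shows "vec_space.rank d (mat d d (\<lambda>(i,j). ip n (u i) (u j)) :: real mat) = n"
proof -
  interpret vec_space "TYPE(real)" d .
  define U where "U = mat d n (\<lambda>(i,k). u i k)"
  define P where "P = (mat d d (\<lambda>(i,j). ip n (u i) (u j)) :: real mat)"
  have car: "U \<in> carrier_mat d n" "P \<in> carrier_mat d d" by (simp_all add: U_def P_def)
  have UU: "U\<^sup>T * U = 1\<^sub>m n"
    by (rule eq_matI) (use tightD[OF u] in \<open>auto simp: U_def times_mat_def scalar_prod_def atLeast0LessThan\<close>)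
  have PU: "P = U * U\<^sup>T"
    by (rule eq_matI) (auto simp: U_def P_def ip_def times_mat_def scalar_prod_def atLeast0LessThan)
  have inj: "v = 0\<^sub>v n" if v: "v \<in> carrier_vec n" "U *\<^sub>v v = 0\<^sub>v d" for v
  proof -
    have "v = (U\<^sup>T * U) *\<^sub>v v" using v(1) UU by simp
    also have "\<dots> = U\<^sup>T *\<^sub>v (U *\<^sub>v v)" using car v by (intro assoc_mult_mat_vec) auto
    also have "\<dots> = 0\<^sub>v n" using v car by (auto intro!: eq_vecI)
    finally show ?thesis .
  qed
  have dist: "distinct (cols U)"
  proof (rule distinct_conv_nth[THEN iffD2], intro allI impI)
    fix k l assume kl: "k < length (cols U)" "l < length (cols U)" "k \<noteq> l"
    then have kl': "k < n" "l < n" using car by auto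
    show "cols U ! k \<noteq> cols U ! l"
    proof
      assume "cols U ! k = cols U ! l"
      then have "col U k = col U l" using kl by simp
      then have "u i k = u i l" if "i < d" for i
      proof -
        have "col U k $ i = col U l $ i" using \<open>col U k = col U l\<close> by simp
        then show ?thesis using that kl' by (simp add: U_def)
      qed
      then have "(\<Sum>i<d. u i k * u i l) = (\<Sum>i<d. u i l * u i l)" by (intro sum.cong) auto
      then show False using tightD[OF u kl'] tightD[OF u kl'(2,2)] kl(3) by simp
    qed
  qed
  have "rank U = n"
    by (rule lin_indpt_full_rank[OF car(1) dist]) (metis lin_depE[OF car(1) _ dist] inj)
  moreover have "col_space P = col_space U"
  proof -
    have "P *\<^sub>v x = U *\<^sub>v (U\<^sup>T *\<^sub>v x)" if "x \<in> carrier_vec d" for x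
      unfolding PU using car that by (intro assoc_mult_mat_vec) auto
    moreover have "U *\<^sub>v x = P *\<^sub>v (U *\<^sub>v x)" if x: "x \<in> carrier_vec n" for x
    proof -
      have "P *\<^sub>v (U *\<^sub>v x) = U *\<^sub>v (U\<^sup>T *\<^sub>v (U *\<^sub>v x))"
        unfolding PU using car x by (intro assoc_mult_mat_vec) auto
      also have "U\<^sup>T *\<^sub>v (U *\<^sub>v x) = (U\<^sup>T * U) *\<^sub>v x" using car x by (intro assoc_mult_mat_vec[symmetric]) auto
      finally show ?thesis using UU x by simp
    qed
    moreover have "U\<^sup>T *\<^sub>v x \<in> carrier_vec n" if "x \<in> carrier_vec d" for x using that car by simp
    moreover have "U *\<^sub>v x \<in> carrier_vec d" if "x \<in> carrier_vec n" for x using that car by simp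
    ultimately show ?thesis
      unfolding col_space_eq[OF car(1)] col_space_eq[OF car(2)] using car by (auto, metis+)
  qed
  ultimately show ?thesis unfolding P_def[symmetric] by (simp add: rank_def col_space_def)
qed

lemma orthogonal_projection_gram:
  assumes P: "P \<in> orthogonal_projections n d"
  obtains u where "tight n {..<d} u" "P = mat d d (\<lambda>(i,j). ip n (u i) (u j))"
proof -
  have car: "P \<in> carrier_mat d d" and tr: "P\<^sup>T = P" and idem: "P * P = P" and rk: "vec_space.rank d P = n"
    using P by (auto simp: orthogonal_projections_def)
  have sym: "P $$ (i,j) = P $$ (j,i)" if "i < d" "j < d" for i j
  proof -
    have "P\<^sup>T $$ (i,j) = P $$ (j,i)" using car that by simp
    then show ?thesis by (simp add: tr)
  qed
  have "(\<Sum>k<d. P $$ (i,k) * P $$ (k,j)) = P $$ (i,j)" if ij: "i < d" "j < d" for i j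
  proof -
    have "(P * P) $$ (i,j) = (\<Sum>k<d. P $$ (i,k) * P $$ (k,j))"
      using car ij by (simp add: scalar_prod_def atLeast0LessThan)
    then show ?thesis by (simp add: idem)
  qed
  with sym obtain m u where u: "tight m {..<d} u" "\<And>i j. i < d \<Longrightarrow> j < d \<Longrightarrow> P $$ (i,j) = ip m (u i) (u j)"
    using idempotent_frame[of d "\<lambda>i j. P $$ (i,j)"] by blast
  have Pm: "P = mat d d (\<lambda>(i,j). ip m (u i) (u j))"
    by (rule eq_matI) (use car u(2) in auto)
  then have "m = n" using rank_gram[OF u(1)] rk by simp
  then show thesis using that u(1) Pm by simp
qed

lemma gram_orthogonal_projection:
  assumes u: "tight n {..<d} u"
  shows "mat d d (\<lambda>(i,j). ip n (u i) (u j)) \<in> orthogonal_projections n d"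
  unfolding orthogonal_projections_def
proof (intro CollectI conjI)
  let ?P = "mat d d (\<lambda>(i,j). ip n (u i) (u j)) :: real mat"
  show "?P \<in> carrier_mat d d" by simp
  show "?P\<^sup>T = ?P" by (rule eq_matI) (auto simp: ip_commute)
  show "?P * ?P = ?P"
  proof (rule eq_matI)
    fix i j assume "i < dim_row ?P" "j < dim_col ?P"
    then have ij: "i < d" "j < d" by auto
    have "(?P * ?P) $$ (i,j) = (\<Sum>k<d. ip n (u i) (u k) * ip n (u k) (u j))"
      using ij by (simp add: scalar_prod_def atLeast0LessThan)
    then show "(?P * ?P) $$ (i,j) = ?P $$ (i,j)" using tight_parseval[OF u] ij by simp
  qed auto
  show "vec_space.rank d ?P = n" by (rule rank_gram[OF u])
qed

text \<open>
  Absolute values in an eigenvector equation give a nonnegative vector on which the quadratic form of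
  the matrix is at least the modulus of the eigenvalue.
\<close>

lemma spectral_radius_abs_gram_le:
  assumes B: "frame_bound n B" and u: "tight n {..<d} u" and d: "0 < d"
  shows "real_spectral_radius (abs_mat (mat d d (\<lambda>(i,j). ip n (u i) (u j)))) \<le> B"
proof -
  define M where "M = map_mat complex_of_real (abs_mat (mat d d (\<lambda>(i,j). ip n (u i) (u j))))"
  have car: "M \<in> carrier_mat d d" by (simp add: M_def abs_mat_def)
  have entry: "M $$ (i,j) = complex_of_real \<bar>ip n (u i) (u j)\<bar>" if "i < d" "j < d" for i j
    using that by (simp add: M_def abs_mat_def)
  obtain k where k: "k \<in> spectrum M" "spectral_radius M = norm k"
    using spectral_radius_mem_max(1)[OF car d] by auto
  then obtain z where z: "z \<in> carrier_vec d" "z \<noteq> 0\<^sub>v d" "M *\<^sub>v z = k \<cdot>\<^sub>v z"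
    using car by (auto simp: spectrum_def eigenvalue_def eigenvector_def)
  define x where "x i = norm (z $ i)" for i
  have row: "(\<Sum>j<d. complex_of_real \<bar>ip n (u i) (u j)\<bar> * z $ j) = k * z $ i" if i: "i < d" for i
  proof -
    have "(M *\<^sub>v z) $ i = (\<Sum>j<d. M $$ (i,j) * z $ j)"
      using i car z(1) by (simp add: scalar_prod_def atLeast0LessThan)
    also have "\<dots> = (\<Sum>j<d. complex_of_real \<bar>ip n (u i) (u j)\<bar> * z $ j)"
      by (intro sum.cong refl) (use i entry in auto)
    finally show ?thesis using z i by simp
  qed
  have "norm k * (\<Sum>i<d. (x i)\<^sup>2) = (\<Sum>i<d. norm (k * z $ i) * x i)"
    by (simp add: sum_distrib_left x_def norm_mult power2_eq_square mult.assoc)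
  also have "\<dots> \<le> (\<Sum>i<d. (\<Sum>j<d. \<bar>ip n (u i) (u j)\<bar> * x j) * x i)"
  proof (intro sum_mono mult_right_mono)
    fix i assume "i \<in> {..<d}"
    then have "k * z $ i = (\<Sum>j<d. complex_of_real \<bar>ip n (u i) (u j)\<bar> * z $ j)" using row by simp
    then have "norm (k * z $ i) \<le> (\<Sum>j<d. norm (complex_of_real \<bar>ip n (u i) (u j)\<bar> * z $ j))"
      using norm_sum by metis
    then show "norm (k * z $ i) \<le> (\<Sum>j<d. \<bar>ip n (u i) (u j)\<bar> * x j)" by (simp add: norm_mult x_def)
  qed (simp add: x_def)
  also have "\<dots> = bform {..<d} (\<lambda>i j. \<bar>ip n (u i) (u j)\<bar>) x x" by (simp add: bform_eq)
  also have "\<dots> \<le> B * (\<Sum>i<d. (x i)\<^sup>2)" by (rule abs_gram_form_le[OF B u]) simp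
  finally have le: "norm k * (\<Sum>i<d. (x i)\<^sup>2) \<le> B * (\<Sum>i<d. (x i)\<^sup>2)" .
  have "(\<Sum>i<d. (x i)\<^sup>2) \<noteq> 0"
  proof
    assume "(\<Sum>i<d. (x i)\<^sup>2) = 0"
    then have "\<forall>i<d. z $ i = 0" by (simp add: sum_nonneg_eq_0_iff x_def)
    then have "z = 0\<^sub>v d" using z(1) by (auto intro!: eq_vecI)
    with z show False by simp
  qed
  then have "0 < (\<Sum>i<d. (x i)\<^sup>2)" by (simp add: sum_nonneg order.not_eq_order_implies_strict)
  with le have "norm k \<le> B" by simp
  then show ?thesis using k by (simp add: real_spectral_radius_def M_def)
qed

context optimal_frame
begin

lemma optimal_gram:
  assumes n: "0 < n"
  defines "P \<equiv> mat d d (\<lambda>(i,j). ip n (u i) (u j))"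
  shows "P \<in> orthogonal_projections_of_rank n" "positive_mat (abs_mat P)" "real_spectral_radius (abs_mat P) = B"
proof -
  have nd: "n \<le> d" using tight_card[OF tight_u] by simp
  then show "P \<in> orthogonal_projections_of_rank n"
    using gram_orthogonal_projection[OF tight_u] by (auto simp: orthogonal_projections_of_rank_def P_def)
  show "positive_mat (abs_mat P)"
    using gram_nonzero[OF n] by (simp add: positive_mat_def abs_mat_def P_def)
  have d: "0 < d" using nd n by simp
  define M where "M = map_mat complex_of_real (abs_mat P)"
  have car: "M \<in> carrier_mat d d" by (simp add: M_def abs_mat_def P_def)
  define z where "z = vec d (\<lambda>i. complex_of_real (t i))"
  have "M *\<^sub>v z = complex_of_real B \<cdot>\<^sub>v z"
  proof (rule eq_vecI)
    fix i assume "i < dim_vec (complex_of_real B \<cdot>\<^sub>v z)"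
    then have i: "i < d" by (simp add: z_def)
    have "(M *\<^sub>v z) $ i = (\<Sum>j<d. complex_of_real (\<bar>ip n (u i) (u j)\<bar> * t j))"
      using i by (simp add: M_def abs_mat_def P_def z_def scalar_prod_def atLeast0LessThan)
    also have "\<dots> = complex_of_real (\<Sum>j<d. \<bar>ip n (u i) (u j)\<bar> * t j)" by simp
    also have "\<dots> = complex_of_real (B * t i)" using perron[OF i] by (simp only:)
    finally show "(M *\<^sub>v z) $ i = (complex_of_real B \<cdot>\<^sub>v z) $ i" using i by (simp add: z_def)
  qed (use car in \<open>simp add: z_def\<close>)
  moreover have "z \<noteq> 0\<^sub>v d"
  proof
    assume "z = 0\<^sub>v d"
    then have "z $ 0 = 0" using d by simp
    then show False using pos[OF d] d by (simp add: z_def)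
  qed
  ultimately have "complex_of_real B \<in> spectrum M"
    unfolding spectrum_def eigenvalue_def eigenvector_def using car by (auto intro!: exI[of _ z] simp: z_def)
  then have "norm (complex_of_real B) \<le> spectral_radius M"
    by (intro spectral_radius_mem_max(2)[OF car d] imageI)
  then have "B \<le> real_spectral_radius (abs_mat P)" by (simp add: real_spectral_radius_def M_def)
  then show "real_spectral_radius (abs_mat P) = B"
    using spectral_radius_abs_gram_le[OF bound tight_u d] by (simp add: P_def)
qed

lemma projection_sup_eq:
  assumes n: "0 < n"
  shows "projection_sup n = B"
  unfolding projection_sup_def
proof (rule cSup_eq_maximum)
  show "B \<in> {real_spectral_radius (abs_mat P) |P. P \<in> orthogonal_projections_of_rank n \<and> positive_mat (abs_mat P)}"
    using optimal_gram[OF n] by blast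
  fix x assume "x \<in> {real_spectral_radius (abs_mat P) |P. P \<in> orthogonal_projections_of_rank n \<and> positive_mat (abs_mat P)}"
  then obtain P e where P: "x = real_spectral_radius (abs_mat P)" "n \<le> e" "P \<in> orthogonal_projections n e"
    by (auto simp: orthogonal_projections_of_rank_def)
  obtain v where v: "tight n {..<e} v" "P = mat e e (\<lambda>(i,j). ip n (v i) (v j))"
    by (rule orthogonal_projection_gram[OF P(3)])
  show "x \<le> B" using spectral_radius_abs_gram_le[OF bound v(1)] P(1,2) v(2) n by simp
qed

end

section \<open>The Mazur-Orlicz theorem\<close>

definition sublinear :: "((nat \<Rightarrow> real) \<Rightarrow> real) \<Rightarrow> bool" where
  "sublinear p \<longleftrightarrow> (\<forall>x y. p (\<lambda>i. x i + y i) \<le> p x + p y) \<and> (\<forall>c x. 0 \<le> c \<longrightarrow> p (\<lambda>i. c * x i) = c * p x)"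

lemma sublinear_add: "sublinear p \<Longrightarrow> p (\<lambda>i. x i + y i) \<le> p x + p y"
  by (simp add: sublinear_def)

lemma sublinear_scale: "sublinear p \<Longrightarrow> 0 \<le> c \<Longrightarrow> p (\<lambda>i. c * x i) = c * p x"
  by (simp add: sublinear_def)

lemma sublinear_zero: "sublinear p \<Longrightarrow> p (\<lambda>i. 0) = 0"
  using sublinear_scale[of p 0 "\<lambda>_. 0"] by simp

lemma sublinear_neg: "sublinear p \<Longrightarrow> - p (\<lambda>i. - x i) \<le> p x"
  using sublinear_add[of p x "\<lambda>i. - x i"] sublinear_zero[of p] by simp

text \<open>
  Convexity of a set of pairs \<open>(y, r)\<close>, each of which stands for the requirement that a functional be at
  least \<open>r\<close> at \<open>y\<close>.
\<close>

definition convex_data :: "((nat \<Rightarrow> real) \<times> real) set \<Rightarrow> bool" where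
  "convex_data K \<longleftrightarrow> (\<forall>y r z s a b. (y,r) \<in> K \<longrightarrow> (z,s) \<in> K \<longrightarrow> 0 \<le> a \<longrightarrow> 0 \<le> b \<longrightarrow> a + b = 1 \<longrightarrow>
     ((\<lambda>i. a * y i + b * z i), a * r + b * s) \<in> K)"

text \<open>
  The inequality \<open>q (- y) \<le> - r\<close> forces every linear functional below \<open>q\<close> to be at least \<open>r\<close> at \<open>y\<close>. The
  smaller functional \<open>q x\<close> is the infimum of \<open>p (x + c * y) - c * r\<close> over \<open>c \<ge> 0\<close> and \<open>(y, r)\<close> in \<open>K\<close>.
\<close>

lemma sublinear_shrink:
  assumes p: "sublinear p" and K: "convex_data K" "K \<noteq> {}" and le: "\<And>y r. (y,r) \<in> K \<Longrightarrow> r \<le> p y"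
  shows "\<exists>q. sublinear q \<and> (\<forall>x. q x \<le> p x) \<and> (\<forall>y r. (y,r) \<in> K \<longrightarrow> q (\<lambda>i. - y i) \<le> - r)"
proof -
  define A where "A x = {p (\<lambda>i. x i + c * y i) - c * r | c y r. 0 \<le> c \<and> (y,r) \<in> K}" for x
  define q where "q x = Inf (A x)" for x
  have AI: "p (\<lambda>i. x i + c * y i) - c * r \<in> A x" if "0 \<le> c" "(y,r) \<in> K" for x c y r
    using that by (auto simp: A_def)
  obtain y0 r0 where k0: "(y0, r0) \<in> K" using K(2) by auto
  have ne: "A x \<noteq> {}" for x using AI[OF _ k0, of 0] by auto
  have lb: "- p (\<lambda>i. - x i) \<le> a" if "a \<in> A x" for x a
  proof -
    obtain c y r where a: "a = p (\<lambda>i. x i + c * y i) - c * r" "0 \<le> c" "(y,r) \<in> K" using \<open>a \<in> A x\<close> by (auto simp: A_def)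
    have "c * r \<le> c * p y" using le[OF a(3)] a(2) by (rule mult_left_mono)
    also have "\<dots> = p (\<lambda>i. c * y i)" using sublinear_scale[OF p a(2)] by simp
    also have "\<dots> \<le> p (\<lambda>i. x i + c * y i) + p (\<lambda>i. - x i)"
      using sublinear_add[OF p, of "\<lambda>i. x i + c * y i" "\<lambda>i. - x i"] by simp
    finally show ?thesis using a(1) by simp
  qed
  have bdd: "bdd_below (A x)" for x using lb by (auto simp: bdd_below_def)
  have qle: "q x \<le> a" if "a \<in> A x" for x a unfolding q_def by (rule cInf_lower[OF that bdd])
  have qge: "b \<le> q x" if "\<And>a. a \<in> A x \<Longrightarrow> b \<le> a" for x b unfolding q_def by (rule cInf_greatest[OF ne that])
  have qp: "q x \<le> p x" for x using qle[OF AI[OF _ k0, of 0 x]] by simp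
  have add: "q (\<lambda>i. x i + x' i) \<le> a + a'" if aa: "a \<in> A x" "a' \<in> A x'" for x x' a a'
  proof -
    obtain c y r where a: "a = p (\<lambda>i. x i + c * y i) - c * r" "0 \<le> c" "(y,r) \<in> K" using aa(1) by (auto simp: A_def)
    obtain d z s where b: "a' = p (\<lambda>i. x' i + d * z i) - d * s" "0 \<le> d" "(z,s) \<in> K" using aa(2) by (auto simp: A_def)
    show ?thesis
    proof (cases "c + d = 0")
      case True
      then have "c = 0" "d = 0" using a b by auto
      then have "p (\<lambda>i. x i + x' i) \<le> a + a'" using a b sublinear_add[OF p, of x x'] by simp
      then show ?thesis using qp order_trans by blast
    next
      case False
      then have cd: "0 < c + d" using a b by simp
      define w where "w = (\<lambda>i. c / (c + d) * y i + d / (c + d) * z i)"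
      define v where "v = c / (c + d) * r + d / (c + d) * s"
      have "c / (c + d) + d / (c + d) = 1" using cd by (simp add: add_divide_distrib[symmetric])
      then have "(w, v) \<in> K"
        using K(1)[unfolded convex_data_def, rule_format, OF a(3) b(3), of "c / (c + d)" "d / (c + d)"] a b cd
        by (simp add: w_def v_def)
      then have "q (\<lambda>i. x i + x' i) \<le> p (\<lambda>i. (x i + x' i) + (c + d) * w i) - (c + d) * v"
        using cd by (intro qle AI) auto
      also have "(\<lambda>i. (x i + x' i) + (c + d) * w i) = (\<lambda>i. (x i + c * y i) + (x' i + d * z i))"
        using cd by (auto simp: w_def distrib_left)
      also have "(c + d) * v = c * r + d * s" using cd by (simp add: v_def distrib_left)
      finally show ?thesis using sublinear_add[OF p, of "\<lambda>i. x i + c * y i" "\<lambda>i. x' i + d * z i"] a b by simp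
    qed
  qed
  have sub: "q (\<lambda>i. x i + x' i) \<le> q x + q x'" for x x'
  proof -
    have "q (\<lambda>i. x i + x' i) - a' \<le> q x" if "a' \<in> A x'" for a'
      by (rule qge) (use add[OF _ that] in force)
    then have "q (\<lambda>i. x i + x' i) - q x \<le> q x'" by (intro qge) force
    then show ?thesis by simp
  qed
  have scale_le: "q (\<lambda>i. c * x i) \<le> c * q x" if c: "0 < c" for c x
  proof -
    have "q (\<lambda>i. c * x i) / c \<le> q x"
    proof (rule qge)
      fix a assume "a \<in> A x"
      then obtain d y r where a: "a = p (\<lambda>i. x i + d * y i) - d * r" "0 \<le> d" "(y,r) \<in> K" by (auto simp: A_def)
      have "q (\<lambda>i. c * x i) \<le> p (\<lambda>i. c * x i + (c * d) * y i) - (c * d) * r"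
        using a c by (intro qle AI) auto
      also have "(\<lambda>i. c * x i + (c * d) * y i) = (\<lambda>i. c * (x i + d * y i))" by (simp add: distrib_left mult.assoc)
      also have "p (\<lambda>i. c * (x i + d * y i)) = c * p (\<lambda>i. x i + d * y i)" using c by (intro sublinear_scale[OF p]) simp
      finally have "q (\<lambda>i. c * x i) \<le> c * a" by (simp add: a(1) right_diff_distrib mult.assoc)
      then show "q (\<lambda>i. c * x i) / c \<le> a" using c by (simp add: pos_divide_le_eq mult.commute)
    qed
    then show ?thesis using c by (simp add: pos_divide_le_eq mult.commute)
  qed
  have scale: "q (\<lambda>i. c * x i) = c * q x" if "0 \<le> c" for c x
  proof (cases "c = 0")
    case True
    have "q (\<lambda>i. 0) = 0"
      using qp[of "\<lambda>i. 0"] qge[of "\<lambda>i. 0" 0] lb[of _ "\<lambda>i. 0"] sublinear_zero[OF p] by force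
    with True show ?thesis by simp
  next
    case False
    with that have c: "0 < c" by simp
    have "q (\<lambda>i. (1 / c) * (c * x i)) \<le> (1 / c) * q (\<lambda>i. c * x i)" using c by (intro scale_le) simp
    then have "c * q x \<le> q (\<lambda>i. c * x i)" using c by (simp add: field_simps)
    with scale_le[OF c, of x] show ?thesis by simp
  qed
  have neg: "q (\<lambda>i. - y i) \<le> - r" if "(y,r) \<in> K" for y r
    using qle[OF AI[OF _ that, of 1 "\<lambda>i. - y i"]] sublinear_zero[OF p] by simp
  show ?thesis using sub scale qp neg by (intro exI[of _ q]) (simp add: sublinear_def)
qed

text \<open>
  Shrinking makes the functional linear on one coordinate axis after another; an axis that is already
  linear stays so, because a sublinear functional below a linear one on a line agrees with it there.
\<close>

lemma sublinear_coordinates: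
  assumes p: "sublinear p"
  shows "\<exists>a q. sublinear q \<and> (\<forall>x. q x \<le> p x) \<and> (\<forall>i<k. \<forall>s. q (\<lambda>j. if j = i then s else 0) = s * a i)"
proof (induction k)
  case 0 then show ?case using p by auto
next
  case (Suc k)
  then obtain a q where q: "sublinear q" "\<forall>x. q x \<le> p x" "\<forall>i<k. \<forall>s. q (\<lambda>j. if j = i then s else 0) = s * a i"
    by blast
  define e where "e i s = (\<lambda>j. if j = i then s else (0::real))" for i :: nat and s
  have esc: "(\<lambda>j. c * e i s j) = e i (c * s)" for c i s by (auto simp: e_def)
  define K where "K = {(e k s, s * q (e k 1)) | s. True}"
  have "convex_data K"
  proof -
    have "(\<lambda>i. a * e k s i + b * e k t i) = e k (a * s + b * t)" for a b s t by (auto simp: e_def)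
    then show ?thesis by (auto simp: convex_data_def K_def distrib_right mult.assoc)
  qed
  moreover have "K \<noteq> {}" by (auto simp: K_def)
  moreover have "r \<le> q y" if yr: "(y,r) \<in> K" for y r
  proof -
    obtain s where s: "y = e k s" "r = s * q (e k 1)" using yr by (auto simp: K_def)
    show ?thesis
    proof (cases "0 \<le> s")
      case True
      then have "q (\<lambda>j. s * e k 1 j) = s * q (e k 1)" by (rule sublinear_scale[OF q(1)])
      then show ?thesis using s by (simp add: esc)
    next
      case False
      then have "q (\<lambda>j. (- s) * e k 1 j) = (- s) * q (e k 1)" by (intro sublinear_scale[OF q(1)]) simp
      then have "q (e k (- s)) = (- s) * q (e k 1)" unfolding esc by simp
      moreover have "(\<lambda>j. - e k s j) = e k (- s)" by (auto simp: e_def)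
      ultimately show ?thesis using sublinear_neg[OF q(1), of "e k s"] s by simp
    qed
  qed
  ultimately obtain q' where q': "sublinear q'" "\<forall>x. q' x \<le> q x" "\<forall>y r. (y,r) \<in> K \<longrightarrow> q' (\<lambda>i. - y i) \<le> - r"
    using sublinear_shrink[OF q(1)] by blast
  define a' where "a' = a(k := q (e k 1))"
  have up: "q' (e i s) \<le> s * a' i" if "i < Suc k" for i s
  proof (cases "i = k")
    case True
    have "(e k (- s), (- s) * q (e k 1)) \<in> K" by (auto simp: K_def)
    with q'(3) have "q' (\<lambda>j. - e k (- s) j) \<le> - ((- s) * q (e k 1))" by blast
    moreover have "(\<lambda>j. - e k (- s) j) = e k s" by (auto simp: e_def)
    ultimately show ?thesis using True by (simp add: a'_def)
  next
    case False
    then have "q (e i s) = s * a i" using q(3) that by (simp add: e_def)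
    then show ?thesis using q'(2) False by (metis a'_def fun_upd_apply)
  qed
  have "q' (e i s) = s * a' i" if i: "i < Suc k" for i s
  proof -
    have "(\<lambda>j. - e i s j) = e i (- s)" by (auto simp: e_def)
    then have "- q' (e i (- s)) \<le> q' (e i s)" using sublinear_neg[OF q'(1), of "e i s"] by simp
    then show ?thesis using up[OF i, of s] up[OF i, of "- s"] by simp
  qed
  then show ?case using q'(1,2) q(2) unfolding e_def by (meson order_trans)
qed

text \<open>
  The finite-dimensional case of the Mazur-Orlicz theorem, a common form of the Hahn-Banach and minimax
  theorems: a sublinear functional that satisfies a convex family of lower bounds dominates a linear
  functional that satisfies them.
\<close>

theorem mazur_orlicz:
  assumes p: "sublinear p" and K: "convex_data K" "K \<noteq> {}" and le: "\<And>y r. (y,r) \<in> K \<Longrightarrow> r \<le> p y"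
  shows "\<exists>a. (\<forall>x. (\<forall>i\<ge>m. x i = 0) \<longrightarrow> (\<Sum>i<m. a i * x i) \<le> p x) \<and>
     (\<forall>y r. (y,r) \<in> K \<longrightarrow> (\<forall>i\<ge>m. y i = 0) \<longrightarrow> r \<le> (\<Sum>i<m. a i * y i))"
proof -
  obtain p0 where p0: "sublinear p0" "\<forall>x. p0 x \<le> p x" "\<forall>y r. (y,r) \<in> K \<longrightarrow> p0 (\<lambda>i. - y i) \<le> - r"
    using sublinear_shrink[OF p K le] by blast
  obtain a q where q: "sublinear q" "\<forall>x. q x \<le> p0 x" "\<forall>i<m. \<forall>s. q (\<lambda>j. if j = i then s else 0) = s * a i"
    using sublinear_coordinates[OF p0(1)] by blast
  have up: "q x \<le> (\<Sum>i<m. a i * x i)" if x: "\<forall>i\<ge>m. x i = 0" for x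
  proof -
    have "q (\<lambda>j. if j < k then x j else 0) \<le> (\<Sum>i<k. a i * x i)" if "k \<le> m" for k
      using that
    proof (induction k)
      case 0 then show ?case using sublinear_zero[OF q(1)] by simp
    next
      case (Suc k)
      have "(\<lambda>j. if j < Suc k then x j else 0) = (\<lambda>j. (if j < k then x j else 0) + (if j = k then x k else 0))"
        by (auto simp: less_Suc_eq)
      then have "q (\<lambda>j. if j < Suc k then x j else 0) \<le> q (\<lambda>j. if j < k then x j else 0) + q (\<lambda>j. if j = k then x k else 0)"
        using sublinear_add[OF q(1)] by metis
      then show ?case using Suc q(3) by (simp add: mult.commute)
    qed
    from this[OF order_refl] have "q (\<lambda>j. if j < m then x j else 0) \<le> (\<Sum>i<m. a i * x i)" .
    moreover have "(\<lambda>j. if j < m then x j else 0) = x" using x by auto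
    ultimately show ?thesis by simp
  qed
  have low: "(\<Sum>i<m. a i * x i) \<le> q x" if x: "\<forall>i\<ge>m. x i = 0" for x
    using up[of "\<lambda>i. - x i"] sublinear_neg[OF q(1), of x] x by (simp add: sum_negf)
  show ?thesis
  proof (intro exI[of _ a] conjI allI impI)
    fix x :: "nat \<Rightarrow> real" assume "\<forall>i\<ge>m. x i = 0"
    then show "(\<Sum>i<m. a i * x i) \<le> p x" using low q(2) p0(2) by (meson order_trans)
  next
    fix y r assume y: "(y,r) \<in> K" "\<forall>i\<ge>m. y i = (0::real)"
    have "(\<Sum>i<m. a i * (- y i)) \<le> q (\<lambda>i. - y i)" using low[of "\<lambda>i. - y i"] y by simp
    also have "\<dots> \<le> - r" using q(2) p0(3) y order_trans by blast
    finally show "r \<le> (\<Sum>i<m. a i * y i)" by (simp add: sum_negf)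
  qed
qed

definition coord_max :: "nat \<Rightarrow> (nat \<Rightarrow> real) \<Rightarrow> real" where
  "coord_max d y = Max (y ` {..<d})"

lemma coord_max_ge: "i < d \<Longrightarrow> y i \<le> coord_max d y"
  unfolding coord_max_def by (intro Max_ge) auto

lemma coord_max_le: "0 < d \<Longrightarrow> (\<And>i. i < d \<Longrightarrow> y i \<le> b) \<Longrightarrow> coord_max d y \<le> b"
  unfolding coord_max_def by (subst Max_le_iff) auto

lemma coord_max_attained:
  assumes "0 < d" shows "\<exists>i<d. coord_max d y = y i"
proof -
  have "Max (y ` {..<d}) \<in> y ` {..<d}" by (rule Max_in) (use assms in auto)
  then show ?thesis by (auto simp: coord_max_def)
qed

lemma coord_max_scale:
  assumes "0 < d" "0 \<le> c" shows "coord_max d (\<lambda>i. c * y i) = c * coord_max d y"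
proof (rule antisym)
  show "coord_max d (\<lambda>i. c * y i) \<le> c * coord_max d y"
    using assms by (intro coord_max_le mult_left_mono coord_max_ge) auto
  obtain i where "i < d" "coord_max d y = y i" using coord_max_attained[OF assms(1)] by blast
  then show "c * coord_max d y \<le> coord_max d (\<lambda>i. c * y i)" using coord_max_ge[of i d "\<lambda>i. c * y i"] by simp
qed

lemma sublinear_coord_max: "0 < d \<Longrightarrow> sublinear (coord_max d)"
  by (auto simp: sublinear_def coord_max_scale intro!: coord_max_le add_mono coord_max_ge)

lemma sublinear_coord_max_abs:
  assumes "0 < d" shows "sublinear (\<lambda>y. coord_max d (\<lambda>i. \<bar>y i\<bar>))"
  unfolding sublinear_def
proof (intro conjI allI impI)
  fix x y :: "nat \<Rightarrow> real"
  show "coord_max d (\<lambda>i. \<bar>x i + y i\<bar>) \<le> coord_max d (\<lambda>i. \<bar>x i\<bar>) + coord_max d (\<lambda>i. \<bar>y i\<bar>)"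
  proof (rule coord_max_le[OF assms])
    fix i assume "i < d"
    then show "\<bar>x i + y i\<bar> \<le> coord_max d (\<lambda>i. \<bar>x i\<bar>) + coord_max d (\<lambda>i. \<bar>y i\<bar>)"
      using coord_max_ge[of i d "\<lambda>i. \<bar>x i\<bar>"] coord_max_ge[of i d "\<lambda>i. \<bar>y i\<bar>"] abs_triangle_ineq[of "x i" "y i"] by linarith
  qed
next
  fix c :: real and x :: "nat \<Rightarrow> real" assume "0 \<le> c"
  then show "coord_max d (\<lambda>i. \<bar>c * x i\<bar>) = c * coord_max d (\<lambda>i. \<bar>x i\<bar>)"
    using coord_max_scale[OF assms, of c "\<lambda>i. \<bar>x i\<bar>"] by (simp add: abs_mult)
qed

section \<open>Projections onto spaces with finitely many coordinates\<close>

text \<open>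
  The coordinate functionals \<open>g j\<close> embed \<open>n\<close>-dimensional space into \<open>d\<close>-dimensional space, and \<open>y \<mapsto> \<Sum>\<^sub>j y j * c j\<close>
  maps back. The condition says that this is a left inverse, that is, that it gives a projection onto
  the embedded space.
\<close>

definition resolves_identity :: "nat \<Rightarrow> nat \<Rightarrow> (nat \<Rightarrow> nat \<Rightarrow> real) \<Rightarrow> (nat \<Rightarrow> nat \<Rightarrow> real) \<Rightarrow> bool" where
  "resolves_identity n d g c \<longleftrightarrow> (\<forall>k<n. \<forall>l<n. (\<Sum>j<d. c j k * g j l) = (if k = l then 1 else 0))"

text \<open>
  The orthogonal projection for the inner product weighted by \<open>w\<close>. In an orthonormal basis for this inner
  product, the functionals times the square roots of their weights form a tight frame, and the
  weighted sum is its frame value.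
\<close>

lemma weighted_projection:
  assumes B: "frame_bound n B" and w: "\<And>i. i < d \<Longrightarrow> 0 < w i" "(\<Sum>i<d. w i) = 1"
    and g: "\<And>x. (\<And>i. i < d \<Longrightarrow> ip n (g i) x = 0) \<Longrightarrow> (\<forall>k<n. x k = 0)"
  shows "\<exists>c. resolves_identity n d g c \<and> (\<Sum>i<d. w i * (\<Sum>j<d. \<bar>ip n (g i) (c j)\<bar>)) \<le> B"
proof -
  define G where "G k l = (\<Sum>i<d. w i * (g i k * g i l))" for k l
  obtain q \<gamma> where X: "eigenframe n G q \<gamma>"
    using symmetric_spectral[where X=G and d=n] by (auto simp: G_def mult_ac)
  note q = eigenframeD(1)[OF X]
  define h where "h i m = ip n (g i) (\<lambda>k. q k m)" for i m
  have Gq: "(\<Sum>i<d. w i * h i m * g i k) = \<gamma> m * q k m" if "m < n" "k < n" for m k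
  proof -
    have "(\<Sum>i<d. w i * h i m * g i k) = (\<Sum>l<n. (\<Sum>i<d. w i * (g i k * g i l)) * q l m)"
      unfolding h_def ip_def sum_distrib_left sum_distrib_right by (subst sum.swap) (simp add: mult_ac)
    also have "\<dots> = \<gamma> m * q k m" using eigenframeD(2)[OF X that(2,1)] by (simp add: G_def)
    finally show ?thesis .
  qed
  have hh: "(\<Sum>i<d. w i * h i m * h i m') = \<gamma> m * (if m = m' then 1 else 0)" if mm: "m < n" "m' < n" for m m'
  proof -
    have "(\<Sum>i<d. w i * h i m * h i m') = (\<Sum>k<n. (\<Sum>i<d. w i * h i m * g i k) * q k m')"
      unfolding h_def[of _ m'] ip_def[of n "g _"] sum_distrib_left sum_distrib_right by (subst sum.swap) (simp add: mult_ac)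
    also have "\<dots> = (\<Sum>k<n. \<gamma> m * (q k m * q k m'))" by (intro sum.cong refl) (use mm in \<open>simp add: Gq\<close>)
    also have "\<dots> = \<gamma> m * (if m = m' then 1 else 0)" using tightD[OF q mm] by (simp add: sum_distrib_left[symmetric])
    finally show ?thesis .
  qed
  have gpos: "0 < \<gamma> m" if m: "m < n" for m
  proof -
    have e: "\<gamma> m = (\<Sum>i<d. w i * (h i m)\<^sup>2)" using hh[OF m m] by (simp add: power2_eq_square mult.assoc)
    have nn: "0 \<le> w i * (h i m)\<^sup>2" if "i < d" for i using w(1)[OF that] by simp
    then have "0 \<le> \<gamma> m" unfolding e by (intro sum_nonneg) auto
    moreover have "\<gamma> m \<noteq> 0"
    proof
      assume "\<gamma> m = 0"
      then have "\<forall>i\<in>{..<d}. w i * (h i m)\<^sup>2 = 0" using nn unfolding e by (subst (asm) sum_nonneg_eq_0_iff) auto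
      then have "ip n (g i) (\<lambda>k. q k m) = 0" if "i < d" for i using w(1)[OF that] that by (force simp: h_def)
      from g[OF this] have "\<forall>k<n. q k m = 0" by simp
      then show False using tightD[OF q m m] by simp
    qed
    ultimately show ?thesis by simp
  qed
  define u where "u i m = sqrt (w i) * h i m / sqrt (\<gamma> m)" for i m
  define t where "t i = sqrt (w i)" for i
  have wsq: "sqrt (w i) * sqrt (w i) = w i" if "i < d" for i using w(1)[OF that] by simp
  have "(\<Sum>i<d. u i m * u i m') = (if m = m' then 1 else 0)" if mm: "m < n" "m' < n" for m m'
  proof -
    have "(\<Sum>i<d. u i m * u i m') = (\<Sum>i<d. w i * h i m * h i m') / (sqrt (\<gamma> m) * sqrt (\<gamma> m'))"
      unfolding sum_divide_distrib
    proof (intro sum.cong refl)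
      fix i assume "i \<in> {..<d}"
      have "u i m * u i m' = (sqrt (w i) * sqrt (w i)) * h i m * h i m' / (sqrt (\<gamma> m) * sqrt (\<gamma> m'))"
        by (simp add: u_def)
      then show "u i m * u i m' = w i * h i m * h i m' / (sqrt (\<gamma> m) * sqrt (\<gamma> m'))" using wsq \<open>i \<in> {..<d}\<close> by simp
    qed
    then show ?thesis using hh[OF mm] gpos[OF mm(1)] by auto
  qed
  then have wf: "weighted_frame n {..<d} t u" using w by (simp add: weighted_frame_def tight_def t_def less_imp_le)
  define c where "c j k = w j * (\<Sum>m<n. h j m / \<gamma> m * q k m)" for j k
  have gc: "ip n (g i) (c j) = w j * (\<Sum>m<n. h i m * h j m / \<gamma> m)" for i j
    unfolding c_def h_def[of i] ip_scale_right ip_sum_right by (simp add: mult.commute)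
  have "resolves_identity n d g c"
    unfolding resolves_identity_def
  proof (intro allI impI)
    fix k l assume kl: "k < n" "l < n"
    have "(\<Sum>j<d. c j k * g j l) = (\<Sum>j<d. \<Sum>m<n. q k m / \<gamma> m * (w j * h j m * g j l))"
      unfolding c_def by (intro sum.cong refl) (simp add: sum_distrib_left sum_distrib_right mult_ac)
    also have "\<dots> = (\<Sum>m<n. q k m / \<gamma> m * (\<Sum>j<d. w j * h j m * g j l))"
      by (subst sum.swap) (simp only: sum_distrib_left)
    also have "\<dots> = (\<Sum>m<n. q k m * q l m)"
      by (intro sum.cong refl) (use kl gpos in \<open>force simp: Gq\<close>)
    also have "\<dots> = (if k = l then 1 else 0)"
      using tight_square_orthonormal[OF q kl] by (simp add: ip_def)
    finally show "(\<Sum>j<d. c j k * g j l) = (if k = l then 1 else 0)" .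
  qed
  moreover have "(\<Sum>i<d. w i * (\<Sum>j<d. \<bar>ip n (g i) (c j)\<bar>)) = frame_value n {..<d} t u"
    unfolding frame_value_def sum_distrib_left
  proof (intro sum.cong refl)
    fix i j assume ij: "i \<in> {..<d}" "j \<in> {..<d}"
    have "ip n (u i) (u j) = sqrt (w i) * sqrt (w j) * (\<Sum>m<n. h i m * h j m / \<gamma> m)"
      unfolding ip_def sum_distrib_left
    proof (intro sum.cong refl)
      fix m assume "m \<in> {..<n}"
      then have "sqrt (\<gamma> m) * sqrt (\<gamma> m) = \<gamma> m" using gpos[of m] by simp
      moreover have "u i m * u j m = sqrt (w i) * sqrt (w j) * (h i m * h j m / (sqrt (\<gamma> m) * sqrt (\<gamma> m)))"
        by (simp add: u_def)
      ultimately show "u i m * u j m = sqrt (w i) * sqrt (w j) * (h i m * h j m / \<gamma> m)" by simp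
    qed
    then have "t i * t j * \<bar>ip n (u i) (u j)\<bar> = (sqrt (w i) * sqrt (w i)) * ((sqrt (w j) * sqrt (w j)) * \<bar>\<Sum>m<n. h i m * h j m / \<gamma> m\<bar>)"
      using w(1)[of i] w(1)[of j] ij by (simp only: t_def abs_mult) (simp add: mult_ac)
    also have "\<dots> = w i * (w j * \<bar>\<Sum>m<n. h i m * h j m / \<gamma> m\<bar>)" using wsq ij by simp
    also have "\<dots> = w i * \<bar>ip n (g i) (c j)\<bar>" using w(1)[of j] ij by (simp add: gc abs_mult)
    finally show "w i * \<bar>ip n (g i) (c j)\<bar> = t i * t j * \<bar>ip n (u i) (u j)\<bar>" by simp
  qed
  ultimately show ?thesis using frame_boundD[OF B wf] by auto
qed

text \<open>
  Otherwise the vectors of row sums, over all projections, have a coordinate above \<open>B + \<epsilon>\<close>, and the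
  Mazur-Orlicz theorem for the maximum of the coordinates gives weights \<open>a\<close> such that every projection
  has weighted row sum at least \<open>B + \<epsilon>\<close>. Mixing \<open>a\<close> slightly with the uniform weights makes it
  positive, and then it contradicts \<open>weighted_projection\<close>.
\<close>

lemma small_projection:
  assumes B: "frame_bound n B" "0 \<le> B" and n: "0 < n" and eps: "0 < \<epsilon>"
    and g: "\<And>x. (\<And>i. i < d \<Longrightarrow> ip n (g i) x = 0) \<Longrightarrow> (\<forall>k<n. x k = 0)"
  shows "\<exists>c. resolves_identity n d g c \<and> (\<forall>i<d. (\<Sum>j<d. \<bar>ip n (g i) (c j)\<bar>) \<le> B + \<epsilon>)"
proof (rule ccontr)
  assume contra: "\<not> ?thesis"
  have d: "0 < d"
  proof (rule ccontr)
    assume "\<not> 0 < d"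
    then have "\<forall>k<n. (\<lambda>_. 1::real) k = 0" using g[of "\<lambda>_. 1"] by simp
    with n show False by auto
  qed
  define \<phi> where "\<phi> c i = (\<Sum>j<d. \<bar>ip n (g i) (c j)\<bar>)" for c i
  define K where "K = {(y, B + \<epsilon>) | y. \<exists>c. resolves_identity n d g c \<and> (\<forall>i<d. \<phi> c i \<le> y i)}"
  have cv: "convex_data K"
    unfolding convex_data_def
  proof (intro allI impI)
    fix y r z s a b
    assume "(y,r) \<in> K" "(z,s) \<in> K" and ab: "0 \<le> a" "0 \<le> b" "a + b = (1::real)"
    then obtain c c' where c: "r = B + \<epsilon>" "s = B + \<epsilon>" "resolves_identity n d g c" "resolves_identity n d g c'"
      "\<forall>i<d. \<phi> c i \<le> y i" "\<forall>i<d. \<phi> c' i \<le> z i" by (auto simp: K_def)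
    define e where "e j k = a * c j k + b * c' j k" for j k
    have "(\<Sum>j<d. e j k * g j l) = a * (\<Sum>j<d. c j k * g j l) + b * (\<Sum>j<d. c' j k * g j l)" for k l
      by (simp add: e_def distrib_right sum.distrib sum_distrib_left mult.assoc)
    then have "resolves_identity n d g e" using c(3,4) ab by (simp add: resolves_identity_def)
    moreover have "\<phi> e i \<le> a * y i + b * z i" if i: "i < d" for i
    proof -
      have "\<phi> e i \<le> (\<Sum>j<d. a * \<bar>ip n (g i) (c j)\<bar> + b * \<bar>ip n (g i) (c' j)\<bar>)"
        unfolding \<phi>_def
      proof (intro sum_mono)
        fix j
        have "ip n (g i) (e j) = a * ip n (g i) (c j) + b * ip n (g i) (c' j)"
          unfolding e_def ip_add_right ip_scale_right ..
        then show "\<bar>ip n (g i) (e j)\<bar> \<le> a * \<bar>ip n (g i) (c j)\<bar> + b * \<bar>ip n (g i) (c' j)\<bar>"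
          using abs_triangle_ineq[of "a * ip n (g i) (c j)" "b * ip n (g i) (c' j)"] ab by (simp add: abs_mult)
      qed
      also have "\<dots> = a * \<phi> c i + b * \<phi> c' i" by (simp add: \<phi>_def sum.distrib sum_distrib_left)
      also have "\<dots> \<le> a * y i + b * z i" using c(5,6) i ab by (intro add_mono mult_left_mono) auto
      finally show ?thesis .
    qed
    moreover have "a * r + b * s = B + \<epsilon>" using c(1,2) ab by (simp add: distrib_right[symmetric])
    ultimately show "((\<lambda>i. a * y i + b * z i), a * r + b * s) \<in> K" by (auto simp: K_def)
  qed
  have KI: "(\<lambda>i. if i < d then \<phi> c i else 0, B + \<epsilon>) \<in> K" if "resolves_identity n d g c" for c
    using that by (auto simp: K_def)
  have "K \<noteq> {}"
  proof -
    have "(\<Sum>i<d. 1 / real d) = 1" using d by simp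
    then obtain c where "resolves_identity n d g c" using weighted_projection[OF B(1) _ _ g, of d "\<lambda>_. 1 / real d"] d by auto
    then show ?thesis using KI by blast
  qed
  moreover have "r \<le> coord_max d y" if "(y,r) \<in> K" for y r
  proof -
    obtain c where c: "r = B + \<epsilon>" "resolves_identity n d g c" "\<forall>i<d. \<phi> c i \<le> y i" using \<open>(y,r) \<in> K\<close> by (auto simp: K_def)
    then obtain i where "i < d" "B + \<epsilon> < \<phi> c i" using contra by (auto simp: \<phi>_def not_le)
    then show ?thesis using c coord_max_ge[of i d y] by force
  qed
  ultimately obtain a where a: "\<forall>x. (\<forall>i\<ge>d. x i = 0) \<longrightarrow> (\<Sum>i<d. a i * x i) \<le> coord_max d x"
    "\<forall>y r. (y,r) \<in> K \<longrightarrow> (\<forall>i\<ge>d. y i = 0) \<longrightarrow> r \<le> (\<Sum>i<d. a i * y i)"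
    using mazur_orlicz[OF sublinear_coord_max[OF d] cv, of d] by blast
  have a1: "(\<Sum>i<d. a i * x i) \<le> coord_max d x" if "\<forall>i\<ge>d. x i = 0" for x using a(1) that by blast
  have a0: "0 \<le> a i" if i: "i < d" for i
  proof -
    define x where "x = (\<lambda>j. if j = i then -1 else (0::real))"
    have "(\<Sum>j<d. a j * x j) = (\<Sum>j<d. if j = i then - a i else 0)" by (intro sum.cong) (auto simp: x_def)
    then have "- a i = (\<Sum>j<d. a j * x j)" using i by simp
    also have "\<dots> \<le> coord_max d x" using a(1) i by (simp add: x_def)
    also have "\<dots> \<le> 0" using d by (intro coord_max_le) (auto simp: x_def)
    finally show ?thesis by simp
  qed
  have asum: "(\<Sum>i<d. a i) = 1"
  proof (rule antisym)
    have "(\<Sum>i<d. a i * (if i < d then 1 else 0)) \<le> coord_max d (\<lambda>i. if i < d then 1 else 0)" by (rule a1) simp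
    also have "\<dots> \<le> 1" using d by (intro coord_max_le) auto
    finally show "(\<Sum>i<d. a i) \<le> 1" by simp
    have "(\<Sum>i<d. a i * (if i < d then - 1 else 0)) \<le> coord_max d (\<lambda>i. if i < d then - 1 else 0)" by (rule a1) simp
    also have "\<dots> \<le> - 1" using d by (intro coord_max_le) auto
    finally show "1 \<le> (\<Sum>i<d. a i)" by (simp add: sum_negf)
  qed
  \<comment> \<open>Small enough for \<open>B / (1 - \<delta>) < B + \<epsilon>\<close>.\<close>
  define \<delta> where "\<delta> = (\<epsilon> / 2) / (B + \<epsilon>)"
  have del: "0 < \<delta>" "\<delta> < 1" "(1 - \<delta>) * (B + \<epsilon>) > B"
  proof -
    have Be: "0 < B + \<epsilon>" using eps B(2) by simp
    then show "0 < \<delta>" "\<delta> < 1" using eps B(2) by (simp_all add: \<delta>_def pos_divide_less_eq del: divide_divide_eq_left)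
    have "(\<epsilon> / 2) / c * c = \<epsilon> / 2" if "0 < c" for c using that by simp
    from this[OF Be] have "\<delta> * (B + \<epsilon>) = \<epsilon> / 2" unfolding \<delta>_def .
    then show "(1 - \<delta>) * (B + \<epsilon>) > B" using eps by (simp add: left_diff_distrib)
  qed
  define w where "w i = (1 - \<delta>) * a i + \<delta> / real d" for i
  have "0 < w i" if "i < d" for i
    using a0[OF that] del d by (auto simp: w_def intro!: add_nonneg_pos)
  moreover have "(\<Sum>i<d. w i) = 1" using asum d by (simp add: w_def sum.distrib sum_distrib_left[symmetric])
  ultimately obtain c where c: "resolves_identity n d g c" "(\<Sum>i<d. w i * \<phi> c i) \<le> B"
    using weighted_projection[OF B(1) _ _ g, of d w] unfolding \<phi>_def by blast
  have "B + \<epsilon> \<le> (\<Sum>i<d. a i * (if i < d then \<phi> c i else 0))" using a(2) KI[OF c(1)] by fastforce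
  also have "\<dots> = (\<Sum>i<d. a i * \<phi> c i)" by (intro sum.cong) auto
  finally have "B + \<epsilon> \<le> (\<Sum>i<d. a i * \<phi> c i)" .
  then have "(1 - \<delta>) * (B + \<epsilon>) \<le> (1 - \<delta>) * (\<Sum>i<d. a i * \<phi> c i)" using del by (intro mult_left_mono) auto
  also have "\<dots> \<le> (\<Sum>i<d. w i * \<phi> c i)"
    unfolding sum_distrib_left
  proof (intro sum_mono)
    fix i
    have "0 \<le> \<phi> c i" by (simp add: \<phi>_def sum_nonneg)
    then have "0 \<le> \<delta> / real d * \<phi> c i" using del by (intro mult_nonneg_nonneg) auto
    then show "(1 - \<delta>) * (a i * \<phi> c i) \<le> w i * \<phi> c i" unfolding w_def by (simp add: distrib_right mult.assoc)
  qed
  finally show False using c(2) del(3) by simp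
qed

section \<open>Norms and embeddings into the bounded sequences\<close>

lemma vec_add: "vec n (\<lambda>i. x i + y i) = vec n x + vec n (y :: nat \<Rightarrow> real)"
  by (rule eq_vecI) auto

lemma vec_scale: "vec n (\<lambda>i. c * x i) = c \<cdot>\<^sub>v vec n (x :: nat \<Rightarrow> real)"
  by (rule eq_vecI) auto

lemma vec_zero_iff: "vec n x = 0\<^sub>v n \<longleftrightarrow> (\<forall>i<n. x i = (0::real))"
proof
  assume e: "vec n x = 0\<^sub>v n"
  show "\<forall>i<n. x i = 0"
  proof (intro allI impI)
    fix i assume "i < n"
    then show "x i = 0" using arg_cong[OF e, of "\<lambda>v. v $ i"] by simp
  qed
qed (auto intro!: eq_vecI)

text \<open>
  A norm on the coordinate space, transferred to functions by \<open>nrm\<close>.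
\<close>

locale normed_vec =
  fixes n :: nat and N :: "real vec \<Rightarrow> real"
  assumes norm_on: "norm_on n N"
begin

definition nrm :: "(nat \<Rightarrow> real) \<Rightarrow> real" where "nrm x = N (vec n x)"

lemma nrm_nonneg: "0 \<le> nrm x"
  using norm_on by (simp add: norm_on_def nrm_def)

lemma nrm_zero_iff: "nrm x = 0 \<longleftrightarrow> (\<forall>i<n. x i = 0)"
  using norm_on by (simp add: norm_on_def nrm_def vec_zero_iff)

lemma nrm_scale: "nrm (\<lambda>i. c * x i) = \<bar>c\<bar> * nrm x"
  using norm_on by (simp add: norm_on_def nrm_def vec_scale)

lemma nrm_add: "nrm (\<lambda>i. x i + y i) \<le> nrm x + nrm y"
  using norm_on by (simp add: norm_on_def nrm_def vec_add)

lemma nrm_neg: "nrm (\<lambda>i. - x i) = nrm x"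
  using nrm_scale[of "-1" x] by simp

lemma nrm_diff: "\<bar>nrm x - nrm y\<bar> \<le> nrm (\<lambda>i. x i - y i)"
  using nrm_add[of y "\<lambda>i. x i - y i"] nrm_add[of x "\<lambda>i. y i - x i"] nrm_neg[of "\<lambda>i. x i - y i"] by simp

lemma sublinear_nrm: "sublinear nrm"
  by (simp add: sublinear_def nrm_add nrm_scale)

lemma nrm_cong: "(\<And>i. i < n \<Longrightarrow> x i = y i) \<Longrightarrow> nrm x = nrm y"
  unfolding nrm_def by (rule arg_cong[of _ _ N], rule eq_vecI) auto

definition unit_nrm :: "nat \<Rightarrow> real" where "unit_nrm i = nrm (\<lambda>j. if j = i then 1 else 0)"

lemma unit_nrm_nonneg: "0 \<le> unit_nrm i" by (simp add: unit_nrm_def nrm_nonneg)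

lemma nrm_le: "nrm x \<le> (\<Sum>i<n. \<bar>x i\<bar> * unit_nrm i)"
proof -
  have "nrm (\<lambda>j. if j < k then x j else 0) \<le> (\<Sum>i<k. \<bar>x i\<bar> * unit_nrm i)" for k
  proof (induction k)
    case 0 then show ?case using nrm_zero_iff by (simp add: order_eq_refl)
  next
    case (Suc k)
    have "(\<lambda>j. if j < Suc k then x j else 0) = (\<lambda>j. (if j < k then x j else 0) + x k * (if j = k then 1 else 0))"
      by (auto simp: less_Suc_eq)
    then have "nrm (\<lambda>j. if j < Suc k then x j else 0) \<le> nrm (\<lambda>j. if j < k then x j else 0) + \<bar>x k\<bar> * unit_nrm k"
      using nrm_add[of "\<lambda>j. if j < k then x j else 0" "\<lambda>j. x k * (if j = k then 1 else 0)"]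
        nrm_scale[of "x k" "\<lambda>j. if j = k then 1 else 0"] by (simp only: unit_nrm_def)
    then show ?case using Suc by simp
  qed
  from this[of n] show ?thesis using nrm_cong[of "\<lambda>j. if j < n then x j else 0" x] by simp
qed

text \<open>
  The Mazur-Orlicz theorem for a single requirement.
\<close>

lemma norming_functional:
  "\<exists>a. (\<forall>y. \<bar>ip n a y\<bar> \<le> nrm y) \<and> ip n a x = nrm x"
proof -
  define x0 where "x0 = (\<lambda>i. if i < n then x i else 0)"
  have x0: "nrm x0 = nrm x" by (rule nrm_cong) (simp add: x0_def)
  have "convex_data {(x0, nrm x)}" by (simp add: convex_data_def distrib_right[symmetric])
  from mazur_orlicz[OF sublinear_nrm this, of n] obtain a where
    a: "\<forall>y. (\<forall>i\<ge>n. y i = 0) \<longrightarrow> (\<Sum>i<n. a i * y i) \<le> nrm y" "nrm x \<le> (\<Sum>i<n. a i * x0 i)"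
    using x0 by (auto simp: x0_def)
  have le: "ip n a y \<le> nrm y" for y
  proof -
    have "(\<Sum>i<n. a i * (if i < n then y i else 0)) \<le> nrm (\<lambda>i. if i < n then y i else 0)"
      by (rule a(1)[THEN spec, THEN mp]) simp
    also have "nrm (\<lambda>i. if i < n then y i else 0) = nrm y" by (rule nrm_cong) simp
    finally show ?thesis by (simp add: ip_def)
  qed
  have "\<bar>ip n a y\<bar> \<le> nrm y" for y
    using le[of y] le[of "\<lambda>i. - y i"] nrm_neg[of y] by (simp add: ip_def sum_negf abs_le_iff)
  moreover have "nrm x \<le> ip n a x" using a(2) by (simp add: ip_def x0_def)
  ultimately show ?thesis using le[of x] by (intro exI[of _ a]) (auto intro: antisym)
qed

lemma rational_approximation:
  assumes "0 < e"
  shows "\<exists>xs :: rat list. nrm (\<lambda>i. x i - (if i < length xs then of_rat (xs ! i) else 0)) \<le> e"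
proof -
  define C where "C = (\<Sum>i<n. unit_nrm i) + 1"
  have C: "C > 0" by (simp add: C_def add_nonneg_pos sum_nonneg unit_nrm_nonneg)
  have "\<exists>q :: rat. \<bar>x i - of_rat q\<bar> < e / C" for i
  proof -
    have "x i < x i + e / C" using assms C by simp
    then obtain q where "x i < of_rat q" "of_rat q < x i + e / C" using of_rat_dense by blast
    then show ?thesis by (intro exI[of _ q]) linarith
  qed
  then obtain q :: "nat \<Rightarrow> rat" where q: "\<And>i. \<bar>x i - of_rat (q i)\<bar> < e / C" by metis
  define xs where "xs = map q [0..<n]"
  have "nrm (\<lambda>i. x i - (if i < length xs then of_rat (xs ! i) else 0)) = nrm (\<lambda>i. x i - of_rat (q i))"
    by (rule nrm_cong) (simp add: xs_def)
  also have "\<dots> \<le> (\<Sum>i<n. \<bar>x i - of_rat (q i)\<bar> * unit_nrm i)" by (rule nrm_le)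
  also have "\<dots> \<le> (\<Sum>i<n. e / C * unit_nrm i)"
    using q by (intro sum_mono mult_right_mono unit_nrm_nonneg) (simp add: less_imp_le)
  also have "\<dots> = e / C * (C - 1)" by (simp add: sum_distrib_left C_def)
  also have "\<dots> \<le> e / C * C" using assms C by (intro mult_left_mono) auto
  also have "\<dots> = e" using C by simp
  finally show ?thesis by blast
qed

lemma nrm_vec_index: "v \<in> carrier_vec n \<Longrightarrow> nrm (\<lambda>i. v $ i) = N v"
  unfolding nrm_def by (rule arg_cong[of _ _ N], rule eq_vecI) auto

text \<open>
  The coordinates of the embedding are norming functionals of the countably many rational points.
\<close>

lemma isometric_embedding_exists: "\<exists>\<phi>. isometric_embedding n N \<phi>"
proof -
  define r where "r k = (\<lambda>i. if i < length (from_nat k :: rat list) then of_rat (from_nat k ! i) else (0::real))" for k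
  define a where "a k = (SOME a. (\<forall>y. \<bar>ip n a y\<bar> \<le> nrm y) \<and> ip n a (r k) = nrm (r k))" for k
  have "(\<forall>y. \<bar>ip n (a k) y\<bar> \<le> nrm y) \<and> ip n (a k) (r k) = nrm (r k)" for k
    unfolding a_def by (rule someI_ex[OF norming_functional])
  then have a: "\<And>k y. \<bar>ip n (a k) y\<bar> \<le> nrm y" "\<And>k. ip n (a k) (r k) = nrm (r k)" by blast+
  define \<phi> where "\<phi> v = Bcontfun (\<lambda>k. ip n (a k) (\<lambda>i. v $ i))" for v :: "real vec"
  have ap: "apply_bcontfun (\<phi> v) k = ip n (a k) (\<lambda>i. v $ i)" for v k
  proof -
    have "(\<lambda>k. ip n (a k) (\<lambda>i. v $ i)) \<in> bcontfun"
      by (rule bcontfun_normI[where b="nrm (\<lambda>i. v $ i)"]) (use a(1) in \<open>auto simp: continuous_on_discrete\<close>)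
    then show ?thesis by (simp add: \<phi>_def Bcontfun_inverse)
  qed
  have "\<phi> (v + w) = \<phi> v + \<phi> w" if "v \<in> carrier_vec n" "w \<in> carrier_vec n" for v w
    by (rule bcontfun_eqI) (use that in \<open>simp add: ap ip_def sum.distrib distrib_left\<close>)
  moreover have "\<phi> (c \<cdot>\<^sub>v v) = c *\<^sub>R \<phi> v" if "v \<in> carrier_vec n" for c v
    by (rule bcontfun_eqI) (use that in \<open>simp add: ap ip_def sum_distrib_left mult.left_commute\<close>)
  moreover have "norm (\<phi> v) = N v" if v: "v \<in> carrier_vec n" for v
  proof (rule antisym)
    show "norm (\<phi> v) \<le> N v"
      by (rule norm_bound) (simp add: ap a(1)[of _ "\<lambda>i. v $ i", unfolded nrm_vec_index[OF v]])
    show "N v \<le> norm (\<phi> v)"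
    proof (rule field_le_epsilon)
      fix e :: real assume "0 < e"
      then have "0 < e / 2" by simp
      from rational_approximation[OF this, of "\<lambda>i. v $ i"] obtain xs :: "rat list" where
        xs: "nrm (\<lambda>i. v $ i - (if i < length xs then of_rat (xs ! i) else 0)) \<le> e / 2" by blast
      define k where "k = to_nat xs"
      have rk: "r k = (\<lambda>i. if i < length xs then of_rat (xs ! i) else 0)" unfolding r_def k_def from_nat_to_nat ..
      have d: "nrm (\<lambda>i. v $ i - r k i) \<le> e / 2" using xs by (simp add: rk)
      have "N v \<le> nrm (r k) + e / 2"
        using nrm_diff[of "\<lambda>i. v $ i" "r k"] d nrm_vec_index[OF v] by simp
      also have "nrm (r k) = ip n (a k) (\<lambda>i. v $ i) - ip n (a k) (\<lambda>i. v $ i - r k i)"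
        unfolding a(2)[symmetric] by (simp add: ip_def sum_subtractf right_diff_distrib)
      also have "\<dots> \<le> norm (\<phi> v) + e / 2"
        using norm_bounded[of "\<phi> v" k] a(1)[of k "\<lambda>i. v $ i - r k i"] d by (simp add: ap)
      finally show "N v \<le> norm (\<phi> v) + e" by simp
    qed
  qed
  ultimately show ?thesis unfolding isometric_embedding_def by blast
qed

end

locale embedded_space = normed_vec +
  fixes \<phi> :: "real vec \<Rightarrow> linfty"
  assumes embedding: "isometric_embedding n N \<phi>"
begin

definition emb :: "(nat \<Rightarrow> real) \<Rightarrow> linfty" where "emb x = \<phi> (vec n x)"

lemma emb_add: "emb (\<lambda>i. x i + y i) = emb x + emb y"
  using embedding by (simp add: isometric_embedding_def emb_def vec_add)

lemma emb_scale: "emb (\<lambda>i. c * x i) = c *\<^sub>R emb x"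
  using embedding by (simp add: isometric_embedding_def emb_def vec_scale)

lemma norm_emb: "norm (emb x) = nrm x"
  using embedding by (simp add: isometric_embedding_def emb_def nrm_def)

lemma emb_zero: "emb (\<lambda>i. 0) = 0"
  using emb_scale[of 0 "\<lambda>i. 0"] by simp

lemma emb_sum: "emb (\<lambda>i. \<Sum>j<(d::nat). f j i) = (\<Sum>j<d. emb (f j))"
  by (induction d) (auto simp: emb_zero emb_add)

lemma emb_cong: "(\<And>i. i < n \<Longrightarrow> x i = y i) \<Longrightarrow> emb x = emb y"
  unfolding emb_def by (rule arg_cong[of _ _ \<phi>], rule eq_vecI) auto

lemma emb_eq_iff: "emb x = emb y \<longleftrightarrow> (\<forall>i<n. x i = y i)"
proof
  assume e: "emb x = emb y"
  have "emb (\<lambda>i. x i + (- 1) * y i) = 0" unfolding emb_add emb_scale using e by simp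
  then have "nrm (\<lambda>i. x i + (- 1) * y i) = 0" using norm_emb by (metis norm_zero)
  then show "\<forall>i<n. x i = y i" by (simp add: nrm_zero_iff)
qed (auto intro: emb_cong)

lemma range_emb: "\<phi> ` carrier_vec n = range emb"
proof
  show "\<phi> ` carrier_vec n \<subseteq> range emb"
  proof
    fix y assume "y \<in> \<phi> ` carrier_vec n"
    then obtain v where v: "v \<in> carrier_vec n" "y = \<phi> v" by blast
    have "vec n (\<lambda>i. v $ i) = v" using v by (intro eq_vecI) auto
    then have "y = emb (\<lambda>i. v $ i)" using v by (simp add: emb_def)
    then show "y \<in> range emb" by blast
  qed
  show "range emb \<subseteq> \<phi> ` carrier_vec n" by (auto simp: emb_def)
qed

definition coord :: "nat \<Rightarrow> nat \<Rightarrow> real" where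
  "coord k l = apply_bcontfun (emb (\<lambda>j. if j = l then 1 else 0)) k"

lemma apply_emb: "apply_bcontfun (emb x) k = ip n (coord k) x"
proof -
  have "emb x = emb (\<lambda>i. \<Sum>l<n. x l * (if i = l then 1 else 0))"
  proof (rule emb_cong)
    fix i assume "i < n"
    have "(\<Sum>l<n. x l * (if i = l then 1 else 0)) = (\<Sum>l<n. if l = i then x i else 0)"
      by (intro sum.cong) auto
    then show "x i = (\<Sum>l<n. x l * (if i = l then 1 else 0))" using \<open>i < n\<close> by simp
  qed
  also have "\<dots> = (\<Sum>l<n. x l *\<^sub>R emb (\<lambda>j. if j = l then 1 else 0))"
    unfolding emb_sum emb_scale ..
  finally have e: "emb x = (\<Sum>l<n. x l *\<^sub>R emb (\<lambda>j. if j = l then 1 else 0))" .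
  have s: "apply_bcontfun (\<Sum>l<m. f l) k = (\<Sum>l<m. apply_bcontfun (f l) k)" for f :: "nat \<Rightarrow> linfty" and m :: nat
    by (induction m) auto
  show ?thesis unfolding e s by (simp add: ip_def coord_def mult.commute)
qed

text \<open>
  The open sets where a given coordinate suffices cover the compact Euclidean unit sphere.
\<close>

lemma finitely_many_coordinates:
  assumes eps: "0 < \<epsilon>"
  shows "\<exists>d. \<forall>x. \<exists>k<d. nrm x \<le> (1 + \<epsilon>) * \<bar>ip n (coord k) x\<bar>"
proof -
  define K where "K = {x :: nat \<Rightarrow> real. \<forall>p. \<bar>x p\<bar> \<le> 1} \<inter> {x. ip n x x = 1}"
  have c: "continuous_on A (\<lambda>x. x p)" for A and p :: nat
    by (rule continuous_on_subset[OF continuous_on_product_coordinates]) auto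
  have "compact K" unfolding K_def ip_def
    by (intro compact_Int_closed compact_cube closed_Collect_eq continuous_intros c)
  have cn: "continuous_on UNIV nrm"
    unfolding continuous_on_def
  proof
    fix a :: "nat \<Rightarrow> real"
    have h: "continuous_on UNIV (\<lambda>x. \<Sum>i<n. \<bar>x i - a i\<bar> * unit_nrm i)" by (intro continuous_intros c)
    then have "((\<lambda>x. \<Sum>i<n. \<bar>x i - a i\<bar> * unit_nrm i) \<longlongrightarrow> (\<Sum>i<n. \<bar>a i - a i\<bar> * unit_nrm i)) (at a)"
      unfolding continuous_on_def by (simp only: UNIV_I ball_simps)
    then have "((\<lambda>x. \<Sum>i<n. \<bar>x i - a i\<bar> * unit_nrm i) \<longlongrightarrow> 0) (at a)" by simp
    moreover have "\<forall>\<^sub>F x in at a. norm (nrm x - nrm a) \<le> (\<Sum>i<n. \<bar>x i - a i\<bar> * unit_nrm i)"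
      by (intro always_eventually allI) (use nrm_diff nrm_le order_trans in \<open>fastforce\<close>)
    ultimately have "((\<lambda>x. nrm x - nrm a) \<longlongrightarrow> 0) (at a)" by (rule Lim_null_comparison[rotated])
    then show "(nrm \<longlongrightarrow> nrm a) (at a)" by (simp add: LIM_zero_iff)
  qed
  define U where "U k = {x. nrm x < (1 + \<epsilon>) * \<bar>ip n (coord k) x\<bar>}" for k
  have oU: "open (U k)" for k
    unfolding U_def ip_def by (intro open_Collect_less cn continuous_intros c)
  have "K \<subseteq> (\<Union>k. U k)"
  proof
    fix x assume "x \<in> K"
    then have "ip n x x = 1" by (simp add: K_def)
    then have "\<not> (\<forall>i<n. x i = 0)" using ip_zero_iff[of n x] by simp
    then have "nrm x \<noteq> 0" using nrm_zero_iff by blast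
    then have pos: "0 < nrm x" using nrm_nonneg[of x] by simp
    have "\<exists>k. nrm x < (1 + \<epsilon>) * \<bar>ip n (coord k) x\<bar>"
    proof (rule ccontr)
      assume "\<not> ?thesis"
      then have "\<And>k. \<bar>ip n (coord k) x\<bar> \<le> nrm x / (1 + \<epsilon>)" using eps by (simp add: pos_le_divide_eq not_less mult.commute)
      then have "norm (emb x) \<le> nrm x / (1 + \<epsilon>)" by (intro norm_bound) (simp add: apply_emb)
      then show False using pos eps mult_pos_pos[OF eps pos] unfolding norm_emb by (simp add: field_simps)
    qed
    then show "x \<in> (\<Union>k. U k)" by (auto simp: U_def)
  qed
  then obtain C where C: "finite C" "K \<subseteq> (\<Union>k\<in>C. U k)"
    using compactE_image[OF \<open>compact K\<close>, of UNIV U] oU by auto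
  define d where "d = Suc (Max (insert 0 C))"
  have Cd: "k < d" if "k \<in> C" for k using that C(1) by (simp add: d_def less_Suc_eq_le)
  show ?thesis
  proof (rule exI[of _ d], rule allI)
    fix x :: "nat \<Rightarrow> real"
    show "\<exists>k<d. nrm x \<le> (1 + \<epsilon>) * \<bar>ip n (coord k) x\<bar>"
    proof (cases "ip n x x = 0")
      case True
      then have "nrm x = 0" using nrm_zero_iff ip_zero_iff by blast
      then show ?thesis using eps by (intro exI[of _ 0]) (simp add: d_def)
    next
      case False
      define s where "s = sqrt (ip n x x)"
      have s: "s > 0" "s * s = ip n x x" using False ip_self_nonneg[of n x] by (auto simp: s_def)
      define y where "y = (\<lambda>i. (1 / s) * (if i < n then x i else 0))"
      have yx: "ip n a y = (1 / s) * ip n a x" for a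
        unfolding y_def ip_scale_right by (simp add: ip_def)
      have yy: "ip n y y = 1"
      proof -
        have "ip n y y = (1 / s) * ((1 / s) * ip n x x)" by (subst yx, subst ip_commute, subst yx) simp
        also have "\<dots> = (1 / s) * ((1 / s) * (s * s))" by (simp only: s(2))
        also have "\<dots> = 1" using s(1) by simp
        finally show ?thesis .
      qed
      have "\<bar>y p\<bar> \<le> 1" for p
      proof (cases "p < n")
        case True
        then have "y p * y p \<le> ip n y y" unfolding ip_def by (intro member_le_sum) auto
        then show ?thesis using yy by (simp add: abs_square_le_1 power2_eq_square[symmetric])
      qed (simp add: y_def)
      with yy have "y \<in> K" by (simp add: K_def)
      then obtain k where k: "k \<in> C" "nrm y < (1 + \<epsilon>) * \<bar>ip n (coord k) y\<bar>" using C(2) by (auto simp: U_def)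
      have "nrm y = (1 / s) * nrm x"
        unfolding y_def nrm_scale using s by (simp add: nrm_cong[of "\<lambda>i. if i < n then x i else 0" x])
      then have "(1 / s) * nrm x \<le> (1 / s) * ((1 + \<epsilon>) * \<bar>ip n (coord k) x\<bar>)"
        using k(2) s by (simp add: yx abs_mult)
      then have "nrm x \<le> (1 + \<epsilon>) * \<bar>ip n (coord k) x\<bar>" using s by (simp add: divide_le_cancel)
      then show ?thesis using Cd[OF k(1)] by blast
    qed
  qed
qed

text \<open>
  Restrict a sequence to the finitely many coordinates that almost determine the norm, and apply
  \<open>small_projection\<close> there.
\<close>

lemma projection_exists:
  assumes B: "frame_bound n B" "0 \<le> B" and n: "0 < n" and eps: "0 < \<epsilon>"
  shows "\<exists>Q \<in> projections_onto (\<phi> ` carrier_vec n). onorm Q \<le> (1 + \<epsilon>) * (B + \<epsilon>)"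
proof -
  obtain d where d: "\<forall>x. \<exists>k<d. nrm x \<le> (1 + \<epsilon>) * \<bar>ip n (coord k) x\<bar>"
    using finitely_many_coordinates[OF eps] by blast
  have g: "\<forall>k<n. x k = 0" if "\<And>i. i < d \<Longrightarrow> ip n (coord i) x = 0" for x
    using d[rule_format, of x] that nrm_nonneg[of x] nrm_zero_iff[of x] by force
  obtain c where c: "resolves_identity n d coord c" "\<forall>i<d. (\<Sum>j<d. \<bar>ip n (coord i) (c j)\<bar>) \<le> B + \<epsilon>"
    using small_projection[OF B n eps g] by blast
  define V where "V y l = (\<Sum>j<d. apply_bcontfun y j * c j l)" for y :: linfty and l
  define Q where "Q y = emb (V y)" for y
  have ap: "\<bar>apply_bcontfun y j\<bar> \<le> norm y" for y :: linfty and j using norm_bounded[of y j] by simp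
  have bound: "norm (Q y) \<le> norm y * ((1 + \<epsilon>) * (B + \<epsilon>))" for y
  proof -
    obtain i where i: "i < d" "nrm (V y) \<le> (1 + \<epsilon>) * \<bar>ip n (coord i) (V y)\<bar>" using d by blast
    have "ip n (coord i) (V y) = (\<Sum>j<d. apply_bcontfun y j * ip n (coord i) (c j))"
      unfolding V_def ip_sum_right ip_scale_right ..
    also have "\<bar>\<dots>\<bar> \<le> (\<Sum>j<d. norm y * \<bar>ip n (coord i) (c j)\<bar>)"
      by (rule order_trans[OF sum_abs]) (auto simp: abs_mult intro!: sum_mono mult_right_mono ap)
    also have "\<dots> = norm y * (\<Sum>j<d. \<bar>ip n (coord i) (c j)\<bar>)" by (simp add: sum_distrib_left)
    also have "\<dots> \<le> norm y * (B + \<epsilon>)" using c(2) i by (intro mult_left_mono) auto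
    finally have "(1 + \<epsilon>) * \<bar>ip n (coord i) (V y)\<bar> \<le> (1 + \<epsilon>) * (norm y * (B + \<epsilon>))"
      using eps by (intro mult_left_mono) auto
    then show ?thesis using i(2) by (simp add: Q_def norm_emb mult_ac)
  qed
  have "bounded_linear Q"
  proof (rule bounded_linear_intro[OF _ _ bound])
    fix y z :: linfty and r :: real
    have "V (y + z) = (\<lambda>l. V y l + V z l)" by (auto simp: V_def distrib_right sum.distrib)
    then show "Q (y + z) = Q y + Q z" by (simp only: Q_def emb_add)
    have "V (r *\<^sub>R y) = (\<lambda>l. r * V y l)" by (auto simp: V_def sum_distrib_left mult.assoc)
    then show "Q (r *\<^sub>R y) = r *\<^sub>R Q y" by (simp only: Q_def emb_scale)
  qed
  moreover have id: "Q (emb x) = emb x" for x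
    unfolding Q_def
  proof (rule emb_cong)
    fix l assume l: "l < n"
    have "V (emb x) l = (\<Sum>j<d. \<Sum>k<n. x k * (c j l * coord j k))"
      unfolding V_def apply_emb ip_def sum_distrib_right by (simp add: mult_ac)
    also have "\<dots> = (\<Sum>k<n. x k * (\<Sum>j<d. c j l * coord j k))"
      by (subst sum.swap) (simp only: sum_distrib_left)
    also have "\<dots> = (\<Sum>k<n. if k = l then x k else 0)"
      by (intro sum.cong refl) (use c(1) l in \<open>auto simp: resolves_identity_def\<close>)
    finally show "V (emb x) l = x l" using l by simp
  qed
  moreover have "range Q = range emb"
  proof
    show "range Q \<subseteq> range emb" by (auto simp: Q_def)
    show "range emb \<subseteq> range Q" using id by (metis image_subsetI rangeI)
  qed
  ultimately have "Q \<in> projections_onto (\<phi> ` carrier_vec n)"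
    unfolding range_emb projections_onto_def by auto
  moreover have "onorm Q \<le> (1 + \<epsilon>) * (B + \<epsilon>)"
    using bound eps B(2) by (intro onorm_bound) (auto simp: mult.commute)
  ultimately show ?thesis by blast
qed

lemma projection_constant_le:
  assumes B: "frame_bound n B" "0 \<le> B" and n: "0 < n"
  shows "relative_projection_constant (\<phi> ` carrier_vec n) \<le> B"
proof (rule field_le_epsilon)
  fix e :: real assume e: "0 < e"
  \<comment> \<open>Chosen so that \<open>(1 + \<epsilon>) * (B + \<epsilon>) \<le> B + e\<close>.\<close>
  define \<epsilon> where "\<epsilon> = min 1 (e / (2 + B))"
  have eps: "0 < \<epsilon>" "\<epsilon> \<le> 1" "\<epsilon> * (2 + B) \<le> e"
  proof -
    show "0 < \<epsilon>" "\<epsilon> \<le> 1" using e B(2) by (auto simp: \<epsilon>_def)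
    have "\<epsilon> \<le> e / (2 + B)" by (simp add: \<epsilon>_def)
    then show "\<epsilon> * (2 + B) \<le> e" using B(2) by (simp add: pos_le_divide_eq)
  qed
  obtain Q where Q: "Q \<in> projections_onto (\<phi> ` carrier_vec n)" "onorm Q \<le> (1 + \<epsilon>) * (B + \<epsilon>)"
    using projection_exists[OF B n eps(1)] by blast
  have "bdd_below (onorm ` projections_onto (\<phi> ` carrier_vec n))"
    by (rule bdd_belowI2[of _ 0]) (auto simp: projections_onto_def intro: onorm_pos_le)
  then have "relative_projection_constant (\<phi> ` carrier_vec n) \<le> onorm Q"
    unfolding relative_projection_constant_def using Q(1) by (intro cINF_lower)
  also note Q(2)
  also have "(1 + \<epsilon>) * (B + \<epsilon>) = B + \<epsilon> * (1 + B + \<epsilon>)" by (simp add: algebra_simps)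
  also have "\<dots> \<le> B + \<epsilon> * (2 + B)" using eps by (intro add_left_mono mult_left_mono) auto
  also have "\<dots> \<le> B + e" using eps(3) by simp
  finally show "relative_projection_constant (\<phi> ` carrier_vec n) \<le> B + e" .
qed

end

section \<open>The polyhedral space of an optimal frame\<close>

text \<open>
  A functional on a subspace of \<open>d\<close>-dimensional space with the maximum norm extends to the whole space
  with norm at most one; the dual norm is the sum of the absolute values.
\<close>

lemma dominated_functional:
  fixes v :: "nat \<Rightarrow> nat \<Rightarrow> real"
  assumes d: "0 < d" and le: "\<And>x. ip n f x \<le> coord_max d (\<lambda>i. \<bar>ip n (v i) x\<bar>)"
  shows "\<exists>a. (\<Sum>i<d. \<bar>a i\<bar>) \<le> 1 \<and> (\<forall>x. ip n f x = (\<Sum>i<d. a i * ip n (v i) x))"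
proof -
  define T where "T x = (\<lambda>i. if i < d then ip n (v i) x else 0)" for x
  define K where "K = {(T x, ip n f x) | x. True}"
  have lin: "T (\<lambda>k. a * x k + b * y k) = (\<lambda>i. a * T x i + b * T y i)" for a b x y
    by (auto simp: T_def ip_add_right ip_scale_right)
  have "convex_data K"
    unfolding convex_data_def
  proof (intro allI impI)
    fix y r z s a b assume "(y,r) \<in> K" "(z,s) \<in> K"
    then obtain x x' where "y = T x" "r = ip n f x" "z = T x'" "s = ip n f x'" by (auto simp: K_def)
    then have "((\<lambda>i. a * y i + b * z i), a * r + b * s) = (T (\<lambda>k. a * x k + b * x' k), ip n f (\<lambda>k. a * x k + b * x' k))"
      by (simp add: lin ip_add_right ip_scale_right)
    then show "((\<lambda>i. a * y i + b * z i), a * r + b * s) \<in> K" unfolding K_def by blast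
  qed
  moreover have "K \<noteq> {}" by (auto simp: K_def)
  moreover have "r \<le> coord_max d (\<lambda>i. \<bar>y i\<bar>)" if "(y,r) \<in> K" for y r
  proof -
    obtain x where x: "y = T x" "r = ip n f x" using \<open>(y,r) \<in> K\<close> by (auto simp: K_def)
    have "coord_max d (\<lambda>i. \<bar>ip n (v i) x\<bar>) \<le> coord_max d (\<lambda>i. \<bar>y i\<bar>)"
    proof (rule coord_max_le[OF d])
      fix i assume "i < d"
      then show "\<bar>ip n (v i) x\<bar> \<le> coord_max d (\<lambda>i. \<bar>y i\<bar>)" using coord_max_ge[of i d "\<lambda>i. \<bar>y i\<bar>"] by (simp add: x T_def)
    qed
    then show ?thesis using le[of x] x by simp
  qed
  ultimately obtain a where a: "\<forall>x. (\<forall>i\<ge>d. x i = 0) \<longrightarrow> (\<Sum>i<d. a i * x i) \<le> coord_max d (\<lambda>i. \<bar>x i\<bar>)"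
    "\<forall>y r. (y,r) \<in> K \<longrightarrow> (\<forall>i\<ge>d. y i = 0) \<longrightarrow> r \<le> (\<Sum>i<d. a i * y i)"
    using mazur_orlicz[OF sublinear_coord_max_abs[OF d], of K d] by blast
  have ge: "ip n f x \<le> (\<Sum>i<d. a i * ip n (v i) x)" for x
  proof -
    have "(T x, ip n f x) \<in> K" by (auto simp: K_def)
    moreover have "\<forall>i\<ge>d. T x i = 0" by (simp add: T_def)
    ultimately have "ip n f x \<le> (\<Sum>i<d. a i * T x i)" using a(2) by blast
    also have "\<dots> = (\<Sum>i<d. a i * ip n (v i) x)" by (intro sum.cong) (auto simp: T_def)
    finally show ?thesis .
  qed
  have "ip n f x = (\<Sum>i<d. a i * ip n (v i) x)" for x
  proof (rule antisym[OF ge])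
    have neg: "ip n h (\<lambda>k. - x k) = - ip n h x" for h by (simp add: ip_def sum_negf)
    show "(\<Sum>i<d. a i * ip n (v i) x) \<le> ip n f x" using ge[of "\<lambda>k. - x k"] by (simp add: neg sum_negf)
  qed
  moreover have "(\<Sum>i<d. \<bar>a i\<bar>) \<le> 1"
  proof -
    have "(\<Sum>i<d. \<bar>a i\<bar>) = (\<Sum>i<d. a i * (if i < d then sgn (a i) else 0))"
      by (intro sum.cong) (auto simp: abs_sgn)
    also have "\<dots> \<le> coord_max d (\<lambda>i. \<bar>if i < d then sgn (a i) else 0\<bar>)"
      by (rule a(1)[THEN spec, THEN mp]) simp
    also have "\<dots> \<le> 1" by (rule coord_max_le[OF d]) (simp add: abs_sgn_eq)
    finally show ?thesis .
  qed
  ultimately show ?thesis by blast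
qed

context optimal_frame
begin

text \<open>
  The functionals whose maximum modulus is the norm of the extremal space.
\<close>

definition direction :: "nat \<Rightarrow> nat \<Rightarrow> real" where "direction i k = u i k / t i"

definition polyhedral_norm :: "real vec \<Rightarrow> real" where
  "polyhedral_norm x = coord_max d (\<lambda>i. \<bar>ip n (direction i) (\<lambda>k. x $ k)\<bar>)"

lemma direction_eq: "i < d \<Longrightarrow> u i k = t i * direction i k"
  using pos[of i] by (simp add: direction_def)

lemma direction_spanning:
  assumes "\<And>i. i < d \<Longrightarrow> ip n (direction i) x = 0" "k < n"
  shows "x k = 0"
proof -
  have "ip n (u i) x = 0" if i: "i < d" for i
  proof -
    have "ip n (u i) x = ip n (\<lambda>k. t i * direction i k) x" using i by (intro ip_cong) (auto simp: direction_eq)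
    then show ?thesis using assms(1)[OF i] by (simp only: ip_scale_left)
  qed
  then have "(\<Sum>i<d. ip n (u i) x * u i k) = 0" by simp
  then show ?thesis using tight_reconstruct[OF tight_u assms(2)] by simp
qed

lemma norm_on_polyhedral:
  assumes n: "0 < n"
  shows "norm_on n polyhedral_norm"
proof -
  have d: "0 < d" using tight_card[OF tight_u] n by simp
  note sub = sublinear_coord_max_abs[OF d]
  show ?thesis
    unfolding norm_on_def
  proof (intro conjI ballI allI)
    fix x :: "real vec" assume x: "x \<in> carrier_vec n"
    have ge: "\<bar>ip n (direction i) (\<lambda>k. x $ k)\<bar> \<le> polyhedral_norm x" if "i < d" for i
      unfolding polyhedral_norm_def using coord_max_ge[OF that, of "\<lambda>i. \<bar>ip n (direction i) (\<lambda>k. x $ k)\<bar>"] .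
    show nn: "0 \<le> polyhedral_norm x" using ge[OF d] by simp
    show "polyhedral_norm x = 0 \<longleftrightarrow> x = 0\<^sub>v n"
    proof
      assume "polyhedral_norm x = 0"
      then have "ip n (direction i) (\<lambda>k. x $ k) = 0" if "i < d" for i using ge[OF that] by simp
      from direction_spanning[OF this] show "x = 0\<^sub>v n" using x by (intro eq_vecI) auto
    next
      assume "x = 0\<^sub>v n"
      then have z: "ip n (direction i) (\<lambda>k. x $ k) = 0" for i by (simp add: ip_def)
      have "polyhedral_norm x \<le> 0" unfolding polyhedral_norm_def by (rule coord_max_le[OF d]) (simp add: z)
      then show "polyhedral_norm x = 0" using nn by simp
    qed
    show "polyhedral_norm (c \<cdot>\<^sub>v x) = \<bar>c\<bar> * polyhedral_norm x" for c
    proof -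
      have "ip n (direction i) (\<lambda>k. (c \<cdot>\<^sub>v x) $ k) = c * ip n (direction i) (\<lambda>k. x $ k)" for i
        unfolding ip_scale_right[symmetric] by (rule ip_cong) (use x in auto)
      then show ?thesis
        unfolding polyhedral_norm_def by (simp add: abs_mult coord_max_scale[OF d])
    qed
    fix y :: "real vec" assume y: "y \<in> carrier_vec n"
    have "ip n (direction i) (\<lambda>k. (x + y) $ k) = ip n (direction i) (\<lambda>k. x $ k) + ip n (direction i) (\<lambda>k. y $ k)" for i
      unfolding ip_add_right[symmetric] by (rule ip_cong) (use x y in auto)
    then show "polyhedral_norm (x + y) \<le> polyhedral_norm x + polyhedral_norm y"
      unfolding polyhedral_norm_def
      using sublinear_add[OF sub, of "\<lambda>i. ip n (direction i) (\<lambda>k. x $ k)" "\<lambda>i. ip n (direction i) (\<lambda>k. y $ k)"] by simp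
  qed
qed

text \<open>
  Trace duality. The embedding extends to the space of all \<open>d\<close>-tuples with the maximum norm, by
  \<open>dominated_functional\<close> in each coordinate of the sequence space; composing with \<open>Q\<close> turns the unit
  vectors into \<open>c i\<close>, which resolve the identity. So the trace \<open>B\<close> of the operator defined by the weights
  and signs, which maps the space into itself by \<open>invariant\<close>, can be computed through the \<open>c i\<close>, and each
  weight contributes at most \<open>onorm Q\<close>.
\<close>

lemma onorm_projection_ge:
  assumes n: "0 < n" and emb: "isometric_embedding n polyhedral_norm \<phi>"
    and Q: "Q \<in> projections_onto (\<phi> ` carrier_vec n)"
  shows "B \<le> onorm Q"
proof -
  interpret embedded_space n polyhedral_norm \<phi>
    by unfold_locales (use norm_on_polyhedral[OF n] emb in auto)
  have d: "0 < d" using tight_card[OF tight_u] n by simp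
  let ?v = direction
  have nrm_eq: "nrm x = coord_max d (\<lambda>i. \<bar>ip n (?v i) x\<bar>)" for x
  proof -
    have "ip n (?v i) (\<lambda>k. vec n x $ k) = ip n (?v i) x" for i by (rule ip_cong) auto
    then show ?thesis by (simp add: nrm_def polyhedral_norm_def)
  qed
  have dom: "ip n (coord k) x \<le> coord_max d (\<lambda>i. \<bar>ip n (?v i) x\<bar>)" for k x
    using norm_bounded[of "emb x" k] by (simp add: apply_emb norm_emb nrm_eq)
  define a where "a k = (SOME a. (\<Sum>i<d. \<bar>a i\<bar>) \<le> 1 \<and> (\<forall>x. ip n (coord k) x = (\<Sum>i<d. a i * ip n (?v i) x)))" for k
  have "(\<Sum>i<d. \<bar>a k i\<bar>) \<le> 1 \<and> (\<forall>x. ip n (coord k) x = (\<Sum>i<d. a k i * ip n (?v i) x))" for k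
    unfolding a_def by (rule someI_ex[OF dominated_functional[OF d dom]])
  then have a: "(\<Sum>i<d. \<bar>a k i\<bar>) \<le> 1" "ip n (coord k) x = (\<Sum>i<d. a k i * ip n (?v i) x)" for k x by blast+
  have a1: "\<bar>a k i\<bar> \<le> 1" if "i < d" for k i
  proof -
    have "\<bar>a k i\<bar> \<le> (\<Sum>i<d. \<bar>a k i\<bar>)" using that by (intro member_le_sum) auto
    then show ?thesis using a(1)[of k] by simp
  qed
  define y where "y i = Bcontfun (\<lambda>k. a k i)" for i
  have ap: "apply_bcontfun (y i) k = a k i" if "i < d" for i k
  proof -
    have "(\<lambda>k. a k i) \<in> bcontfun"
      by (rule bcontfun_normI[where b=1]) (use a1[OF that] in \<open>auto simp: continuous_on_discrete\<close>)
    then show ?thesis by (simp add: y_def Bcontfun_inverse)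
  qed
  have aps: "apply_bcontfun (\<Sum>i<d. f i) k = (\<Sum>i<d. apply_bcontfun (f i) k)" for f :: "nat \<Rightarrow> linfty" and k
  proof -
    have "apply_bcontfun (\<Sum>i<m. f i) k = (\<Sum>i<m. apply_bcontfun (f i) k)" for m :: nat by (induction m) auto
    then show ?thesis .
  qed
  have emb_y: "emb x = (\<Sum>i<d. ip n (?v i) x *\<^sub>R y i)" for x
    by (rule bcontfun_eqI) (simp add: aps apply_emb a(2) ap mult.commute cong: sum.cong_simp)
  have bl: "bounded_linear Q" and rg: "range Q = range emb" and fix_emb: "Q (emb x) = emb x" for x
    using Q unfolding projections_onto_def range_emb by auto
  interpret Q: bounded_linear Q by (rule bl)
  define c where "c i = (SOME x. Q (y i) = emb x)" for i
  have c: "Q (y i) = emb (c i)" for i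
  proof -
    have "Q (y i) \<in> range emb" using rg by blast
    then have "\<exists>x. Q (y i) = emb x" by auto
    then show ?thesis unfolding c_def by (rule someI_ex)
  qed
  have res: "(\<Sum>i<d. c i k * ?v i l) = (if k = l then 1 else 0)" if kl: "k < n" "l < n" for k l
  proof -
    define e where "e = (\<lambda>j. if j = l then 1 else (0::real))"
    have ve: "ip n (?v i) e = ?v i l" for i
    proof -
      have "ip n (?v i) e = (\<Sum>j<n. if j = l then ?v i j else 0)" unfolding ip_def e_def by (intro sum.cong) auto
      then show ?thesis using kl by simp
    qed
    have "emb e = Q (\<Sum>i<d. ip n (?v i) e *\<^sub>R y i)" using fix_emb[of e] emb_y[of e] by simp
    also have "\<dots> = (\<Sum>i<d. ip n (?v i) e *\<^sub>R emb (c i))" by (simp add: Q.sum Q.scaleR c)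
    also have "\<dots> = emb (\<lambda>k. \<Sum>i<d. ip n (?v i) e * c i k)" unfolding emb_sum emb_scale ..
    finally have "e k = (\<Sum>i<d. ip n (?v i) e * c i k)" using kl(1) unfolding emb_eq_iff by blast
    also have "\<dots> = (\<Sum>i<d. c i k * ?v i l)" by (simp only: ve mult.commute)
    finally show ?thesis by (simp add: e_def)
  qed
  have signs: "ip n (?v j) (\<lambda>k. \<Sum>i<d. s i * c i k) \<le> onorm Q" if s: "\<And>i. i < d \<Longrightarrow> \<bar>s i\<bar> \<le> 1" and j: "j < d" for s j
  proof -
    have "norm (\<Sum>i<d. s i *\<^sub>R y i) \<le> 1"
    proof (rule norm_bound)
      fix k
      have "apply_bcontfun (\<Sum>i<d. s i *\<^sub>R y i) k = (\<Sum>i<d. s i * a k i)"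
        unfolding aps by (intro sum.cong) (auto simp: ap)
      also have "norm \<dots> \<le> (\<Sum>i<d. \<bar>a k i\<bar>)"
        unfolding real_norm_def
        by (rule order_trans[OF sum_abs]) (intro sum_mono, simp add: abs_mult s mult_left_le_one_le)
      finally show "norm (apply_bcontfun (\<Sum>i<d. s i *\<^sub>R y i) k) \<le> 1" using a(1)[of k] by simp
    qed
    then have "norm (Q (\<Sum>i<d. s i *\<^sub>R y i)) \<le> onorm Q * 1"
      using onorm[OF bl] onorm_pos_le[OF bl] by (meson mult_left_mono order_trans)
    moreover have "Q (\<Sum>i<d. s i *\<^sub>R y i) = emb (\<lambda>k. \<Sum>i<d. s i * c i k)"
      unfolding emb_sum emb_scale by (simp add: Q.sum Q.scaleR c)
    ultimately have "nrm (\<lambda>k. \<Sum>i<d. s i * c i k) \<le> onorm Q" by (simp add: norm_emb)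
    moreover have "\<bar>ip n (?v j) (\<lambda>k. \<Sum>i<d. s i * c i k)\<bar> \<le> nrm (\<lambda>k. \<Sum>i<d. s i * c i k)"
      unfolding nrm_eq by (rule coord_max_ge[OF j])
    ultimately show ?thesis by simp
  qed
  define S where "S i j = sgn (ip n (u i) (u j))" for i j
  define X where "X i j = t i * t j * S i j" for i j
  define M where "M l k = bform {..<d} X (\<lambda>i. u i l) (\<lambda>i. u i k)" for l k
  have inv: "(\<Sum>j<d. X i j * u j k) = (\<Sum>l<n. u i l * M l k)" if "k < n" "i < d" for i k
    unfolding M_def X_def
    by (rule invariant) (use that in \<open>auto simp: S_def ip_commute sgn_if\<close>)
  \<comment> \<open>The invariance in the coordinates of the polyhedral space.\<close>
  have invv: "(\<Sum>j<d. (t j)\<^sup>2 * S j i * ?v j k) = (\<Sum>l<n. ?v i l * M l k)" if ki: "k < n" "i < d" for i k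
  proof -
    have "t i * (\<Sum>j<d. (t j)\<^sup>2 * S j i * ?v j k) = (\<Sum>j<d. X i j * u j k)"
      unfolding sum_distrib_left
      by (intro sum.cong refl) (simp add: X_def S_def ip_commute direction_eq power2_eq_square)
    also have "\<dots> = t i * (\<Sum>l<n. ?v i l * M l k)"
      unfolding inv[OF ki] sum_distrib_left by (intro sum.cong refl) (use ki in \<open>simp add: direction_eq\<close>)
    finally show ?thesis using pos[OF ki(2)] by simp
  qed
  have "B = (\<Sum>i<d. \<Sum>j<d. X i j * ip n (u i) (u j))"
    unfolding val[symmetric] frame_value_def by (intro sum.cong refl) (simp add: X_def S_def abs_sgn mult_ac)
  also have "\<dots> = (\<Sum>k<n. M k k)" unfolding M_def frame_trace ..
  also have "\<dots> = (\<Sum>k<n. \<Sum>l<n. M l k * (\<Sum>i<d. c i k * ?v i l))"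
  proof (intro sum.cong refl)
    fix k assume "k \<in> {..<n}"
    then have "(\<Sum>l<n. M l k * (\<Sum>i<d. c i k * ?v i l)) = (\<Sum>l<n. if k = l then M l k else 0)"
      by (intro sum.cong refl) (auto simp: res)
    then show "M k k = (\<Sum>l<n. M l k * (\<Sum>i<d. c i k * ?v i l))" using \<open>k \<in> {..<n}\<close> by simp
  qed
  also have "\<dots> = (\<Sum>k<n. \<Sum>i<d. c i k * (\<Sum>l<n. ?v i l * M l k))"
  proof (rule sum.cong[OF refl])
    fix k
    show "(\<Sum>l<n. M l k * (\<Sum>i<d. c i k * ?v i l)) = (\<Sum>i<d. c i k * (\<Sum>l<n. ?v i l * M l k))"
      unfolding sum_distrib_left by (subst sum.swap) (simp add: mult_ac)
  qed
  also have "\<dots> = (\<Sum>k<n. \<Sum>i<d. c i k * (\<Sum>j<d. (t j)\<^sup>2 * S j i * ?v j k))"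
    by (intro sum.cong refl) (simp add: invv)
  also have "\<dots> = (\<Sum>k<n. \<Sum>j<d. (t j)\<^sup>2 * (?v j k * (\<Sum>i<d. S j i * c i k)))"
  proof (rule sum.cong[OF refl])
    fix k
    show "(\<Sum>i<d. c i k * (\<Sum>j<d. (t j)\<^sup>2 * S j i * ?v j k)) = (\<Sum>j<d. (t j)\<^sup>2 * (?v j k * (\<Sum>i<d. S j i * c i k)))"
      unfolding sum_distrib_left by (subst sum.swap) (simp add: mult_ac)
  qed
  also have "\<dots> = (\<Sum>j<d. (t j)\<^sup>2 * ip n (?v j) (\<lambda>k. \<Sum>i<d. S j i * c i k))"
    unfolding ip_def by (subst sum.swap) (simp only: sum_distrib_left)
  also have "\<dots> \<le> (\<Sum>j<d. (t j)\<^sup>2 * onorm Q)"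
  proof (intro sum_mono mult_left_mono)
    fix j assume "j \<in> {..<d}"
    then show "ip n (?v j) (\<lambda>k. \<Sum>i<d. S j i * c i k) \<le> onorm Q"
      by (intro signs) (auto simp: S_def abs_sgn_eq)
  qed simp
  also have "\<dots> = onorm Q" using sum_t by (simp add: sum_distrib_right[symmetric])
  finally show ?thesis .
qed

lemma bound_nonneg: "0 \<le> B"
proof -
  have "0 \<le> frame_value n {..<d} t u"
    unfolding frame_value_def using pos by (intro sum_nonneg mult_nonneg_nonneg) (auto simp: less_imp_le)
  then show ?thesis by (simp add: val)
qed

lemma projection_constant_le_bound:
  assumes n: "0 < n" and N: "norm_on n N"
  shows "projection_constant n N \<le> B"
proof -
  interpret normed_vec n N by unfold_locales (rule N)
  interpret embedded_space n N "SOME \<phi>. isometric_embedding n N \<phi>"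
    by unfold_locales (rule someI_ex[OF isometric_embedding_exists])
  show ?thesis
    unfolding projection_constant_def by (rule projection_constant_le[OF bound bound_nonneg n])
qed

lemma projection_constant_polyhedral:
  assumes n: "0 < n"
  shows "projection_constant n polyhedral_norm = B"
proof (rule antisym)
  note N = norm_on_polyhedral[OF n]
  show "projection_constant n polyhedral_norm \<le> B" by (rule projection_constant_le_bound[OF n N])
  interpret normed_vec n polyhedral_norm by unfold_locales (rule N)
  define \<phi> where "\<phi> = (SOME \<phi>. isometric_embedding n polyhedral_norm \<phi>)"
  have emb: "isometric_embedding n polyhedral_norm \<phi>"
    unfolding \<phi>_def by (rule someI_ex[OF isometric_embedding_exists])
  interpret embedded_space n polyhedral_norm \<phi> by unfold_locales (rule emb)
  have "projections_onto (\<phi> ` carrier_vec n) \<noteq> {}"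
    using projection_exists[OF bound bound_nonneg n, of 1] by auto
  then show "B \<le> projection_constant n polyhedral_norm"
    unfolding projection_constant_def relative_projection_constant_def \<phi>_def[symmetric]
    by (intro cINF_greatest onorm_projection_ge[OF n emb])
qed

lemma maximal_projection_constant_eq:
  assumes n: "0 < n"
  shows "maximal_projection_constant n = B"
  unfolding maximal_projection_constant_def
proof (rule Greatest_equality)
  show "B \<in> {projection_constant n N |N. norm_on n N}"
    using projection_constant_polyhedral[OF n] norm_on_polyhedral[OF n] by force
  show "c \<le> B" if "c \<in> {projection_constant n N |N. norm_on n N}" for c
    using that projection_constant_le_bound[OF n] by blast
qed

end

theorem theorem1p4:
  fixes n :: nat
  assumes "n \<ge> 1"
  shows "sign_matrix_sup n = projection_sup n \<and>
         projection_sup n = maximal_projection_constant n \<and>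
         (\<exists>P \<in> orthogonal_projections_of_rank n.
            positive_mat (abs_mat P) \<and> real_spectral_radius (abs_mat P) = projection_sup n)"
proof -
  have n: "0 < n" using assms by simp
  from frame_maximum_exists[OF n] obtain B and d :: nat and t u where
    *: "weighted_frame n {..<d} t u" "\<forall>i<d. 0 < t i" "frame_value n {..<d} t u = B" "frame_bound n B" by blast
  interpret optimal_frame n d B t u by unfold_locales (use * in auto)
  show ?thesis
    using sign_matrix_sup_eq[OF n] projection_sup_eq[OF n] maximal_projection_constant_eq[OF n] optimal_gram[OF n]
    by (intro conjI bexI[of _ "mat d d (\<lambda>(i,j). ip n (u i) (u j))"]) simp_all
qed

end
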